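(* For each $r \ge 3$, there exists $\gamma > 0$ such that if $p=p(n) \le n^{-2/r+\gamma}$ and $\mu_r \to \infty$ as $n\to\infty$, then $$\mathbb{P}\big( H_r(G(n,p)) = H \big) = \pi^{e(H)} (1 - \pi)^{\binom{n}{r} - e(H)} \, p^{-t(H)} \, e^{- \Delta_2 +\Delta_2^0 + O(\omega \xi + n^{-\gamma})}$$ for every good $H$, where $$\xi = \begin{cases} n^5p^7 + \sqrt{n^5p^7} & \text{if } r = 3,\\ n^3p^6 + n^8p^{16} & \text{if } r = 4,\\ \mu_{r+1} & \text{if } r \ge 5.\end{cases}$$ Moreover, $H_r(G(n,p))$ is good with high probability (that is, with probability tending to $1$ as $n\to\infty$).
   Context: $G(n,p)$ is the binomial random graph with vertex set $V(K_n)$. For a graph $G$, $H_r(G)$ is the $r$-uniform hypergraph on $V(G)$ whose hyperedges are the $r$-sets $S$ with $G[S]\cong K_r$. For each $k$, $\mu_k=\binom{n}{k}p^{\binom{k}{2}}$; $\pi=p^{\binom r2}$. For an $r$-uniform hypergraph $H$, $e(H)$ is its number of hyperedges and $t(H)=\binom r2e(H)-e(G(H))$, where $G(H)$ is the graph formed by all pairs of vertices contained in some hyperedge of $H$. Let $N=\binom nr$, let $V_1,\ldots,V_N$ be the $r$-subsets of $V(K_n)$, let $E_i$ be the set of all $\binom r2$ pairs inside $V_i$, and let $A_i$ be the event $E_i\subset E(G(n,p))$. Write $i\sim j$ if $i\neq j$ and $E_i\cap E_j\ne\emptyset$. A 3-cluster is a set of three indices on which $\sim$ induces a connected graph. Let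 $$\Delta_2=\frac12\sum_{i\sim j}\mathbb{P}(A_i\cap A_j),\qquad \Delta_2^0=\frac12\sum_{i\sim j}\mathbb{P}(A_i)\mathbb{P}(A_j)$$ (sums over ordered pairs). For an $r$-uniform hypergraph $H$ on $V(K_n)$ let $Y=Y(H)=\{i:V_i\in E(H)\}$, $R=\bigcup_{i\in Y}E_i$, and $$Q_2(H)=\frac12\sum_{i\sim j}\mathbf{1}[i,j\in Y],\qquad Q_3(H)=\sum_{(i,j,k)}\mathbf{1}[i,j\in Y]\,\mathbb{P}(A_k\mid A_i),$$ the latter over ordered triples of distinct indices such that $\{i,j,k\}$ is a 3-cluster; $$Q_4(H)=\sum_{\substack{i\sim i'\sim j'\sim j\\ i'\not\sim j,\ i\not\sim j'}}\mathbf{1}[i,j\in Y]\,\mathbb{P}(A_{i'}\cap A_{j'}\mid A_i\cap A_j),$$ over 4-tuples of distinct indices; and $C(H)=\sum_j p^{|E_j\setminus R|}$, the sum being over those $j\notin Y$ for which there are at least two $i\in Y$ with $i\sim j$. An $r$-uniform hypergraph $H$ on $V(K_n)$ is good if $H=H_r(G)$ for some graph $G$, $|e(H)-\mu_r|\le\omega\sqrt{\mu_r}$, $Q_i(H)\le\omega\,\mathbb{E}[Q_i(H_r(G(n,p)))]$ for each $i\in\{2,3,4\}$, and $C(H)\le\omega\,\mathbb{E}[C(H_r(G(n,p)))]$. Here $\omega=\omega(n)\to\infty$ arbitrarily slowly, i.e. $\omega$ is any function tending to infinity sufficiently slowly (in particular one may take $\omega^2\le\mu_r$); the same $\omega$ is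 used in the definition of good and in the conclusion. Implicit constants are independent of $n$ and $H$. *)

theory Defs
  imports "HOL-Probability.Probability" "HOL-Library.Ramsey"
begin

text \<open>
  The complete graph \<open>K\<^sub>n\<close> has vertex set \<open>{..<n}\<close>. A graph on it is identified with its set
  of edges (a subset of \<open>nsets {..<n} 2\<close>), and an \<open>r\<close>-uniform hypergraph with its set of
  hyperedges (a subset of \<open>nsets {..<n} r\<close>), where \<open>nsets A k\<close> is the set of \<open>k\<close>-subsets of \<open>A\<close>.

  An \<open>r\<close>-subset serves as its own index: the index \<open>i\<close> with \<open>V\<^sub>i = S\<close> is \<open>S\<close> itself, so that
  \<open>E\<^sub>i\<close> is \<open>nsets S 2\<close>, the index set is \<open>nsets {..<n} r\<close>, and \<open>Y(H)\<close> is \<open>H\<close>.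
\<close>

definition gnp :: "nat \<Rightarrow> real \<Rightarrow> nat set set pmf" where
  "gnp n p = map_pmf (\<lambda>f. {e \<in> nsets {..<n} 2. f e})
     (Pi_pmf (nsets {..<n} 2) False (\<lambda>_. bernoulli_pmf p))"

definition clique_hypergraph :: "nat \<Rightarrow> nat \<Rightarrow> nat set set \<Rightarrow> nat set set" where
  "clique_hypergraph r n G = {S \<in> nsets {..<n} r. nsets S 2 \<subseteq> G}"

definition mu :: "nat \<Rightarrow> nat \<Rightarrow> real \<Rightarrow> real" where
  "mu k n p = real (n choose k) * p ^ (k choose 2)"

definition shadow :: "nat set set \<Rightarrow> nat set set" where
  "shadow H = (\<Union>S\<in>H. nsets S 2)"

text \<open>The graph \<open>G(H)\<close> and the edge set \<open>R\<close> are both \<open>shadow H\<close>.\<close>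

definition tH :: "nat \<Rightarrow> nat set set \<Rightarrow> int" where
  "tH r H = int (r choose 2) * int (card H) - int (card (shadow H))"

definition clique_ev :: "nat set \<Rightarrow> nat set set set" where
  "clique_ev S = {G. nsets S 2 \<subseteq> G}"

definition adj :: "nat set \<Rightarrow> nat set \<Rightarrow> bool" where
  "adj S T \<longleftrightarrow> S \<noteq> T \<and> nsets S 2 \<inter> nsets T 2 \<noteq> {}"

definition is_3_cluster :: "nat set set \<Rightarrow> bool" where
  "is_3_cluster K \<longleftrightarrow> card K = 3 \<and>
     (\<forall>S\<in>K. \<forall>T\<in>K. (S, T) \<in> {(A, B). A \<in> K \<and> B \<in> K \<and> adj A B}\<^sup>*)"

definition Delta2 :: "nat \<Rightarrow> nat \<Rightarrow> real \<Rightarrow> real" where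
  "Delta2 r n p = 1/2 *
     (\<Sum>(S, T) \<in> {(S, T). S \<in> nsets {..<n} r \<and> T \<in> nsets {..<n} r \<and> adj S T}.
        measure_pmf.prob (gnp n p) (clique_ev S \<inter> clique_ev T))"

definition Delta2_0 :: "nat \<Rightarrow> nat \<Rightarrow> real \<Rightarrow> real" where
  "Delta2_0 r n p = 1/2 *
     (\<Sum>(S, T) \<in> {(S, T). S \<in> nsets {..<n} r \<and> T \<in> nsets {..<n} r \<and> adj S T}.
        measure_pmf.prob (gnp n p) (clique_ev S) * measure_pmf.prob (gnp n p) (clique_ev T))"

definition Q2 :: "nat \<Rightarrow> nat \<Rightarrow> nat set set \<Rightarrow> real" where
  "Q2 r n H = 1/2 *
     (\<Sum>(S, T) \<in> {(S, T). S \<in> nsets {..<n} r \<and> T \<in> nsets {..<n} r \<and> adj S T}.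
        of_bool (S \<in> H \<and> T \<in> H))"

definition Q3 :: "nat \<Rightarrow> nat \<Rightarrow> real \<Rightarrow> nat set set \<Rightarrow> real" where
  "Q3 r n p H =
     (\<Sum>(S, T, U) \<in> {(S, T, U). S \<in> nsets {..<n} r \<and> T \<in> nsets {..<n} r \<and> U \<in> nsets {..<n} r \<and>
          distinct [S, T, U] \<and> is_3_cluster {S, T, U}}.
        of_bool (S \<in> H \<and> T \<in> H) *
        \<P>(G in measure_pmf (gnp n p). G \<in> clique_ev U \<bar> G \<in> clique_ev S))"

text \<open>The tuple \<open>(S, S', T', T)\<close> below stands for \<open>(i, i', j', j)\<close>.\<close>

definition Q4 :: "nat \<Rightarrow> nat \<Rightarrow> real \<Rightarrow> nat set set \<Rightarrow> real" where
  "Q4 r n p H =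
     (\<Sum>(S, S', T', T) \<in> {(S, S', T', T).
          S \<in> nsets {..<n} r \<and> S' \<in> nsets {..<n} r \<and> T' \<in> nsets {..<n} r \<and> T \<in> nsets {..<n} r \<and>
          distinct [S, S', T', T] \<and>
          adj S S' \<and> adj S' T' \<and> adj T' T \<and> \<not> adj S' T \<and> \<not> adj S T'}.
        of_bool (S \<in> H \<and> T \<in> H) *
        \<P>(G in measure_pmf (gnp n p). G \<in> clique_ev S' \<inter> clique_ev T' \<bar>
           G \<in> clique_ev S \<inter> clique_ev T))"

definition CH :: "nat \<Rightarrow> nat \<Rightarrow> real \<Rightarrow> nat set set \<Rightarrow> real" where
  "CH r n p H =
     (\<Sum>T \<in> {T \<in> nsets {..<n} r. T \<notin> H \<and> 2 \<le> card {S \<in> H. adj S T}}.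
        p ^ card (nsets T 2 - shadow H))"

text \<open>The real parameter \<open>w\<close> is the value \<open>\<omega>(n)\<close>.\<close>

definition good :: "nat \<Rightarrow> nat \<Rightarrow> real \<Rightarrow> real \<Rightarrow> nat set set \<Rightarrow> bool" where
  "good r n p w H \<longleftrightarrow>
     (\<exists>G \<subseteq> nsets {..<n} 2. H = clique_hypergraph r n G) \<and>
     \<bar>real (card H) - mu r n p\<bar> \<le> w * sqrt (mu r n p) \<and>
     Q2 r n H \<le> w * measure_pmf.expectation (gnp n p) (\<lambda>G. Q2 r n (clique_hypergraph r n G)) \<and>
     Q3 r n p H \<le> w * measure_pmf.expectation (gnp n p) (\<lambda>G. Q3 r n p (clique_hypergraph r n G)) \<and>
     Q4 r n p H \<le> w * measure_pmf.expectation (gnp n p) (\<lambda>G. Q4 r n p (clique_hypergraph r n G)) \<and>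
     CH r n p H \<le> w * measure_pmf.expectation (gnp n p) (\<lambda>G. CH r n p (clique_hypergraph r n G))"

text \<open>The relevant range is \<open>r \<ge> 3\<close>.\<close>

definition xi :: "nat \<Rightarrow> nat \<Rightarrow> real \<Rightarrow> real" where
  "xi r n p =
     (if r = 3 then real n ^ 5 * p ^ 7 + sqrt (real n ^ 5 * p ^ 7)
      else if r = 4 then real n ^ 3 * p ^ 6 + real n ^ 8 * p ^ 16
      else mu (r + 1) n p)"

end

theory Submission
  imports Defs
begin

text \<open>
  Conditioning on the edges of \<open>shadow H\<close>, the event \<open>H\<^sub>r(G(n,p)) = H\<close> says that no \<open>r\<close>-set
  \<open>T \<notin> H\<close> has all its remaining edges \<open>F T = E\<^sub>T - shadow H\<close> present. Revealing these events one at
  a time, and estimating each conditional probability by forcing edges (a forced set can only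
  decrease the probability of avoiding other sets, which replaces Harris' inequality) together with
  the first two Bonferroni inequalities, gives the avoidance probability up to a factor
  \<open>exp\<close> of a sum over 3-clusters.

  The \<open>r\<close>-sets outside \<open>H\<close> are split by their number of neighbours in \<open>H\<close>. Those with at least two
  cost only a factor \<open>exp (O(C(H)))\<close>. Those with exactly one, of which there are about \<open>2 \<Delta>\<^sub>2\<close> in
  conditional expectation, need only a first-order estimate, whose error is bounded by \<open>Q\<^sub>4(H)\<close>
  and 3-clusters; they contribute \<open>-2 (\<Delta>\<^sub>2 - \<Delta>\<^sub>2\<^sup>0)\<close>. Those with none have their unconditional
  probability, so that the second-order estimate, contributing \<open>\<Delta>\<^sub>2 - \<Delta>\<^sub>2\<^sup>0\<close>, has an error free of \<open>H\<close>.
  Adding a clique to a cluster never increases its expected number when \<open>p \<le> n powr (-2/r + \<gamma>)\<close>,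
  so all errors are governed by the 3-clusters, that is, by \<open>\<xi>\<close>.
\<close>

section \<open>Random subsets\<close>

text \<open>All error terms are sums of monomials n^v p^d, whose exponent at p = n powr (-2/r) is v
  - 2 d / r. If r v < 2 d, such a monomial stays below a fixed negative power of n for small
  \<gamma>; the monomials with r v >= 2 d are what \<xi> has to record. For r >= 5 only K_(r+1) is
  left: two cliques sharing r - 1 vertices with a third one inside their union. For r = 3 and r = 4
  further cluster types survive, so these cases are computed separately.

  The obstacle is that the sets \<open>F T\<close> depend on \<open>H\<close>. Whatever depends on
  \<open>H\<close> must therefore be charged to one of the statistics bounded by goodness, or to
  3-clusters through a fixed member of \<open>H\<close>, whose number is close to \<mu>. The
  different weights of the two correlation terms come from counting: the surplus that members of
  \<open>H\<close> give to their neighbours is a sum over ordered pairs, whereas the correlations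
  inside \<open>J0\<close> enter the logarithm once per unordered pair.

  Probabilities are finite weighted sums rather than integrals, so that induction on the edge set
  applies.\<close>

definition bexp :: "'e set \<Rightarrow> real \<Rightarrow> ('e set \<Rightarrow> real) \<Rightarrow> real" where
  "bexp E p f = (\<Sum>G\<in>Pow E. p ^ card G * (1 - p) ^ card (E - G) * f G)"

lemma bexp_empty [simp]: "bexp {} p f = f {}"
  by (simp add: bexp_def)

lemma bexp_insert:
  assumes "finite E" "x \<notin> E"
  shows "bexp (insert x E) p f = p * bexp E p (\<lambda>G. f (insert x G)) + (1 - p) * bexp E p f"
proof -
  have disj: "Pow E \<inter> insert x ` Pow E = {}" and inj: "inj_on (insert x) (Pow E)"
    using assms by (auto simp: inj_on_def)
  have 1: "p ^ card G * (1 - p) ^ card (insert x E - G) * f G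
      = (1 - p) * (p ^ card G * (1 - p) ^ card (E - G) * f G)" if "G \<in> Pow E" for G
  proof -
    have "insert x E - G = insert x (E - G)" using that assms by auto
    then show ?thesis using assms by simp
  qed
  have 2: "p ^ card (insert x G) * (1 - p) ^ card (insert x E - insert x G) * f (insert x G)
      = p * (p ^ card G * (1 - p) ^ card (E - G) * f (insert x G))" if "G \<in> Pow E" for G
  proof -
    have "insert x E - insert x G = E - G" "finite G" "x \<notin> G"
      using that assms by (auto intro: finite_subset)
    then show ?thesis by simp
  qed
  have "bexp (insert x E) p f =
      (\<Sum>G\<in>Pow E. p ^ card G * (1 - p) ^ card (insert x E - G) * f G)
    + (\<Sum>G\<in>insert x ` Pow E. p ^ card G * (1 - p) ^ card (insert x E - G) * f G)"
    unfolding bexp_def Pow_insert using assms disj by (intro sum.union_disjoint) auto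
  also have "\<dots> = (1 - p) * bexp E p f + p * bexp E p (\<lambda>G. f (insert x G))"
    unfolding bexp_def sum.reindex[OF inj] o_def sum_distrib_left
    using 1 2 by (intro arg_cong2[where f="(+)"] sum.cong) auto
  finally show ?thesis by simp
qed

lemma bexp_const [simp]: "finite E \<Longrightarrow> bexp E p (\<lambda>_. c) = c"
  by (induction rule: finite_induct) (auto simp: bexp_insert algebra_simps)

lemma bexp_add: "bexp E p (\<lambda>G. f G + g G) = bexp E p f + bexp E p g"
  by (simp add: bexp_def algebra_simps sum.distrib)

lemma bexp_diff: "bexp E p (\<lambda>G. f G - g G) = bexp E p f - bexp E p g"
  by (simp add: bexp_def algebra_simps sum_subtractf)

lemma bexp_cmult: "bexp E p (\<lambda>G. c * f G) = c * bexp E p f"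
  by (simp add: bexp_def algebra_simps sum_distrib_left)

lemma bexp_sum: "bexp E p (\<lambda>G. \<Sum>i\<in>I. f i G) = (\<Sum>i\<in>I. bexp E p (f i))"
  unfolding bexp_def sum_distrib_left by (rule sum.swap)

lemma bexp_mono:
  assumes "0 \<le> p" "p \<le> 1" "\<And>G. G \<subseteq> E \<Longrightarrow> f G \<le> g G"
  shows "bexp E p f \<le> bexp E p g"
  unfolding bexp_def using assms by (intro sum_mono mult_left_mono) auto

lemma bexp_cong: "(\<And>G. G \<subseteq> E \<Longrightarrow> f G = g G) \<Longrightarrow> bexp E p f = bexp E p g"
  unfolding bexp_def by (intro sum.cong) auto

lemma bexp_force_insert:
  assumes "finite E" "x \<in> E"
  shows "bexp E p (\<lambda>G. of_bool (x \<in> G) * f G) = p * bexp E p (\<lambda>G. f (insert x G))"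
proof -
  define E' where "E' = E - {x}"
  have E: "E = insert x E'" "x \<notin> E'" "finite E'" using assms by (auto simp: E'_def)
  have "bexp E' p (\<lambda>G. of_bool (x \<in> G) * f G) = bexp E' p (\<lambda>_. 0)"
    using E by (intro bexp_cong) auto
  then show ?thesis unfolding E(1) using E by (simp add: bexp_insert algebra_simps)
qed

text \<open>The edges outside X are independent of those in X, so conditioning on X being present
  has the same effect as adding X to the random set. All correlation estimates below rest on this
  identity.\<close>

lemma bexp_force:
  assumes "finite E" "X \<subseteq> E"
  shows "bexp E p (\<lambda>G. of_bool (X \<subseteq> G) * f G) = p ^ card X * bexp E p (\<lambda>G. f (G \<union> X))"
proof -
  have "finite X" using assms finite_subset by blast
  then show ?thesis using assms(2)
  proof (induction arbitrary: f rule: finite_induct)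
    case (insert x X)
    have "bexp E p (\<lambda>G. of_bool (insert x X \<subseteq> G) * f G)
      = bexp E p (\<lambda>G. of_bool (x \<in> G) * (of_bool (X \<subseteq> G) * f G))"
      by (intro bexp_cong) auto
    also have "\<dots> = p * bexp E p (\<lambda>G. of_bool (X \<subseteq> insert x G) * f (insert x G))"
      using insert assms by (subst bexp_force_insert) auto
    also have "\<dots> = p * bexp E p (\<lambda>G. of_bool (X \<subseteq> G) * f (insert x G))"
      using insert by (intro arg_cong[where f="(*) p"] bexp_cong) auto
    also have "\<dots> = p * (p ^ card X * bexp E p (\<lambda>G. f (insert x (G \<union> X))))"
      using insert by simp
    finally show ?case using insert by simp
  qed simp
qed

lemma bexp_subset:
  assumes "finite E" "X \<subseteq> E"
  shows "bexp E p (\<lambda>G. of_bool (X \<subseteq> G)) = p ^ card X"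
  using bexp_force[OF assms, of p "\<lambda>_. 1"] assms by simp

lemma bexp_pos:
  assumes "finite E" "0 < p" "p < 1" "\<And>G. G \<subseteq> E \<Longrightarrow> 0 \<le> f G" "0 < f {}"
  shows "0 < bexp E p f"
  unfolding bexp_def by (rule sum_pos2[of _ "{}"]) (use assms in auto)

lemma bexp_eq_0_imp:
  assumes "finite E" "0 < p" "p < 1" "\<And>G. G \<subseteq> E \<Longrightarrow> 0 \<le> f G" "bexp E p f = 0" "G \<subseteq> E"
  shows "f G = 0"
proof -
  have "\<forall>G\<in>Pow E. p ^ card G * (1 - p) ^ card (E - G) * f G = 0"
    using assms(1-5) unfolding bexp_def by (subst sum_nonneg_eq_0_iff[symmetric]) auto
  then show ?thesis using assms(2,3,6) by auto
qed

text \<open>Markov's inequality at the threshold w times the mean. If the mean is 0 there is nothing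
  to divide by, but then f vanishes on every subset because each has positive weight.\<close>

lemma bexp_markov:
  assumes "finite E" "0 < p" "p < 1" "\<And>G. G \<subseteq> E \<Longrightarrow> 0 \<le> f G" "0 < w"
  shows "bexp E p (\<lambda>G. of_bool (\<not> f G \<le> w * bexp E p f)) \<le> 1 / w"
proof (cases "bexp E p f = 0")
  case True
  then have "bexp E p (\<lambda>G. of_bool (\<not> f G \<le> w * bexp E p f)) = bexp E p (\<lambda>_. 0)"
    using bexp_eq_0_imp[OF assms(1-4) True] by (intro bexp_cong) simp
  then show ?thesis using assms by simp
next
  case False
  let ?m = "bexp E p f"
  have "bexp E p (\<lambda>_. 0) \<le> ?m" using assms by (intro bexp_mono) auto
  then have pos: "0 < ?m" using False assms(1) by simp
  have "bexp E p (\<lambda>G. (w * ?m) * of_bool (\<not> f G \<le> w * ?m)) \<le> ?m"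
    using assms pos by (intro bexp_mono) auto
  then have "(w * ?m) * bexp E p (\<lambda>G. of_bool (\<not> f G \<le> w * ?m)) \<le> ?m"
    by (simp only: bexp_cmult)
  then show ?thesis using pos assms(5) by (simp add: field_simps)
qed

lemma bexp_multc: "bexp E p (\<lambda>G. f G * c) = c * bexp E p f"
  using bexp_cmult[of E p c f] by (simp add: mult.commute)

lemma expectation_random_subset:
  assumes "finite E" "0 < p" "p < 1"
  shows "measure_pmf.expectation (map_pmf (\<lambda>f. {e \<in> E. f e}) (Pi_pmf E False (\<lambda>_. bernoulli_pmf p))) f
    = bexp E p f"
proof -
  let ?M = "Pi_pmf E False (\<lambda>_. bernoulli_pmf p)"
  let ?h = "\<lambda>f. {e \<in> E. f e}"
  have sub: "set_pmf ?M \<subseteq> {f. \<forall>x. x \<notin> E \<longrightarrow> f x = False}"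
    by (rule set_Pi_pmf_subset[OF assms(1)])
  \<comment> \<open>Outside E every function in the support has the default value
    \<open>False\<close>, so it is determined by the set of edges it selects.\<close>
  have inj: "inj_on ?h (set_pmf ?M)"
  proof (intro inj_onI ext)
    fix f g x assume "f \<in> set_pmf ?M" "g \<in> set_pmf ?M" and eq: "?h f = ?h g"
    then have "x \<notin> E \<Longrightarrow> f x = g x" using sub by auto
    moreover have "x \<in> E \<Longrightarrow> f x = g x" using eq by (auto simp: set_eq_iff)
    ultimately show "f x = g x" by blast
  qed
  have pm: "pmf (map_pmf ?h ?M) G = p ^ card G * (1 - p) ^ card (E - G)" if "G \<subseteq> E" for G
  proof -
    let ?g = "\<lambda>e. e \<in> G"
    have hg: "?h ?g = G" using that by auto
    have val: "pmf ?M ?g = (\<Prod>x\<in>E. if x \<in> G then p else 1 - p)"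
      using that assms by (subst pmf_Pi') (auto intro!: prod.cong)
    also have "\<dots> = (\<Prod>x\<in>E \<inter> G. p) * (\<Prod>x\<in>E - G. 1 - p)"
      by (subst prod.If_cases[OF assms(1)], intro arg_cong2[where f="(*)"] prod.cong) auto
    also have "\<dots> = p ^ card G * (1 - p) ^ card (E - G)" using that by (simp add: Int_absorb1)
    finally have v: "pmf ?M ?g = p ^ card G * (1 - p) ^ card (E - G)" .
    then have "?g \<in> set_pmf ?M" using assms by (simp add: set_pmf_iff)
    from pmf_map_inj[OF inj this] v hg show ?thesis by simp
  qed
  have "measure_pmf.expectation (map_pmf ?h ?M) f = (\<Sum>G\<in>Pow E. f G * pmf (map_pmf ?h ?M) G)"
    using assms by (intro integral_measure_pmf_real) auto
  then show ?thesis unfolding bexp_def using pm by (auto intro!: sum.cong)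
qed

section \<open>Avoidance probabilities and forced sets\<close>

definition avoids :: "('i \<Rightarrow> 'e set) \<Rightarrow> 'i set \<Rightarrow> 'e set \<Rightarrow> bool" where
  "avoids F K G \<longleftrightarrow> (\<forall>k\<in>K. \<not> F k \<subseteq> G)"

text \<open>Nonemptiness of the sets \<open>F i\<close> means that the empty set avoids all of them;
  avoidance probabilities are then positive, so one may divide by them and take logarithms.\<close>

locale set_family =
  fixes E :: "'e set" and p :: real and F :: "'i \<Rightarrow> 'e set" and I :: "'i set"
  assumes finE: "finite E" and finI: "finite I" and p0: "0 < p" and p1: "p < 1"
    and F_sub: "\<And>i. i \<in> I \<Longrightarrow> F i \<subseteq> E" and F_ne: "\<And>i. i \<in> I \<Longrightarrow> F i \<noteq> {}"
begin

definition pr :: "('e set \<Rightarrow> bool) \<Rightarrow> real" where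
  "pr P = bexp E p (\<lambda>G. of_bool (P G))"

lemma pr_nonneg: "0 \<le> pr P"
  using bexp_mono[of p E "\<lambda>_. 0" "\<lambda>G. of_bool (P G)"] finE p0 p1 by (simp add: pr_def)

lemma pr_mono: "(\<And>G. G \<subseteq> E \<Longrightarrow> P G \<Longrightarrow> Q G) \<Longrightarrow> pr P \<le> pr Q"
  unfolding pr_def using p0 p1 by (intro bexp_mono) auto

lemma pr_force: "X \<subseteq> E \<Longrightarrow> pr (\<lambda>G. X \<subseteq> G \<and> P G) = p ^ card X * pr (\<lambda>G. P (G \<union> X))"
  unfolding pr_def using bexp_force[OF finE, of X p "\<lambda>G. of_bool (P G)"] by (simp add: of_bool_conj)

lemma pr_avoids_pos: "K \<subseteq> I \<Longrightarrow> 0 < pr (avoids F K)"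
  unfolding pr_def using finE p0 p1 F_ne by (intro bexp_pos) (auto simp: avoids_def)

lemma avoids_mono: "K \<subseteq> L \<Longrightarrow> avoids F L G \<Longrightarrow> avoids F K G"
  by (auto simp: avoids_def)

lemma pr_avoids_antimono: "K \<subseteq> L \<Longrightarrow> pr (avoids F L) \<le> pr (avoids F K)"
  by (intro pr_mono) (rule avoids_mono)

lemma pr_split: "pr P = pr (\<lambda>G. Q G \<and> P G) + pr (\<lambda>G. \<not> Q G \<and> P G)"
  unfolding pr_def bexp_add[symmetric] by (intro bexp_cong) auto

lemma pr_avoids_insert:
  "pr (avoids F (insert j K)) = pr (avoids F K) - pr (\<lambda>G. F j \<subseteq> G \<and> avoids F K G)"
  using pr_split[of "avoids F K" "\<lambda>G. F j \<subseteq> G"] by (simp add: avoids_def[abs_def])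

text \<open>Adding X to G can only destroy avoidance. This is the instance of Harris' inequality
  that the proof uses, obtained directly from forcing.\<close>

lemma pr_force_avoids_le: "X \<subseteq> E \<Longrightarrow> pr (\<lambda>G. X \<subseteq> G \<and> avoids F K G) \<le> p ^ card X * pr (avoids F K)"
  using p0 by (subst pr_force) (simp_all, intro pr_mono, unfold avoids_def, blast)

lemma pr_force_avoids_eq:
  assumes "X \<subseteq> E" "\<And>k. k \<in> K \<Longrightarrow> F k \<inter> X = {}"
  shows "pr (\<lambda>G. X \<subseteq> G \<and> avoids F K G) = p ^ card X * pr (avoids F K)"
proof -
  have "avoids F K (G \<union> X) = avoids F K G" for G
    unfolding avoids_def using assms(2) by blast
  then show ?thesis using assms by (subst pr_force) auto
qed

lemma union_bound:
  assumes "finite K"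
  shows "pr (\<lambda>G. P G \<and> (\<exists>k\<in>K. Q k G)) \<le> (\<Sum>k\<in>K. pr (\<lambda>G. P G \<and> Q k G))"
proof -
  have "of_bool (P G \<and> (\<exists>k\<in>K. Q k G)) \<le> (\<Sum>k\<in>K. of_bool (P G \<and> Q k G) :: real)" for G
  proof (cases "P G \<and> (\<exists>k\<in>K. Q k G)")
    case True
    then obtain k where k: "k \<in> K" "P G" "Q k G" by auto
    have "of_bool (P G \<and> Q k G) \<le> (\<Sum>k\<in>K. of_bool (P G \<and> Q k G) :: real)"
      by (rule member_le_sum) (use k assms in auto)
    then show ?thesis using k by simp
  qed (simp add: sum_nonneg)
  then show ?thesis unfolding pr_def bexp_sum[symmetric] using p0 p1 by (intro bexp_mono) auto
qed

text \<open>The subtracted sum runs over ordered pairs, twice the usual term, which affects only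
  constants. Pointwise it says m <= 1 + m (m - 1), where m >= 1 is the number of true
  \<open>Q k G\<close>.\<close>

lemma bonferroni:
  assumes "finite K"
  shows "(\<Sum>k\<in>K. pr (\<lambda>G. P G \<and> Q k G))
      - (\<Sum>(k,l)\<in>{(k,l). k \<in> K \<and> l \<in> K \<and> k \<noteq> l}. pr (\<lambda>G. P G \<and> Q k G \<and> Q l G))
    \<le> pr (\<lambda>G. P G \<and> (\<exists>k\<in>K. Q k G))"
proof -
  let ?D = "{(k,l). k \<in> K \<and> l \<in> K \<and> k \<noteq> l}"
  have finD: "finite ?D" using assms by (auto intro: finite_subset[of _ "K \<times> K"])
  have "(\<Sum>k\<in>K. of_bool (P G \<and> Q k G)) \<le>
    of_bool (P G \<and> (\<exists>k\<in>K. Q k G)) + (\<Sum>(k,l)\<in>?D. of_bool (P G \<and> Q k G \<and> Q l G) :: real)" for G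
  proof (cases "P G")
    case True
    define A where "A = {k \<in> K. Q k G}"
    have fA: "finite A" using assms by (auto simp: A_def)
    have 1: "(\<Sum>k\<in>K. of_bool (P G \<and> Q k G)) = (real (card A))"
      using assms True by (simp add: A_def of_bool_def sum.If_cases Int_def)
    have "(\<Sum>(k,l)\<in>?D. of_bool (P G \<and> Q k G \<and> Q l G) :: real)
      = (\<Sum>x\<in>?D. of_bool (x \<in> {(k,l). k \<in> A \<and> l \<in> A \<and> k \<noteq> l}))"
      using True by (intro sum.cong) (auto simp: A_def)
    also have "\<dots> = real (card (?D \<inter> {(k,l). k \<in> A \<and> l \<in> A \<and> k \<noteq> l}))"
      using finD by (simp add: of_bool_def sum.If_cases Int_def)
    also have "?D \<inter> {(k,l). k \<in> A \<and> l \<in> A \<and> k \<noteq> l} = (A \<times> A) - Id_on A"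
      by (auto simp: A_def)
    finally have 2: "(\<Sum>(k,l)\<in>?D. of_bool (P G \<and> Q k G \<and> Q l G) :: real) = card ((A \<times> A) - Id_on A)" .
    show ?thesis
    proof (cases "A = {}")
      case True
      have "0 \<le> (\<Sum>(k,l)\<in>?D. of_bool (P G \<and> Q k G \<and> Q l G) :: real)"
        by (intro sum_nonneg) auto
      moreover have "(\<Sum>k\<in>K. of_bool (P G \<and> Q k G)) = (0::real)" using 1 True by simp
      ultimately show ?thesis by (simp only:) (intro add_nonneg_nonneg, simp)
    next
      case False
      then obtain a where a: "a \<in> A" by auto
      have "(\<lambda>l. (a, l)) ` (A - {a}) \<subseteq> (A \<times> A) - Id_on A" using a by auto
      then have "card ((\<lambda>l. (a, l)) ` (A - {a})) \<le> card ((A \<times> A) - Id_on A)"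
        using fA by (intro card_mono) auto
      moreover have "card ((\<lambda>l. (a, l)) ` (A - {a})) = card A - 1"
        using a fA by (subst card_image) (auto simp: inj_on_def)
      moreover have "P G \<and> (\<exists>k\<in>K. Q k G)" using a True by (auto simp: A_def)
      ultimately show ?thesis using 1 2 by simp
    qed
  qed simp
  then have "bexp E p (\<lambda>G. \<Sum>k\<in>K. of_bool (P G \<and> Q k G)) \<le>
     bexp E p (\<lambda>G. of_bool (P G \<and> (\<exists>k\<in>K. Q k G)) + (\<Sum>x\<in>?D. of_bool (P G \<and> Q (fst x) G \<and> Q (snd x) G)))"
    using p0 p1 by (intro bexp_mono) (auto simp: case_prod_beta)
  then show ?thesis
    by (simp add: pr_def bexp_sum bexp_add case_prod_beta)
qed

text \<open>Sets \<open>F k\<close> disjoint from X do not notice the forcing; each of the others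
  costs at most the probability of X and \<open>F k\<close> together, relative to avoiding the
  disjoint ones. Replacing that avoidance probability by the smaller one for K weakens the bound if
  the first factor is nonnegative, and otherwise the left side is at most 0.\<close>

lemma pr_force_avoids_ge:
  assumes "X \<subseteq> E" "K \<subseteq> I"
  shows "(p ^ card X - (\<Sum>k\<in>{k\<in>K. F k \<inter> X \<noteq> {}}. p ^ card (X \<union> F k))) * pr (avoids F K)
    \<le> pr (\<lambda>G. X \<subseteq> G \<and> avoids F K G)"
proof -
  let ?N = "{k\<in>K. F k \<inter> X \<noteq> {}}" and ?D = "{k\<in>K. F k \<inter> X = {}}"
  let ?c = "p ^ card X - (\<Sum>k\<in>?N. p ^ card (X \<union> F k))"
  let ?V = "\<lambda>k. pr (\<lambda>G. (X \<subseteq> G \<and> avoids F ?D G) \<and> F k \<subseteq> G)"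
  have finN: "finite ?N" using finI assms by (auto intro: finite_subset)
  have "p ^ card X * pr (avoids F ?D) = pr (\<lambda>G. X \<subseteq> G \<and> avoids F ?D G)"
    using assms by (intro pr_force_avoids_eq[symmetric]) auto
  moreover have "pr (\<lambda>G. X \<subseteq> G \<and> avoids F ?D G)
     = pr (\<lambda>G. (X \<subseteq> G \<and> avoids F ?D G) \<and> (\<exists>k\<in>?N. F k \<subseteq> G))
     + pr (\<lambda>G. X \<subseteq> G \<and> avoids F K G)"
    by (subst pr_split[of _ "\<lambda>G. \<exists>k\<in>?N. F k \<subseteq> G"],
        intro arg_cong2[where f="(+)"] arg_cong[where f=pr] ext) (auto simp: avoids_def)
  moreover have "pr (\<lambda>G. (X \<subseteq> G \<and> avoids F ?D G) \<and> (\<exists>k\<in>?N. F k \<subseteq> G))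
      \<le> (\<Sum>k\<in>?N. ?V k)"
    using finN by (rule union_bound)
  moreover have "(\<Sum>k\<in>?N. ?V k)
      \<le> (\<Sum>k\<in>?N. p ^ card (X \<union> F k) * pr (avoids F ?D))"
  proof (rule sum_mono)
    fix k assume k: "k \<in> ?N"
    have "?V k = pr (\<lambda>G. X \<union> F k \<subseteq> G \<and> avoids F ?D G)"
      by (intro arg_cong[where f=pr] ext) auto
    also have "\<dots> \<le> p ^ card (X \<union> F k) * pr (avoids F ?D)"
      using k assms F_sub by (intro pr_force_avoids_le) blast
    finally show "?V k \<le> p ^ card (X \<union> F k) * pr (avoids F ?D)" .
  qed
  ultimately have *: "?c * pr (avoids F ?D) \<le> pr (\<lambda>G. X \<subseteq> G \<and> avoids F K G)"
    by (simp add: left_diff_distrib sum_distrib_right)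
  show ?thesis
  proof (cases "?c \<ge> 0")
    case True
    have "?c * pr (avoids F K) \<le> ?c * pr (avoids F ?D)"
      using True by (intro mult_left_mono pr_avoids_antimono) auto
    with * show ?thesis by linarith
  next
    case False
    then have "?c * pr (avoids F K) \<le> 0" using pr_nonneg[of "avoids F K"] by (simp add: mult_nonpos_nonneg)
    also have "0 \<le> pr (\<lambda>G. X \<subseteq> G \<and> avoids F K G)" by (rule pr_nonneg)
    finally show ?thesis .
  qed
qed

end

section \<open>Second-order estimate of avoidance probabilities\<close>

text \<open>A new index j occurs once in either position of an ordered pair. The resulting factor 2
  is why the increments of the revealing process add up to half of a symmetric double sum.\<close>

lemma sum_symmetric_insert:
  fixes f :: "'i \<Rightarrow> 'i \<Rightarrow> real"
  assumes "finite K" "j \<notin> K" "\<And>i k. \<rho> i k \<longleftrightarrow> \<rho> k i" "\<And>i k. f i k = f k i"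
  shows "(\<Sum>i\<in>insert j K. \<Sum>k\<in>{k\<in>insert j K. k \<noteq> i \<and> \<rho> k i}. f i k)
    = (\<Sum>i\<in>K. \<Sum>k\<in>{k\<in>K. k \<noteq> i \<and> \<rho> k i}. f i k) + 2 * (\<Sum>k\<in>{k\<in>K. \<rho> k j}. f j k)"
proof -
  have 1: "{k\<in>insert j K. k \<noteq> j \<and> \<rho> k j} = {k\<in>K. \<rho> k j}" using assms by auto
  have 2: "(\<Sum>k\<in>{k\<in>insert j K. k \<noteq> i \<and> \<rho> k i}. f i k)
     = (\<Sum>k\<in>{k\<in>K. k \<noteq> i \<and> \<rho> k i}. f i k) + (if \<rho> i j then f j i else 0)" if "i \<in> K" for i
  proof -
    have "{k\<in>insert j K. k \<noteq> i \<and> \<rho> k i}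
      = (if \<rho> i j then insert j {k\<in>K. k \<noteq> i \<and> \<rho> k i} else {k\<in>K. k \<noteq> i \<and> \<rho> k i})"
      using that assms(2,3) by auto
    then show ?thesis using assms by (auto simp: add.commute)
  qed
  have "(\<Sum>i\<in>K. if \<rho> i j then f j i else 0) = (\<Sum>i\<in>{i\<in>K. \<rho> i j}. f j i)"
    using assms(1) by (simp add: sum.inter_filter)
  moreover have "(\<Sum>i\<in>K. \<Sum>k\<in>{k\<in>insert j K. k \<noteq> i \<and> \<rho> k i}. f i k)
     = (\<Sum>i\<in>K. (\<Sum>k\<in>{k\<in>K. k \<noteq> i \<and> \<rho> k i}. f i k) + (if \<rho> i j then f j i else 0))"
    by (intro sum.cong refl 2)
  ultimately show ?thesis
    by (simp only: sum.insert[OF assms(1,2)] 1 sum.distrib)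
qed

text \<open>The logarithms are compared with each other rather than expanded separately, so the
  error is proportional to q - r. Separate expansions would leave a term of order q^2 for every
  index, whereas the final formula keeps the power of 1 - \<pi> intact.\<close>

lemma ln_shift_bounds:
  fixes q r \<delta> S :: real
  assumes "0 \<le> r" "r \<le> q" "q \<le> 1/2" "q \<le> \<delta>" "q - r \<le> S"
  shows "q - r \<le> ln (1 - r) - ln (1 - q)" "ln (1 - r) - ln (1 - q) \<le> q - r + 2 * \<delta> * S"
proof -
  have *: "ln (1 - r) - ln (1 - q) = ln ((1 - r) / (1 - q))" using assms by (simp add: ln_div)
  have "ln ((1 - q) / (1 - r)) \<le> (1 - q) / (1 - r) - 1" using assms by (intro ln_le_minus_one) auto
  also have "\<dots> = - ((q - r) / (1 - r))" using assms by (simp add: field_simps)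
  also have "\<dots> \<le> - (q - r)"
  proof -
    have "(q - r) * (1 - r) \<le> (q - r) * 1" using assms by (intro mult_left_mono) auto
    then have "q - r \<le> (q - r) / (1 - r)" using assms by (subst pos_le_divide_eq) auto
    then show ?thesis by simp
  qed
  finally show "q - r \<le> ln (1 - r) - ln (1 - q)" using assms by (simp add: ln_div)
  have "ln ((1 - r) / (1 - q)) \<le> (1 - r) / (1 - q) - 1" using assms by (intro ln_le_minus_one) auto
  also have "\<dots> = (q - r) * (1 / (1 - q))" using assms by (simp add: field_simps)
  also have "1 / (1 - q) \<le> 1 + 2 * q"
  proof -
    have "0 \<le> q * (1 - 2 * q)" using assms by simp
    then show ?thesis using assms by (simp add: field_simps)
  qed
  then have "(q - r) * (1 / (1 - q)) \<le> (q - r) * (1 + 2 * q)" using assms by (intro mult_left_mono) auto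
  also have "\<dots> = q - r + 2 * ((q - r) * q)" by (simp add: algebra_simps)
  also have "(q - r) * q \<le> S * \<delta>" using assms by (intro mult_mono) auto
  finally show "ln (1 - r) - ln (1 - q) \<le> q - r + 2 * \<delta> * S" using * by (simp add: mult.commute)
qed

lemma ln_one_minus_ge: "0 \<le> x \<Longrightarrow> x \<le> 1/2 \<Longrightarrow> - 2 * x \<le> ln (1 - x)" for x :: real
proof -
  assume x: "0 \<le> x" "x \<le> 1/2"
  have "2 * x * x \<le> 1 * x" using x by (intro mult_right_mono) auto
  moreover have "- ln (1 - x) \<le> x + 2 * x * x" using ln_shift_bounds(2)[of 0 x x x] x by simp
  ultimately show "- 2 * x \<le> ln (1 - x)" by linarith
qed

section \<open>Revealing the events one at a time\<close>

context set_family
begin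

abbreviation q :: "'i \<Rightarrow> real" where "q j \<equiv> p ^ card (F j)"
abbreviation q2 :: "'i \<Rightarrow> 'i \<Rightarrow> real" where "q2 j k \<equiv> p ^ card (F j \<union> F k)"
abbreviation q3 :: "'i \<Rightarrow> 'i \<Rightarrow> 'i \<Rightarrow> real" where "q3 j k l \<equiv> p ^ card (F j \<union> F k \<union> F l)"
abbreviation nbs :: "'i set \<Rightarrow> 'i \<Rightarrow> 'i set" where
  "nbs K j \<equiv> {k\<in>K. k \<noteq> j \<and> F k \<inter> F j \<noteq> {}}"
abbreviation nbs2 :: "'i set \<Rightarrow> 'i \<Rightarrow> 'i \<Rightarrow> 'i set" where
  "nbs2 K j k \<equiv> {l\<in>K. l \<noteq> j \<and> l \<noteq> k \<and> F l \<inter> (F j \<union> F k) \<noteq> {}}"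

lemma power_card_mult_le: "p ^ card A * p ^ card B \<le> p ^ card (A \<union> B)"
  using p0 p1 card_Un_le[of A B] by (simp add: power_add[symmetric] power_decreasing)

lemma pr_avoids_insert_ge:
  assumes "j \<in> I"
  shows "(1 - q j) * pr (avoids F K) \<le> pr (avoids F (insert j K))"
  using pr_force_avoids_le[of "F j" K] F_sub[OF assms]
  by (simp add: pr_avoids_insert algebra_simps)

lemma pr_avoids_insert_le:
  assumes "j \<in> I" "K \<subseteq> I" "j \<notin> K"
  shows "pr (avoids F (insert j K)) \<le> (1 - q j + (\<Sum>k\<in>nbs K j. q2 j k)) * pr (avoids F K)"
proof -
  have "nbs K j = {k\<in>K. F k \<inter> F j \<noteq> {}}" using assms by auto
  then show ?thesis
    using pr_force_avoids_ge[of "F j" K] F_sub assms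
    by (simp add: pr_avoids_insert algebra_simps)
qed

lemma sum_nbs_mono:
  assumes "finite K'" "K \<subseteq> K'"
  shows "(\<Sum>k\<in>nbs K j. q2 j k) \<le> (\<Sum>k\<in>nbs K' j. q2 j k)"
  using assms p0 by (intro sum_mono2) auto

text \<open>First-order version: the conditional probability of avoiding each new \<open>F j\<close>
  lies between 1 - q j and 1 - q j + e, where e sums \<open>q2\<close> over the neighbours already
  present. Only pairs with a member in L enter the error.\<close>

lemma pr_avoids_Un_bounds:
  assumes "finite L" "K \<union> L \<subseteq> I" "K \<inter> L = {}" "\<And>j. j \<in> L \<Longrightarrow> q j \<le> 1/2"
  shows "(\<Prod>j\<in>L. 1 - q j) * pr (avoids F K) \<le> pr (avoids F (K \<union> L))"
    and "pr (avoids F (K \<union> L)) \<le>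
      (\<Prod>j\<in>L. 1 - q j) * exp (2 * (\<Sum>j\<in>L. \<Sum>k\<in>nbs (K \<union> L) j. q2 j k)) * pr (avoids F K)"
  using assms
proof (induction L rule: finite_induct)
  case (insert j L)
  case 1
  have qj: "q j \<le> 1" using 1(3)[of j] by simp
  have "(1 - q j) * ((\<Prod>j\<in>L. 1 - q j) * pr (avoids F K)) \<le> (1 - q j) * pr (avoids F (K \<union> L))"
    using insert 1 qj by (intro mult_left_mono) auto
  also have "\<dots> \<le> pr (avoids F (insert j (K \<union> L)))"
    using 1 by (intro pr_avoids_insert_ge) auto
  finally show ?case using insert by (simp add: mult.assoc)
next
  case (insert j L)
  case 2
  let ?S = "\<lambda>L. \<Sum>j\<in>L. \<Sum>k\<in>nbs (K \<union> L) j. q2 j k"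
  define e where "e = (\<Sum>k\<in>nbs (K \<union> L) j. q2 j k)"
  have finKL: "finite (K \<union> insert j L)" by (rule finite_subset[OF 2(1) finI])
  have e0: "e \<ge> 0" unfolding e_def using p0 by (intro sum_nonneg) auto
  have qj: "q j \<le> 1/2" using 2 by auto
  \<comment> \<open>The bound q j <= 1/2 is what allows the additive error e to become a factor exp
    (2 e).\<close>
  have "1 - q j + e \<le> (1 - q j) * (1 + 2 * e)"
    using mult_right_mono[of "q j" "1/2" e] qj e0 by (simp add: algebra_simps)
  also have "\<dots> \<le> (1 - q j) * exp (2 * e)"
    using exp_ge_add_one_self[of "2*e"] qj by (intro mult_left_mono) auto
  finally have step: "1 - q j + e \<le> (1 - q j) * exp (2 * e)" .
  have nn: "0 \<le> (1 - q j) * exp (2 * e)" using qj by simp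
  have prodn: "0 \<le> (\<Prod>j\<in>L. 1 - q j)" 
  proof (rule prod_nonneg)
    fix i assume "i \<in> L"
    then show "0 \<le> 1 - q i" using 2(3)[of i] by simp
  qed
  have S: "?S L + e \<le> ?S (insert j L)"
  proof -
    have "?S L + e \<le> (\<Sum>i\<in>L. \<Sum>k\<in>nbs (K \<union> insert j L) i. q2 i k) + (\<Sum>k\<in>nbs (K \<union> insert j L) j. q2 j k)"
      unfolding e_def using finKL by (intro add_mono sum_mono sum_nbs_mono) auto
    also have "\<dots> = ?S (insert j L)"
      by (simp only: sum.insert[OF insert(1,2)] add.commute)
    finally show ?thesis .
  qed
  have "pr (avoids F (K \<union> insert j L)) \<le> (1 - q j + e) * pr (avoids F (K \<union> L))"
    unfolding e_def using pr_avoids_insert_le[of j "K \<union> L"] 2 insert by auto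
  also have "\<dots> \<le> ((1 - q j) * exp (2 * e)) * pr (avoids F (K \<union> L))"
    using step pr_nonneg by (intro mult_right_mono)
  also have "\<dots> \<le> ((1 - q j) * exp (2 * e)) * ((\<Prod>j\<in>L. 1 - q j) * exp (2 * ?S L) * pr (avoids F K))"
    using 2 insert by (intro mult_left_mono[OF _ nn] insert.IH) auto
  also have "\<dots> = ((1 - q j) * (\<Prod>j\<in>L. 1 - q j)) * exp (2 * (?S L + e)) * pr (avoids F K)"
    by (simp add: exp_add algebra_simps)
  also have "\<dots> \<le> ((1 - q j) * (\<Prod>j\<in>L. 1 - q j)) * exp (2 * ?S (insert j L)) * pr (avoids F K)"
    using S qj prodn pr_nonneg by (intro mult_right_mono mult_left_mono) auto
  finally show ?case using insert by simp
qed simp_all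

text \<open>Split K into the indices N whose sets meet \<open>F j\<close> and the remainder D, which
  is independent of \<open>F j\<close>. Given that D is avoided, let b be the probability that some
  member of N occurs, and a the probability that \<open>F j\<close> occurs as well. The conditional
  probability of \<open>F j\<close> given avoidance of K is then (q j - a) / (1 - b), which differs
  from q j by (a - q j * b) / (1 - b). The union bound and Bonferroni determine a and q j * b up to
  3-cluster sums.\<close>

lemma pr_avoids_insert_second_order:
  assumes "j \<in> I" "K \<subseteq> I" "j \<notin> K" "\<And>i. i \<in> insert j K \<Longrightarrow> q i \<le> \<delta>" "\<delta> \<le> 1/2"
  shows "\<bar>ln (pr (avoids F (insert j K))) - ln (pr (avoids F K)) - ln (1 - q j)
      - (\<Sum>k\<in>nbs K j. q2 j k - q j * q k)\<bar>
    \<le> 2 * (\<Sum>k\<in>nbs K j. \<Sum>l\<in>nbs2 K j k. q3 j k l) + 3 * \<delta> * (\<Sum>k\<in>nbs K j. q2 j k)"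
proof -
  define N where "N = nbs K j"
  define D where "D = {k\<in>K. F k \<inter> F j = {}}"
  define S2 where "S2 = (\<Sum>k\<in>N. q2 j k)"
  define SQ where "SQ = (\<Sum>k\<in>N. q k)"
  define Err where "Err = (\<Sum>k\<in>N. \<Sum>l\<in>nbs2 K j k. q3 j k l)"
  have finK: "finite K" using assms(2) finI finite_subset by blast
  have finN: "finite N" using finK by (simp add: N_def)
  have KND: "K = N \<union> D" "N \<subseteq> K" "D \<subseteq> K" "N \<inter> D = {}" "j \<notin> N" using assms(3) by (auto simp: N_def D_def)
  have finD: "finite D" using finK by (simp add: D_def)
  have sub: "F k \<subseteq> E" if "k \<in> insert j K" for k using that assms F_sub by blast
  let ?PD = "pr (avoids F D)" and ?PK = "pr (avoids F K)"
  let ?PjK = "pr (\<lambda>G. F j \<subseteq> G \<and> avoids F K G)"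
  define U where "U = pr (\<lambda>G. avoids F D G \<and> (\<exists>k\<in>N. F k \<subseteq> G))"
  define V where "V = pr (\<lambda>G. (F j \<subseteq> G \<and> avoids F D G) \<and> (\<exists>k\<in>N. F k \<subseteq> G))"
  have avK: "avoids F K G \<longleftrightarrow> avoids F D G \<and> \<not> (\<exists>k\<in>N. F k \<subseteq> G)" for G
    using KND by (auto simp: avoids_def)
  have PK: "?PK = ?PD - U"
    unfolding U_def using pr_split[of "avoids F D" "\<lambda>G. \<exists>k\<in>N. F k \<subseteq> G"]
    by (simp add: avK[abs_def] conj_commute)
  have "pr (\<lambda>G. F j \<subseteq> G \<and> avoids F D G) = q j * ?PD"
    using assms by (intro pr_force_avoids_eq) (auto simp: D_def F_sub)
  moreover have "pr (\<lambda>G. F j \<subseteq> G \<and> avoids F D G) = V + ?PjK"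
    unfolding V_def using pr_split[of "\<lambda>G. F j \<subseteq> G \<and> avoids F D G" "\<lambda>G. \<exists>k\<in>N. F k \<subseteq> G"]
    by (simp add: avK[abs_def] conj_commute conj_left_commute)
  ultimately have PjK: "?PjK = q j * ?PD - V" by simp
  have PKpos: "0 < ?PK" and PDpos: "0 < ?PD" using assms KND by (auto intro!: pr_avoids_pos)
  have PjK_le: "?PjK \<le> q j * ?PK" using assms by (intro pr_force_avoids_le F_sub)
  have S2_0: "0 \<le> S2" and SQ_0: "0 \<le> SQ" and Err0: "0 \<le> Err"
    unfolding S2_def SQ_def Err_def using p0 by (auto intro!: sum_nonneg)
  let ?V = "\<lambda>k. pr (\<lambda>G. (F j \<subseteq> G \<and> avoids F D G) \<and> F k \<subseteq> G)"
  have V_le: "V \<le> S2 * ?PD"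
  proof -
    have "V \<le> (\<Sum>k\<in>N. ?V k)"
      unfolding V_def by (rule union_bound[OF finN])
    also have "\<dots> \<le> (\<Sum>k\<in>N. q2 j k * ?PD)"
    proof (rule sum_mono)
      fix k assume k: "k \<in> N"
      have "?V k = pr (\<lambda>G. F j \<union> F k \<subseteq> G \<and> avoids F D G)"
        by (intro arg_cong[where f=pr] ext) auto
      also have "\<dots> \<le> q2 j k * ?PD"
        using k KND(2,3) sub by (intro pr_force_avoids_le) auto
      finally show "?V k \<le> q2 j k * ?PD" .
    qed
    finally show ?thesis by (simp add: S2_def sum_distrib_right)
  qed
  have U_le: "U \<le> SQ * ?PD"
  proof -
    have "U \<le> (\<Sum>k\<in>N. pr (\<lambda>G. avoids F D G \<and> F k \<subseteq> G))"
      unfolding U_def by (rule union_bound[OF finN])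
    also have "\<dots> \<le> (\<Sum>k\<in>N. q k * ?PD)"
      using KND(2,3) sub pr_force_avoids_le by (intro sum_mono) (auto simp: conj_commute)
    finally show ?thesis by (simp add: SQ_def sum_distrib_right)
  qed
  let ?NN = "{(k,l). k \<in> N \<and> l \<in> N \<and> k \<noteq> l}"
  have NN: "(\<Sum>(k,l)\<in>?NN. g k l) = (\<Sum>k\<in>N. \<Sum>l\<in>N-{k}. g k l)" for g :: "'i \<Rightarrow> 'i \<Rightarrow> real"
  proof -
    have "?NN = Sigma N (\<lambda>k. N - {k})" by auto
    then show ?thesis using finN by (simp add: sum.Sigma)
  qed
  let ?DJ = "\<lambda>k. {l\<in>D. F l \<inter> (F j \<union> F k) \<noteq> {}}" and ?DK = "\<lambda>k. {l\<in>D. F l \<inter> F k \<noteq> {}}"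
  have V_ge: "(S2 - Err) * ?PD \<le> V"
  proof -
    have "(\<Sum>k\<in>N. (q2 j k - (\<Sum>l\<in>?DJ k. q3 j k l)) * ?PD)
       \<le> (\<Sum>k\<in>N. ?V k)"
    proof (rule sum_mono)
      fix k assume k: "k \<in> N"
      have "(q2 j k - (\<Sum>l\<in>?DJ k. q3 j k l)) * ?PD
          \<le> pr (\<lambda>G. F j \<union> F k \<subseteq> G \<and> avoids F D G)"
        using k KND(2,3) sub assms by (intro pr_force_avoids_ge) auto
      also have "\<dots> = ?V k"
        by (intro arg_cong[where f=pr] ext) auto
      finally show "(q2 j k - (\<Sum>l\<in>?DJ k. q3 j k l)) * ?PD
          \<le> ?V k" .
    qed
    moreover have "(\<Sum>k\<in>N. \<Sum>l\<in>N-{k}. pr (\<lambda>G. (F j \<subseteq> G \<and> avoids F D G) \<and> F k \<subseteq> G \<and> F l \<subseteq> G))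
       \<le> (\<Sum>k\<in>N. \<Sum>l\<in>N-{k}. q3 j k l * ?PD)"
    proof (intro sum_mono)
      fix k l assume k: "k \<in> N" "l \<in> N - {k}"
      have "pr (\<lambda>G. (F j \<subseteq> G \<and> avoids F D G) \<and> F k \<subseteq> G \<and> F l \<subseteq> G)
         = pr (\<lambda>G. F j \<union> F k \<union> F l \<subseteq> G \<and> avoids F D G)"
        by (intro arg_cong[where f=pr] ext) auto
      also have "\<dots> \<le> q3 j k l * ?PD"
        using k KND(2,3) sub by (intro pr_force_avoids_le) auto
      finally show "pr (\<lambda>G. (F j \<subseteq> G \<and> avoids F D G) \<and> F k \<subseteq> G \<and> F l \<subseteq> G) \<le> q3 j k l * ?PD" .
    qed
    \<comment> \<open>The lower bound for V loses twice: through neighbours in D that must still be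
      avoided, and through the Bonferroni pairs in N. These are disjoint ranges of the third index
      and together exhaust \<open>nbs2 K j k\<close>.\<close>
    moreover have "(\<Sum>k\<in>N. (\<Sum>l\<in>?DJ k. q3 j k l) + (\<Sum>l\<in>N-{k}. q3 j k l)) = Err"
      unfolding Err_def
    proof (intro sum.cong refl)
      fix k assume k: "k \<in> N"
      have "nbs2 K j k = ?DJ k \<union> (N - {k})"
        using KND k assms(3) by (auto simp: N_def D_def)
      then show "(\<Sum>l\<in>?DJ k. q3 j k l) + (\<Sum>l\<in>N-{k}. q3 j k l) = (\<Sum>l\<in>nbs2 K j k. q3 j k l)"
        using KND(4) finD finN by (subst sum.union_disjoint[symmetric]) auto
    qed
    ultimately have h1: "(S2 - (\<Sum>k\<in>N. \<Sum>l\<in>?DJ k. q3 j k l)) * ?PD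
        - (\<Sum>k\<in>N. \<Sum>l\<in>N-{k}. q3 j k l) * ?PD \<le> V"
      and h2: "(\<Sum>k\<in>N. \<Sum>l\<in>?DJ k. q3 j k l) + (\<Sum>k\<in>N. \<Sum>l\<in>N-{k}. q3 j k l) = Err"
      using bonferroni[OF finN, of "\<lambda>G. F j \<subseteq> G \<and> avoids F D G" "\<lambda>k G. F k \<subseteq> G"]
      unfolding V_def[symmetric] NN S2_def
      by (simp_all only: sum_subtractf sum.distrib sum_distrib_right[symmetric])
    have "Err * ?PD = (\<Sum>k\<in>N. \<Sum>l\<in>?DJ k. q3 j k l) * ?PD
        + (\<Sum>k\<in>N. \<Sum>l\<in>N-{k}. q3 j k l) * ?PD"
      unfolding h2[symmetric] by (rule distrib_right)
    then show ?thesis using h1 by (simp only: left_diff_distrib)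
  qed
  \<comment> \<open>U alone is known only up to pair sums \<open>q2 k l\<close>. The extra factor q
    j turns these into 3-cluster terms, since q j * q2 k l <= q3 j k l.\<close>
  have qU_ge: "(q j * SQ - Err) * ?PD \<le> q j * U"
  proof -
    have "(\<Sum>k\<in>N. (q k - (\<Sum>l\<in>?DK k. q2 k l)) * ?PD)
       \<le> (\<Sum>k\<in>N. pr (\<lambda>G. avoids F D G \<and> F k \<subseteq> G))"
      using KND(2,3) sub assms pr_force_avoids_ge[of _ D] by (intro sum_mono) (auto simp: conj_commute)
    moreover have "(\<Sum>k\<in>N. \<Sum>l\<in>N-{k}. pr (\<lambda>G. avoids F D G \<and> F k \<subseteq> G \<and> F l \<subseteq> G))
       \<le> (\<Sum>k\<in>N. \<Sum>l\<in>N-{k}. q2 k l * ?PD)"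
    proof (intro sum_mono)
      fix k l assume k: "k \<in> N" "l \<in> N - {k}"
      have "pr (\<lambda>G. avoids F D G \<and> F k \<subseteq> G \<and> F l \<subseteq> G)
         = pr (\<lambda>G. F k \<union> F l \<subseteq> G \<and> avoids F D G)"
        by (intro arg_cong[where f=pr] ext) auto
      also have "\<dots> \<le> q2 k l * ?PD"
        using k KND(2,3) sub by (intro pr_force_avoids_le) auto
      finally show "pr (\<lambda>G. avoids F D G \<and> F k \<subseteq> G \<and> F l \<subseteq> G) \<le> q2 k l * ?PD" .
    qed
    ultimately have "(SQ - (\<Sum>k\<in>N. \<Sum>l\<in>?DK k. q2 k l)) * ?PD
        - (\<Sum>k\<in>N. \<Sum>l\<in>N-{k}. q2 k l) * ?PD \<le> U"
      using bonferroni[OF finN, of "avoids F D" "\<lambda>k G. F k \<subseteq> G"]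
      unfolding U_def[symmetric] NN SQ_def
      by (simp only: sum_subtractf sum.distrib sum_distrib_right[symmetric])
    then have "(SQ - (\<Sum>k\<in>N. (\<Sum>l\<in>?DK k. q2 k l) + (\<Sum>l\<in>N-{k}. q2 k l))) * ?PD \<le> U"
      by (simp only: sum.distrib left_diff_distrib distrib_right)
    then have "q j * ((SQ - (\<Sum>k\<in>N. (\<Sum>l\<in>?DK k. q2 k l) + (\<Sum>l\<in>N-{k}. q2 k l))) * ?PD) \<le> q j * U"
      using p0 by (intro mult_left_mono) auto
    moreover have "q j * (\<Sum>k\<in>N. (\<Sum>l\<in>?DK k. q2 k l) + (\<Sum>l\<in>N-{k}. q2 k l)) \<le> Err"
      unfolding Err_def sum_distrib_left
    proof (intro sum_mono)
      fix k assume k: "k \<in> N"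
      have "(\<Sum>l\<in>?DK k. q2 k l) + (\<Sum>l\<in>N-{k}. q2 k l)
         = (\<Sum>l\<in>?DK k \<union> (N-{k}). q2 k l)"
        using KND(4) finD finN by (subst sum.union_disjoint) auto
      then have "q j * ((\<Sum>l\<in>?DK k. q2 k l) + (\<Sum>l\<in>N-{k}. q2 k l))
         = (\<Sum>l\<in>?DK k \<union> (N-{k}). q j * q2 k l)"
        by (simp add: sum_distrib_left)
      also have "\<dots> \<le> (\<Sum>l\<in>?DK k \<union> (N-{k}). q3 j k l)"
        unfolding Un_assoc by (intro sum_mono power_card_mult_le)
      also have "\<dots> \<le> (\<Sum>l\<in>nbs2 K j k. q3 j k l)"
        using finK p0 KND(2) k assms(3) by (intro sum_mono2) (auto simp: N_def D_def)
      finally show "q j * ((\<Sum>l\<in>?DK k. q2 k l) + (\<Sum>l\<in>N-{k}. q2 k l)) \<le> (\<Sum>l\<in>nbs2 K j k. q3 j k l)" .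
    qed
    then have "(q j * SQ - Err) * ?PD \<le> (q j * (SQ - (\<Sum>k\<in>N. (\<Sum>l\<in>?DK k. q2 k l) + (\<Sum>l\<in>N-{k}. q2 k l)))) * ?PD"
      using PDpos by (intro mult_right_mono) (auto simp: algebra_simps)
    ultimately show ?thesis by (simp add: mult.assoc)
  qed
  \<comment> \<open>Off the diagonal the product consists of 3-cluster terms; the diagonal has only
    two distinct indices besides repetition and is the source of the term with \<delta>.\<close>
  have S2SQ: "S2 * SQ \<le> Err + \<delta> * S2"
  proof -
    have "S2 * SQ = (\<Sum>k\<in>N. \<Sum>l\<in>N. q2 j k * q l)"
      unfolding S2_def SQ_def sum_product ..
    also have "\<dots> = (\<Sum>k\<in>N. q2 j k * q k + (\<Sum>l\<in>N-{k}. q2 j k * q l))"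
      using finN by (intro sum.cong refl sum.remove) auto
    also have "\<dots> \<le> (\<Sum>k\<in>N. q2 j k * \<delta> + (\<Sum>l\<in>nbs2 K j k. q3 j k l))"
    proof (intro sum_mono add_mono)
      fix k assume k: "k \<in> N"
      show "q2 j k * q k \<le> q2 j k * \<delta>" using k KND(2) assms p0 by (intro mult_left_mono) auto
      have "(\<Sum>l\<in>N-{k}. q2 j k * q l) \<le> (\<Sum>l\<in>N-{k}. q3 j k l)"
        by (intro sum_mono power_card_mult_le)
      also have "\<dots> \<le> (\<Sum>l\<in>nbs2 K j k. q3 j k l)"
        using finK p0 KND(2) k assms(3) by (intro sum_mono2) (auto simp: N_def)
      finally show "(\<Sum>l\<in>N-{k}. q2 j k * q l) \<le> (\<Sum>l\<in>nbs2 K j k. q3 j k l)" .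
    qed
    also have "\<dots> = Err + \<delta> * S2"
      by (simp add: sum.distrib Err_def S2_def sum_distrib_left mult.commute add.commute)
    finally show ?thesis .
  qed
  define r where "r = ?PjK / ?PK"
  define a b where "a = V / ?PD" and "b = U / ?PD"
  have ab: "V = a * ?PD" "U = b * ?PD" using PDpos by (auto simp: a_def b_def)
  have b1: "b < 1" using PK PKpos PDpos by (simp add: b_def)
  have b0: "0 \<le> b" using PDpos by (simp add: b_def U_def pr_nonneg)
  have a_le: "a \<le> S2" "S2 - Err \<le> a" "b \<le> SQ" "q j * SQ - Err \<le> q j * b"
    using V_le V_ge U_le qU_ge PDpos unfolding ab by (auto simp: mult.assoc[symmetric])
  have a0: "0 \<le> a" using PDpos by (simp add: a_def V_def pr_nonneg)
  have aq: "a \<le> q j"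
  proof -
    have "0 \<le> (q j - a) * ?PD" using PjK pr_nonneg[of "\<lambda>G. F j \<subseteq> G \<and> avoids F K G"] ab
      by (simp add: algebra_simps)
    then show ?thesis using PDpos by (simp add: zero_le_mult_iff)
  qed
  have r_eq: "r = (q j - a) / (1 - b)"
  proof -
    have "r = ((q j - a) * ?PD) / ((1 - b) * ?PD)"
      unfolding r_def PjK PK ab by (simp add: algebra_simps)
    then show ?thesis using PDpos by simp
  qed
  have rq: "r \<le> q j" unfolding r_def using PjK_le PKpos by (simp add: divide_le_eq)
  have r0: "0 \<le> r" unfolding r_def using PKpos pr_nonneg by simp
  have diff: "q j - r = (a - q j * b) / (1 - b)" using b1 r_eq by (simp add: field_simps)
  have "a - q j * b = (q j - r) * (1 - b)" using diff b1 by simp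
  then have abq: "0 \<le> a - q j * b" using rq b1 by simp
  have lower: "S2 - q j * SQ - Err \<le> q j - r"
  proof -
    have "q j * b \<le> q j * SQ" using a_le p0 by simp
    then have "S2 - q j * SQ - Err \<le> a - q j * b" using a_le by linarith
    also have "\<dots> \<le> (a - q j * b) / (1 - b)" using mult_left_mono[of "1 - b" 1 "a - q j * b"] abq b0 b1 by (simp add: le_divide_eq)
    finally show ?thesis using diff by simp
  qed
  \<comment> \<open>Multiplied by 1 - b, the bound a - q j * b + a * b exceeds a - q j * b by
    exactly b * b * (q j - a), which is nonnegative because a <= q j.\<close>
  have upper: "q j - r \<le> S2 - q j * SQ + 2 * Err + \<delta> * S2"
  proof -
    have "(a - q j * b) / (1 - b) \<le> a - q j * b + a * b"
    proof -
      have "0 \<le> b * b * (q j - a)" using aq by simp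
      then have "a - q j * b \<le> (a - q j * b + a * b) * (1 - b)" by (simp add: algebra_simps)
      then show ?thesis using b1 by (simp add: divide_le_eq)
    qed
    also have "a * b \<le> S2 * SQ" using a_le a0 b0 S2_0 by (intro mult_mono) auto
    finally show ?thesis using diff a_le S2SQ by linarith
  qed
  have qr_S2: "q j - r \<le> S2"
  proof -
    have "N = {k\<in>K. F k \<inter> F j \<noteq> {}}" using assms(3) by (auto simp: N_def)
    then have "(q j - S2) * ?PK \<le> ?PjK"
      using pr_force_avoids_ge[OF F_sub[OF assms(1)] assms(2)] by (simp only: S2_def)
    then show ?thesis unfolding r_def using PKpos by (simp add: field_simps)
  qed
  have lnr: "ln (pr (avoids F (insert j K))) - ln ?PK = ln (1 - r)"
  proof -
    have "pr (avoids F (insert j K)) = ?PK * (1 - r)"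
      unfolding pr_avoids_insert r_def using PKpos by (simp add: field_simps)
    moreover have "q j \<le> 1/2" using assms(4)[of j] assms(5) by simp
    ultimately show ?thesis using PKpos rq by (simp add: ln_mult)
  qed
  have q\<delta>: "q j \<le> \<delta>" "q j \<le> 1/2" using assms(4)[of j] assms(5) by auto
  \<comment> \<open>Of the three multiples of \<delta> * S2 in the claim, two come from the
    logarithm here and one from the diagonal in \<open>S2SQ\<close>.\<close>
  note lns = ln_shift_bounds[OF r0 rq q\<delta>(2,1) qr_S2]
  have \<delta>S2: "0 \<le> \<delta> * S2" using S2_0 q\<delta>(1) p0 by (meson mult_nonneg_nonneg order_trans zero_le_power less_imp_le)
  have "(\<Sum>k\<in>nbs K j. q2 j k - q j * q k) = S2 - q j * SQ"
    by (simp add: S2_def SQ_def N_def sum_subtractf sum_distrib_left)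
  then show ?thesis
    unfolding N_def[symmetric] S2_def[symmetric] Err_def[symmetric]
    using lns lnr lower upper \<delta>S2 Err0 by (simp add: N_def[symmetric] abs_le_iff)
qed

lemma ln_pr_avoids_second_order:
  assumes "J \<subseteq> I" "\<And>j. j \<in> J \<Longrightarrow> q j \<le> \<delta>" "\<delta> \<le> 1/2"
  shows "\<bar>ln (pr (avoids F J)) - (\<Sum>j\<in>J. ln (1 - q j))
      - (\<Sum>j\<in>J. \<Sum>k\<in>nbs J j. q2 j k - q j * q k) / 2\<bar>
    \<le> 2 * (\<Sum>j\<in>J. \<Sum>k\<in>nbs J j. \<Sum>l\<in>nbs2 J j k. q3 j k l)
      + 3 * \<delta> * (\<Sum>j\<in>J. \<Sum>k\<in>nbs J j. q2 j k)"
proof -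
  have "finite J" using assms finI finite_subset by blast
  then show ?thesis using assms(1,2)
  proof (induction J rule: finite_induct)
    case empty
    have "pr (avoids F {}) = 1" using finE by (simp add: pr_def avoids_def)
    then show ?case by simp
  next
    case (insert j K)
    let ?A = "\<lambda>K. \<Sum>j\<in>K. \<Sum>k\<in>nbs K j. q2 j k - q j * q k"
    let ?B = "\<lambda>K. \<Sum>j\<in>K. \<Sum>k\<in>nbs K j. \<Sum>l\<in>nbs2 K j k. q3 j k l"
    let ?C = "\<lambda>K. \<Sum>j\<in>K. \<Sum>k\<in>nbs K j. q2 j k"
    have nbsj: "nbs K j = {k\<in>K. F k \<inter> F j \<noteq> {}}" using insert by auto
    have A: "?A (insert j K) = ?A K + 2 * (\<Sum>k\<in>nbs K j. q2 j k - q j * q k)"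
      unfolding nbsj using insert
      by (intro sum_symmetric_insert[where \<rho>="\<lambda>k i. F k \<inter> F i \<noteq> {}"]) (auto simp: Un_commute mult.commute)
    have C: "?C K + (\<Sum>k\<in>nbs K j. q2 j k) \<le> ?C (insert j K)"
    proof -
      have "?C K + (\<Sum>k\<in>nbs K j. q2 j k)
        \<le> (\<Sum>i\<in>K. \<Sum>k\<in>nbs (insert j K) i. q2 i k) + (\<Sum>k\<in>nbs (insert j K) j. q2 j k)"
        using insert by (intro add_mono sum_mono sum_nbs_mono) auto
      then show ?thesis using insert by (simp add: add.commute)
    qed
    have mono3: "(\<Sum>k\<in>nbs K i. \<Sum>l\<in>nbs2 K i k. q3 i k l)
      \<le> (\<Sum>k\<in>nbs (insert j K) i. \<Sum>l\<in>nbs2 (insert j K) i k. q3 i k l)" for i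
    proof -
      have "(\<Sum>k\<in>nbs K i. \<Sum>l\<in>nbs2 K i k. q3 i k l) \<le> (\<Sum>k\<in>nbs K i. \<Sum>l\<in>nbs2 (insert j K) i k. q3 i k l)"
        using insert p0 by (intro sum_mono sum_mono2) auto
      also have "\<dots> \<le> (\<Sum>k\<in>nbs (insert j K) i. \<Sum>l\<in>nbs2 (insert j K) i k. q3 i k l)"
        using insert p0 by (intro sum_mono2 sum_nonneg) auto
      finally show ?thesis .
    qed
    have B: "?B K + (\<Sum>k\<in>nbs K j. \<Sum>l\<in>nbs2 K j k. q3 j k l) \<le> ?B (insert j K)"
    proof -
      have "?B K + (\<Sum>k\<in>nbs K j. \<Sum>l\<in>nbs2 K j k. q3 j k l)
        \<le> (\<Sum>i\<in>K. \<Sum>k\<in>nbs (insert j K) i. \<Sum>l\<in>nbs2 (insert j K) i k. q3 i k l)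
          + (\<Sum>k\<in>nbs (insert j K) j. \<Sum>l\<in>nbs2 (insert j K) j k. q3 j k l)"
        by (intro add_mono sum_mono mono3)
      then show ?thesis using insert by (simp add: add.commute)
    qed
    have \<delta>0: "0 \<le> \<delta>" using insert.prems(2)[of j] p0 by (meson insertI1 order_trans zero_le_power less_imp_le)
    have "\<bar>ln (pr (avoids F K)) - (\<Sum>j\<in>K. ln (1 - q j)) - ?A K / 2\<bar> \<le> 2 * ?B K + 3 * \<delta> * ?C K"
      using insert by auto
    moreover have "\<bar>ln (pr (avoids F (insert j K))) - ln (pr (avoids F K)) - ln (1 - q j)
      - (\<Sum>k\<in>nbs K j. q2 j k - q j * q k)\<bar>
      \<le> 2 * (\<Sum>k\<in>nbs K j. \<Sum>l\<in>nbs2 K j k. q3 j k l) + 3 * \<delta> * (\<Sum>k\<in>nbs K j. q2 j k)"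
      using insert assms(3) by (intro pr_avoids_insert_second_order) auto
    moreover have "3 * \<delta> * ?C K + 3 * \<delta> * (\<Sum>k\<in>nbs K j. q2 j k) \<le> 3 * \<delta> * ?C (insert j K)"
      using C \<delta>0 by (simp only: distrib_left[symmetric]) (intro mult_left_mono, auto)
    moreover have "(\<Sum>j\<in>insert j K. ln (1 - q j)) = ln (1 - q j) + (\<Sum>j\<in>K. ln (1 - q j))"
      using insert by simp
    ultimately show ?case using A B unfolding abs_le_iff by argo
  qed
qed

end

section \<open>Counting cliques by overlap\<close>

lemma two_choose_two: "2 * (k choose 2) + k = k * k"
  by (induction k) (auto simp: numeral_2_eq_2)

lemma prod_ge_sum_nat: "1 \<le> x \<Longrightarrow> 1 \<le> y \<Longrightarrow> x + y \<le> x * y + 1" for x y :: nat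
  by (cases x; cases y) auto

text \<open>The first summand r (r - s) is what balances n^(r - s) at p = n powr (-2/r); the second
  is the gain that makes a 2-cluster rare given one of its cliques.\<close>

lemma two_choose_two_diff:
  assumes "2 \<le> s" "s < r"
  shows "2 * ((r choose 2) - (s choose 2)) = r * (r - s) + (s - 1) * (r - s)"
proof -
  obtain x where x: "s = Suc x" using assms by (cases s) auto
  obtain a where a: "r = s + a" using assms by (metis less_imp_add_positive)
  have "2 * (r choose 2) = 2 * (s choose 2) + (r * (r - s) + (s - 1) * (r - s))"
    using two_choose_two[of r] two_choose_two[of s] by (simp add: x a algebra_simps)
  then show ?thesis by simp
qed

lemma sum_UN_le:
  fixes f :: "'b \<Rightarrow> real"
  assumes "finite A" "\<And>a. a \<in> A \<Longrightarrow> finite (B a)" "\<And>b. 0 \<le> f b"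
  shows "sum f (\<Union>a\<in>A. B a) \<le> (\<Sum>a\<in>A. sum f (B a))"
  using assms(1,2)
proof (induction A rule: finite_induct)
  case (insert a A)
  have "sum f (\<Union>x\<in>insert a A. B x) = sum f (B a) + sum f (\<Union>x\<in>A. B x) - sum f (B a \<inter> (\<Union>x\<in>A. B x))"
    using insert by (simp add: sum_Un)
  moreover have "0 \<le> sum f (B a \<inter> (\<Union>x\<in>A. B x))" using assms(3) by (rule sum_nonneg)
  moreover have "sum f (\<Union>x\<in>A. B x) \<le> (\<Sum>x\<in>A. sum f (B x))" using insert by auto
  ultimately show ?case using insert(1,2) by simp
qed simp

lemma nsets_Int: "nsets S k \<inter> nsets T k = nsets (S \<inter> T) k"
  by (auto simp: nsets_def)

lemma card_nsets_Diff:
  assumes "finite S"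
  shows "card (nsets S k - nsets T k) = (card S choose k) - (card (S \<inter> T) choose k)"
proof -
  have "nsets S k - nsets T k = nsets S k - nsets (S \<inter> T) k"
    using nsets_Int[of S k T] by auto
  moreover have "nsets (S \<inter> T) k \<subseteq> nsets S k" by (rule nsets_mono) auto
  ultimately show ?thesis
    using assms by (simp add: card_Diff_subset finite_imp_finite_nsets card_nsets)
qed

lemma adj_iff: "finite S \<Longrightarrow> adj S T \<longleftrightarrow> S \<noteq> T \<and> 2 \<le> card (S \<inter> T)"
  by (auto simp: adj_def nsets_Int nsets_eq_empty_iff)

lemma adj_commute: "adj S T \<longleftrightarrow> adj T S"
  by (auto simp: adj_def)

lemma card_overlap_class:
  assumes "finite V" "U \<subseteq> V" "s \<le> r"
  shows "card {S\<in>nsets V r. card (S \<inter> U) = s}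
    = (card U choose s) * ((card V - card U) choose (r - s))"
proof -
  have finU: "finite U" using assms(1,2) by (rule rev_finite_subset)
  let ?f = "\<lambda>S. (S \<inter> U, S - U)"
  have "bij_betw ?f {S\<in>nsets V r. card (S \<inter> U) = s} (nsets U s \<times> nsets (V - U) (r - s))"
  proof (rule bij_betwI[where g="\<lambda>(A, B). A \<union> B"])
    show "?f \<in> {S\<in>nsets V r. card (S \<inter> U) = s} \<rightarrow> nsets U s \<times> nsets (V - U) (r - s)"
    proof
      fix S assume S: "S \<in> {S\<in>nsets V r. card (S \<inter> U) = s}"
      then have "card (S - U) = r - s"
        using finU by (auto simp: nsets_def card_Diff_subset_Int Int_commute)
      then show "?f S \<in> nsets U s \<times> nsets (V - U) (r - s)" using S by (auto simp: nsets_def)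
    qed
    show "(\<lambda>(A, B). A \<union> B) \<in> nsets U s \<times> nsets (V - U) (r - s) \<rightarrow> {S\<in>nsets V r. card (S \<inter> U) = s}"
    proof (clarify, intro CollectI conjI)
      fix A B assume A: "A \<in> nsets U s" and B: "B \<in> nsets (V - U) (r - s)"
      then have "card (A \<union> B) = card A + card B" by (intro card_Un_disjoint) (auto simp: nsets_def)
      then show "A \<union> B \<in> nsets V r" using A B assms by (auto simp: nsets_def)
      have "(A \<union> B) \<inter> U = A" using A B by (auto simp: nsets_def)
      then show "card ((A \<union> B) \<inter> U) = s" using A by (simp add: nsets_def)
    qed
  qed (auto simp: nsets_def)
  then have "card {S\<in>nsets V r. card (S \<inter> U) = s} = card (nsets U s \<times> nsets (V - U) (r - s))"
    by (rule bij_betw_same_card)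
  then show ?thesis using assms finU by (simp add: card_cartesian_product card_nsets card_Diff_subset)
qed

lemma sum_by_overlap:
  fixes h :: "nat \<Rightarrow> real"
  assumes "finite V" "U \<subseteq> V" "A \<subseteq> {..r}"
  shows "(\<Sum>S\<in>{S\<in>nsets V r. card (S \<inter> U) \<in> A}. h (card (S \<inter> U)))
    = (\<Sum>s\<in>A. real ((card U choose s) * ((card V - card U) choose (r - s))) * h s)"
proof -
  have finA: "finite A" using assms(3) finite_subset by blast
  have finX: "finite (nsets V r)" using assms by (intro finite_imp_finite_nsets)
  let ?X = "{S\<in>nsets V r. card (S \<inter> U) \<in> A}"
  have "(\<Sum>S\<in>?X. h (card (S \<inter> U))) = (\<Sum>s\<in>A. \<Sum>S\<in>{S\<in>?X. card (S \<inter> U) = s}. h (card (S \<inter> U)))"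
    using finX finA by (intro sum.group[symmetric]) auto
  also have "\<dots> = (\<Sum>s\<in>A. real (card {S\<in>nsets V r. card (S \<inter> U) = s}) * h s)"
  proof (rule sum.cong[OF refl])
    fix s assume "s \<in> A"
    then have "{S\<in>?X. card (S \<inter> U) = s} = {S\<in>nsets V r. card (S \<inter> U) = s}" by auto
    then show "(\<Sum>S\<in>{S\<in>?X. card (S \<inter> U) = s}. h (card (S \<inter> U)))
        = real (card {S\<in>nsets V r. card (S \<inter> U) = s}) * h s" by simp
  qed
  also have "\<dots> = (\<Sum>s\<in>A. real ((card U choose s) * ((card V - card U) choose (r - s))) * h s)"
    using assms by (intro sum.cong refl) (subst card_overlap_class, auto)
  finally show ?thesis .
qed

lemma binomial_le_power_nat: "(m choose k) \<le> n ^ k" if "m \<le> n"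
proof -
  have "(m choose k) \<le> m ^ k"
    by (cases "k \<le> m") (auto simp: binomial_le_pow binomial_eq_0)
  also have "\<dots> \<le> n ^ k" using that by (rule power_mono) simp
  finally show ?thesis .
qed

lemma sum_by_overlap_le:
  fixes h :: "nat \<Rightarrow> real"
  assumes "U \<subseteq> {..<n}" "A \<subseteq> {..r}" "card U \<le> u" "\<And>s. s \<in> A \<Longrightarrow> 0 \<le> h s"
  shows "(\<Sum>S\<in>{S\<in>nsets {..<n} r. card (S \<inter> U) \<in> A}. h (card (S \<inter> U)))
    \<le> 2 ^ u * (\<Sum>s\<in>A. real n ^ (r - s) * h s)"
proof -
  have "(card U choose s) * ((n - card U) choose (r - s)) \<le> 2 ^ u * n ^ (r - s)" for s
  proof (rule mult_mono)
    have "(card U choose s) \<le> 2 ^ card U" by (rule binomial_le_pow2)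
    also have "\<dots> \<le> 2 ^ u" using assms(3) by (rule power_increasing) simp
    finally show "(card U choose s) \<le> 2 ^ u" .
  qed (auto intro: binomial_le_power_nat)
  then have "real ((card U choose s) * ((n - card U) choose (r - s))) \<le> 2 ^ u * real n ^ (r - s)" for s
    by (rule order_trans[OF of_nat_mono]) simp
  then show ?thesis
    unfolding sum_distrib_left using assms
    by (subst sum_by_overlap) (auto intro!: sum_mono mult_right_mono simp: mult.assoc[symmetric])
qed

text \<open>With \<open>a\<close> and \<open>b\<close> vertices of \<open>U\<close> outside \<open>T\<close> and \<open>S\<close> respectively, \<open>U\<close> has \<open>a b\<close> new edges.\<close>

lemma card_new_edges_ge:
  assumes "finite S" "finite T" "card S = r" "card T = r" "card U = r" "U \<subseteq> S \<union> T" "U \<noteq> S" "U \<noteq> T"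
  shows "max 1 (r - card (S \<inter> T) - 1) \<le> card (nsets U 2 - (nsets S 2 \<union> nsets T 2))"
proof -
  have finU: "finite U" using assms(1,2,6) by (meson finite_Un rev_finite_subset)
  let ?f = "\<lambda>(x, y). {x, y}"
  have "inj_on ?f ((U - T) \<times> (U - S))"
    using assms(6) by (auto simp: inj_on_def doubleton_eq_iff)
  then have "card (?f ` ((U - T) \<times> (U - S))) = card (U - T) * card (U - S)"
    by (simp add: card_image card_cartesian_product)
  moreover have "?f ` ((U - T) \<times> (U - S)) \<subseteq> nsets U 2 - (nsets S 2 \<union> nsets T 2)"
    using assms(6) by auto
  ultimately have 1: "card (U - T) * card (U - S) \<le> card (nsets U 2 - (nsets S 2 \<union> nsets T 2))"
    using finU by (metis card_mono finite_Diff finite_imp_finite_nsets)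
  have "U - T \<noteq> {}" using assms card_subset_eq[of T U] by auto
  then have a: "1 \<le> card (U - T)" using finU by (simp add: Suc_le_eq card_gt_0_iff)
  have "U - S \<noteq> {}" using assms card_subset_eq[of S U] by auto
  then have b: "1 \<le> card (U - S)" using finU by (simp add: Suc_le_eq card_gt_0_iff)
  \<comment> \<open>Only vertices of the intersection of S and T escape both differences. This
    bounds the sum of their sizes from below, and x + y - 1 <= x y carries the bound over to the
    product.\<close>
  have "U = (U - T) \<union> ((U - S) \<union> (U \<inter> (S \<inter> T)))" using assms(6) by auto
  then have "card U \<le> card (U - T) + (card (U - S) + card (U \<inter> (S \<inter> T)))"
    by (metis (no_types, lifting) add_left_mono card_Un_le le_trans)
  moreover have "card (U \<inter> (S \<inter> T)) \<le> card (S \<inter> T)" using assms by (intro card_mono) auto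
  ultimately have "r - card (S \<inter> T) \<le> card (U - T) + card (U - S)" using assms(5) by linarith
  moreover have "card (U - T) + card (U - S) - 1 \<le> card (U - T) * card (U - S)"
  proof -
    obtain a' b' where "card (U - T) = Suc a'" "card (U - S) = Suc b'"
      using a b by (metis Suc_le_D One_nat_def)
    then show ?thesis by simp
  qed
  moreover have "1 \<le> card (U - T) * card (U - S)" using a b by (simp add: Suc_le_eq)
  ultimately show ?thesis using 1 by linarith
qed

text \<open>Since p <= 1/2, any nonempty set of missing edges is present with probability at most
  1/2, as the logarithmic estimates require. Both conditions on p hold for all large n in the
  theorem.\<close>

locale clique_setting =
  fixes r n :: nat and p :: real
  assumes r3: "3 \<le> r" and p0: "0 < p" and p_half: "p \<le> 1/2"
begin

abbreviation X :: "nat set set" where "X \<equiv> nsets {..<n} r"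
abbreviation K2 :: "nat set \<Rightarrow> nat set set" where "K2 S \<equiv> nsets S 2"
abbreviation nbrs :: "nat set \<Rightarrow> nat set set" where "nbrs S \<equiv> {T\<in>X. adj T S}"
abbreviation clus :: "nat set \<Rightarrow> nat set \<Rightarrow> nat set set" where
  "clus S T \<equiv> {U\<in>X. U \<noteq> S \<and> U \<noteq> T \<and> (adj U S \<or> adj U T)}"
text \<open>The number of edges that a clique adds to another one which it meets in s
  vertices.\<close>

abbreviation exc :: "nat \<Rightarrow> nat" where "exc s \<equiv> (r choose 2) - (s choose 2)"

text \<open>Probabilities of cliques: \<open>cond\<close> and \<open>cond3\<close> are conditional
  on S being a clique, \<open>joint\<close> and \<open>joint3\<close> are unconditional.\<close>

abbreviation cond :: "nat set \<Rightarrow> nat set \<Rightarrow> real" where "cond S T \<equiv> p ^ card (K2 T - K2 S)"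
abbreviation cond3 :: "nat set \<Rightarrow> nat set \<Rightarrow> nat set \<Rightarrow> real" where
  "cond3 S T U \<equiv> p ^ card ((K2 T \<union> K2 U) - K2 S)"
abbreviation joint :: "nat set \<Rightarrow> nat set \<Rightarrow> real" where "joint S T \<equiv> p ^ card (K2 S \<union> K2 T)"
abbreviation joint3 :: "nat set \<Rightarrow> nat set \<Rightarrow> nat set \<Rightarrow> real" where
  "joint3 S T U \<equiv> p ^ card (K2 S \<union> K2 T \<union> K2 U)"

text \<open>Up to constants, \<open>\<beta>\<close> and \<open>\<kappa>\<close> bound the expected number of ways to extend a given clique to a
  2-cluster or 3-cluster; \<open>p ^ max 1 (r - s - 1)\<close> stands for a third clique inside the union of two
  cliques with \<open>s\<close> common vertices.\<close>

definition \<beta> :: real where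
  "\<beta> = (\<Sum>s\<in>{2..<r}. real n ^ (r - s) * p ^ (exc s))"

definition \<kappa> :: real where
  "\<kappa> = (\<Sum>s\<in>{2..<r}. real n ^ (r - s) * p ^ (exc s)
      * (\<beta> + p ^ max 1 (r - s - 1)))"

text \<open>The powers of 2 bound the choices of an overlap: a subset of one clique for
  \<open>B2\<close>, and for \<open>B3\<close> additionally a subset of the at most 2 r vertices of
  a 2-cluster.\<close>

abbreviation B2 :: real where "B2 \<equiv> 2 ^ r * \<beta>"
abbreviation B3 :: real where "B3 \<equiv> 2 ^ (3 * r) * \<kappa>"

section \<open>Extensions of a clique and the 3-clusters around it\<close>

lemma \<beta>_nonneg: "0 \<le> \<beta>" unfolding \<beta>_def using p0 by (intro sum_nonneg) auto

lemma \<kappa>_nonneg: "0 \<le> \<kappa>"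
  unfolding \<kappa>_def using p0 \<beta>_nonneg by (intro sum_nonneg mult_nonneg_nonneg add_nonneg_nonneg) auto

lemma XD: "S \<in> X \<Longrightarrow> finite S" "S \<in> X \<Longrightarrow> card S = r" "S \<in> X \<Longrightarrow> S \<subseteq> {..<n}"
  by (auto simp: nsets_def)

lemma finite_X [simp]: "finite X" by (rule finite_imp_finite_nsets) simp

lemma finite_K2 [simp]: "S \<in> X \<Longrightarrow> finite (K2 S)" by (rule finite_imp_finite_nsets) (rule XD)

lemma card_K2: "S \<in> X \<Longrightarrow> card (K2 S) = r choose 2" by (simp add: card_nsets XD)

lemma p_le_1: "p \<le> 1" using p_half by simp

lemma power_le: "a \<le> b \<Longrightarrow> p ^ b \<le> p ^ a" using p0 p_le_1 by (simp add: power_decreasing)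

lemma nbrs_eq: "S \<in> X \<Longrightarrow> nbrs S = {T\<in>X. card (T \<inter> S) \<in> {2..<r}}"
proof -
  assume S: "S \<in> X"
  have "card (T \<inter> S) < r \<longleftrightarrow> T \<noteq> S" if T: "T \<in> X" for T
  proof
    show "T \<noteq> S" if "card (T \<inter> S) < r" using that T XD by auto
    assume "T \<noteq> S"
    then have "T \<inter> S \<subset> T" using T S XD card_subset_eq[of S T] by (metis Int_lower1 inf.order_iff psubsetI inf_commute)
    then show "card (T \<inter> S) < r" using XD T by (metis psubset_card_mono)
  qed
  then show ?thesis using XD(1) by (auto simp: adj_iff)
qed

lemma sum_extension_strict:
  assumes "U \<subseteq> {..<n}" "card U \<le> u"
  shows "(\<Sum>T\<in>{T\<in>X. card (T \<inter> U) \<in> {2..<r}}. cond U T) \<le> 2 ^ u * \<beta>"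
proof -
  have "(\<Sum>T\<in>{T\<in>X. card (T \<inter> U) \<in> {2..<r}}. cond U T)
     = (\<Sum>T\<in>{T\<in>X. card (T \<inter> U) \<in> {2..<r}}. p ^ ((r choose 2) - (card (T \<inter> U) choose 2)))"
    by (intro sum.cong refl) (auto simp: card_nsets_Diff XD)
  also have "\<dots> \<le> 2 ^ u * \<beta>"
    unfolding \<beta>_def using assms p0 by (intro sum_by_overlap_le) auto
  finally show ?thesis .
qed

lemma sum_nbrs_le: "S \<in> X \<Longrightarrow> (\<Sum>T\<in>nbrs S. cond S T) \<le> B2"
  using sum_extension_strict[of S r] by (simp only: nbrs_eq XD)

lemma card_subsets_le:
  assumes "U \<subseteq> {..<n}" "card U \<le> u"
  shows "real (card {T\<in>X. T \<subseteq> U}) \<le> 2 ^ u"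
proof -
  have finU: "finite U" using assms(1) by (rule finite_subset) simp
  have "card {T\<in>X. T \<subseteq> U} \<le> card (Pow U)" using finU by (intro card_mono) auto
  also have "\<dots> \<le> 2 ^ u" using finU assms(2) by (simp add: card_Pow power_increasing)
  finally show ?thesis by (metis of_nat_le_iff of_nat_numeral of_nat_power)
qed

lemma overlap_cases:
  assumes "T \<in> X" "2 \<le> card (T \<inter> U)"
  shows "card (T \<inter> U) \<in> {2..<r} \<or> T \<subseteq> U"
proof -
  have "card (T \<inter> U) \<le> r" using assms XD by (metis card_mono Int_lower1)
  moreover have "T \<subseteq> U" if "card (T \<inter> U) = r"
    using card_subset_eq[of T "T \<inter> U"] that assms XD by auto
  ultimately show ?thesis using assms by force
qed

text \<open>Think of W as the edges already present on the vertex set U. An r-set with a vertex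
  outside U has at least its edges outside \<open>K2 U\<close> missing, which gives the \<beta>
  term; there are at most 2^u r-sets inside U, and these are left to the bound h.\<close>

lemma sum_extension_le:
  assumes "U \<subseteq> {..<n}" "card U \<le> u" "W \<subseteq> K2 U" "\<T> \<subseteq> {T\<in>X. 2 \<le> card (T \<inter> U)}"
    and h: "\<And>T. T \<in> \<T> \<Longrightarrow> T \<subseteq> U \<Longrightarrow> p ^ card (K2 T - W) \<le> h" and "0 \<le> h"
  shows "(\<Sum>T\<in>\<T>. p ^ card (K2 T - W)) \<le> 2 ^ u * (\<beta> + h)"
proof -
  let ?A = "{T\<in>X. card (T \<inter> U) \<in> {2..<r}}"
  have fin: "finite \<T>" using assms(4) by (rule finite_subset) simp
  have "(\<Sum>T\<in>\<T>. p ^ card (K2 T - W)) \<le> (\<Sum>T\<in>\<T>\<inter>?A. p ^ card (K2 T - W)) + (\<Sum>T\<in>{T\<in>\<T>. T \<subseteq> U}. p ^ card (K2 T - W))"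
  proof -
    have "\<T> = (\<T>\<inter>?A) \<union> {T\<in>\<T>. T \<subseteq> U}" using assms(4) overlap_cases by blast
    then have "(\<Sum>T\<in>\<T>. p ^ card (K2 T - W)) = (\<Sum>T\<in>(\<T>\<inter>?A) \<union> {T\<in>\<T>. T \<subseteq> U}. p ^ card (K2 T - W))" by simp
    also have "\<dots> \<le> (\<Sum>T\<in>\<T>\<inter>?A. p ^ card (K2 T - W)) + (\<Sum>T\<in>{T\<in>\<T>. T \<subseteq> U}. p ^ card (K2 T - W))"
      using fin p0 by (subst sum_Un) (auto intro!: sum_nonneg)
    finally show ?thesis .
  qed
  also have "(\<Sum>T\<in>\<T>\<inter>?A. p ^ card (K2 T - W)) \<le> (\<Sum>T\<in>\<T>\<inter>?A. cond U T)"
  proof (rule sum_mono)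
    fix T assume "T \<in> \<T> \<inter> ?A"
    then show "p ^ card (K2 T - W) \<le> cond U T"
      using assms(3) by (intro power_le card_mono) auto
  qed
  also have "\<dots> \<le> (\<Sum>T\<in>?A. cond U T)" using p0 by (intro sum_mono2) auto
  also have "\<dots> \<le> 2 ^ u * \<beta>" using assms by (intro sum_extension_strict)
  also have "(\<Sum>T\<in>{T\<in>\<T>. T \<subseteq> U}. p ^ card (K2 T - W)) \<le> (\<Sum>T\<in>{T\<in>\<T>. T \<subseteq> U}. h)"
    using h by (intro sum_mono) auto
  also have "\<dots> \<le> 2 ^ u * h"
  proof -
    have "card {T\<in>\<T>. T \<subseteq> U} \<le> card {T\<in>X. T \<subseteq> U}" using assms(4) by (intro card_mono) auto
    then have "real (card {T\<in>\<T>. T \<subseteq> U}) \<le> 2 ^ u" using card_subsets_le[OF assms(1,2)] by linarith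
    then show ?thesis using \<open>0 \<le> h\<close> by (simp add: mult_right_mono)
  qed
  finally show ?thesis by (simp add: distrib_left)
qed

lemma sum_extension:
  assumes "U \<subseteq> {..<n}" "card U \<le> u" "W \<subseteq> K2 U" "\<T> \<subseteq> {T\<in>X. 2 \<le> card (T \<inter> U)}"
  shows "(\<Sum>T\<in>\<T>. p ^ card (K2 T - W)) \<le> 2 ^ u * (\<beta> + 1)"
  using assms p0 p_le_1 by (intro sum_extension_le) (auto intro: power_le_one)

lemma card_Un_edges:
  assumes "finite B" "finite A"
  shows "card (A \<union> B) = card A + card (B - A)"
  using assms by (metis Diff_disjoint Un_Diff_cancel card_Un_disjoint finite_Diff)

text \<open>Fix T with overlap s. A third clique either has a vertex outside the 2-cluster, and is
  an extension counted by \<beta>, or lies inside it and then needs at least max 1 (r - s - 1) new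
  edges. Summing over s gives \<kappa>.\<close>

lemma cluster_sum_le:
  assumes S: "S \<in> X"
  shows "(\<Sum>T\<in>nbrs S. \<Sum>U\<in>clus S T. cond3 S T U) \<le> B3"
proof -
  have inner: "(\<Sum>U\<in>clus S T. cond3 S T U)
     \<le> cond S T * (2 ^ (2 * r) * (\<beta> + p ^ max 1 (r - card (T \<inter> S) - 1)))" if T: "T \<in> nbrs S" for T
  proof -
    have TX: "T \<in> X" using T by simp
    have split: "card ((K2 T \<union> K2 U) - K2 S) = card (K2 T - K2 S) + card (K2 U - (K2 S \<union> K2 T))" if "U \<in> X" for U
    proof -
      have "(K2 T \<union> K2 U) - K2 S = (K2 T - K2 S) \<union> (K2 U - (K2 S \<union> K2 T))" by auto
      then show ?thesis using that TX S by (simp, subst card_Un_disjoint) auto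
    qed
    have "(\<Sum>U\<in>clus S T. cond3 S T U)
      = cond S T * (\<Sum>U\<in>clus S T. p ^ card (K2 U - (K2 S \<union> K2 T)))"
      unfolding sum_distrib_left by (intro sum.cong refl) (simp add: split power_add)
    also have "\<dots> \<le> cond S T * (2 ^ (2 * r) * (\<beta> + p ^ max 1 (r - card (T \<inter> S) - 1)))"
    proof (intro mult_left_mono sum_extension_le[where U="S \<union> T"])
      show "S \<union> T \<subseteq> {..<n}" using S TX XD by blast
      show "card (S \<union> T) \<le> 2 * r" using card_Un_le[of S T] S TX XD by simp
      show "K2 S \<union> K2 T \<subseteq> K2 (S \<union> T)" by (auto simp: nsets_def)
      show "clus S T \<subseteq> {Ta \<in> X. 2 \<le> card (Ta \<inter> (S \<union> T))}"
      proof
        fix U assume U: "U \<in> clus S T"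
        then have "2 \<le> card (U \<inter> S) \<or> 2 \<le> card (U \<inter> T)" using XD by (auto simp: adj_iff)
        moreover have "card (U \<inter> S) \<le> card (U \<inter> (S \<union> T))" "card (U \<inter> T) \<le> card (U \<inter> (S \<union> T))"
          using U XD by (auto intro!: card_mono)
        ultimately show "U \<in> {Ta \<in> X. 2 \<le> card (Ta \<inter> (S \<union> T))}" using U by auto
      qed
      show "p ^ card (K2 U - (K2 S \<union> K2 T)) \<le> p ^ max 1 (r - card (T \<inter> S) - 1)"
        if "U \<in> clus S T" "U \<subseteq> S \<union> T" for U
      proof (rule power_le)
        have "max 1 (r - card (S \<inter> T) - 1) \<le> card (K2 U - (K2 S \<union> K2 T))"
          using that S TX XD by (intro card_new_edges_ge) auto
        then show "max 1 (r - card (T \<inter> S) - 1) \<le> card (K2 U - (K2 S \<union> K2 T))" by (simp only: Int_commute)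
      qed
    qed (use p0 in auto)
    finally show ?thesis .
  qed
  have "(\<Sum>T\<in>nbrs S. \<Sum>U\<in>clus S T. cond3 S T U)
     \<le> (\<Sum>T\<in>nbrs S. p ^ ((r choose 2) - (card (T \<inter> S) choose 2))
         * (2 ^ (2 * r) * (\<beta> + p ^ max 1 (r - card (T \<inter> S) - 1))))"
    using inner by (intro sum_mono) (simp add: card_nsets_Diff XD)
  also have "\<dots> \<le> 2 ^ r * (\<Sum>s\<in>{2..<r}. real n ^ (r - s) * (p ^ (exc s)
         * (2 ^ (2 * r) * (\<beta> + p ^ max 1 (r - s - 1)))))"
    unfolding nbrs_eq[OF S] using S XD p0 \<beta>_nonneg
    by (intro sum_by_overlap_le) (auto intro!: mult_nonneg_nonneg add_nonneg_nonneg)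
  also have "\<dots> = B3"
    unfolding \<kappa>_def sum_distrib_left
    by (intro sum.cong refl) (simp add: power_mult power_add[symmetric] mult_ac power3_eq_cube power2_eq_square power_mult_distrib[symmetric])
  finally show ?thesis .
qed

end

section \<open>Clusters in the random graph\<close>

context clique_setting
begin

abbreviation EE :: "nat set set" where "EE \<equiv> nsets {..<n} 2"

definition \<pi> :: real where "\<pi> = p ^ (r choose 2)"
definition \<mu> :: real where "\<mu> = real (n choose r) * \<pi>"

lemma \<pi>_pos: "0 < \<pi>" using p0 by (simp add: \<pi>_def)

lemma card_X: "card X = n choose r" by (simp add: card_nsets)

lemma mu_eq: "mu r n p = \<mu>" by (simp add: mu_def \<mu>_def \<pi>_def)

lemma \<mu>_nonneg: "0 \<le> \<mu>" using \<pi>_pos by (simp add: \<mu>_def)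

lemma finite_EE [simp]: "finite EE" by (rule finite_imp_finite_nsets) simp

lemma K2_subset: "S \<in> X \<Longrightarrow> K2 S \<subseteq> EE" by (intro nsets_mono XD)

lemma gnp_expectation: "measure_pmf.expectation (gnp n p) f = bexp EE p f"
  unfolding gnp_def using p0 p_half by (intro expectation_random_subset) auto

lemma gnp_prob: "measure_pmf.prob (gnp n p) A = bexp EE p (\<lambda>G. of_bool (G \<in> A))"
proof -
  have "measure_pmf.prob (gnp n p) A = measure_pmf.expectation (gnp n p) (indicator A)" by simp
  then show ?thesis unfolding gnp_expectation indicator_def of_bool_def by simp
qed

lemma bexp_supset: "W \<subseteq> EE \<Longrightarrow> bexp EE p (\<lambda>G. of_bool (W \<subseteq> G)) = p ^ card W"
  by (rule bexp_subset) auto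

lemma prob_clique_ev: "S \<in> X \<Longrightarrow> measure_pmf.prob (gnp n p) (clique_ev S) = \<pi>"
  using bexp_supset[OF K2_subset, of S] by (simp add: gnp_prob clique_ev_def XD \<pi>_def)

lemma prob_clique_ev2:
  "S \<in> X \<Longrightarrow> T \<in> X \<Longrightarrow> measure_pmf.prob (gnp n p) (clique_ev S \<inter> clique_ev T) = joint S T"
  using bexp_supset[of "K2 S \<union> K2 T"] K2_subset by (simp add: gnp_prob clique_ev_def)

lemma cond_prob_supset:
  assumes "A \<subseteq> EE" "B \<subseteq> EE"
  shows "\<P>(G in measure_pmf (gnp n p). B \<subseteq> G \<bar> A \<subseteq> G) = p ^ card (B - A)"
proof -
  have fin: "finite A" "finite B" using assms by (auto intro: finite_subset[OF _ finite_EE])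
  have "measure_pmf.prob (gnp n p) {G. B \<subseteq> G \<and> A \<subseteq> G} = bexp EE p (\<lambda>G. of_bool (A \<union> B \<subseteq> G))"
    unfolding gnp_prob by (intro bexp_cong) auto
  also have "\<dots> = p ^ card (A \<union> B)" using assms by (intro bexp_supset) auto
  also have "\<dots> = p ^ card A * p ^ card (B - A)" using fin by (simp add: card_Un_edges power_add)
  finally show ?thesis
    using assms p0 by (simp add: cond_prob_def) (simp add: gnp_prob bexp_supset)
qed

lemma Sigma_nbrs: "{(S, T). S \<in> X \<and> T \<in> X \<and> adj S T} = Sigma X nbrs"
  using adj_commute by auto

lemma power_card_Un: "S \<in> X \<Longrightarrow> T \<in> X \<Longrightarrow> joint S T = \<pi> * cond S T"
  by (simp add: card_Un_edges power_add XD \<pi>_def)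

lemma Delta2_eq: "Delta2 r n p = 1/2 * (\<Sum>S\<in>X. \<Sum>T\<in>nbrs S. joint S T)"
  unfolding Delta2_def Sigma_nbrs by (simp add: sum.Sigma[symmetric] prob_clique_ev2)

lemma Delta2_0_eq: "Delta2_0 r n p = 1/2 * (\<Sum>S\<in>X. \<Sum>T\<in>nbrs S. \<pi> * \<pi>)"
  unfolding Delta2_0_def Sigma_nbrs by (simp add: sum.Sigma[symmetric] prob_clique_ev)

lemma Q2_eq: "H \<subseteq> X \<Longrightarrow> Q2 r n H = 1/2 * (\<Sum>S\<in>H. real (card (nbrs S \<inter> H)))"
proof -
  assume H: "H \<subseteq> X"
  have "(\<Sum>S\<in>X. \<Sum>T\<in>nbrs S. of_bool (S \<in> H \<and> T \<in> H) :: real) = (\<Sum>S\<in>X. if S \<in> H then real (card (nbrs S \<inter> H)) else 0)"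
    by (intro sum.cong refl) (simp add: of_bool_def sum.If_cases Int_def conj_commute)
  also have "\<dots> = (\<Sum>S\<in>H. real (card (nbrs S \<inter> H)))"
    using H by (simp add: sum.If_cases Int_absorb1)
  finally show ?thesis unfolding Q2_def Sigma_nbrs by (simp add: sum.Sigma[symmetric])
qed

definition triples :: "(nat set \<times> nat set \<times> nat set) set" where
  "triples = {(S, T, U). S \<in> X \<and> T \<in> X \<and> U \<in> X \<and> distinct [S, T, U] \<and> is_3_cluster {S, T, U}}"

definition quadruples :: "(nat set \<times> nat set \<times> nat set \<times> nat set) set" where
  "quadruples = {(S, S', T', T). S \<in> X \<and> S' \<in> X \<and> T' \<in> X \<and> T \<in> X \<and> distinct [S, S', T', T] \<and>
          adj S S' \<and> adj S' T' \<and> adj T' T \<and> \<not> adj S' T \<and> \<not> adj S T'}"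

lemma finite_triples: "finite triples"
  by (rule finite_subset[of _ "X \<times> X \<times> X"]) (auto simp: triples_def)

lemma finite_quadruples: "finite quadruples"
  by (rule finite_subset[of _ "X \<times> X \<times> X \<times> X"]) (auto simp: quadruples_def)

lemma Q3_eq: "Q3 r n p H = (\<Sum>(S, T, U)\<in>triples. of_bool (S \<in> H \<and> T \<in> H) * cond S U)"
proof -
  have "\<P>(G in measure_pmf (gnp n p). G \<in> clique_ev U \<bar> G \<in> clique_ev S) = cond S U"
    if "(S, T, U) \<in> triples" for S T U
    using that cond_prob_supset[of "K2 S" "K2 U"] K2_subset by (simp add: triples_def clique_ev_def)
  then show ?thesis unfolding Q3_def triples_def[symmetric] by (intro sum.cong refl) auto
qed

lemma Q4_eq: "Q4 r n p H = (\<Sum>(S, S', T', T)\<in>quadruples. of_bool (S \<in> H \<and> T \<in> H)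
    * p ^ card ((K2 S' \<union> K2 T') - (K2 S \<union> K2 T)))"
proof -
  have "\<P>(G in measure_pmf (gnp n p). G \<in> clique_ev S' \<inter> clique_ev T' \<bar> G \<in> clique_ev S \<inter> clique_ev T)
      = p ^ card ((K2 S' \<union> K2 T') - (K2 S \<union> K2 T))"
    if "(S, S', T', T) \<in> quadruples" for S S' T' T
    using that cond_prob_supset[of "K2 S \<union> K2 T" "K2 S' \<union> K2 T'"] K2_subset
    by (simp add: quadruples_def clique_ev_def)
  then show ?thesis unfolding Q4_def quadruples_def[symmetric] by (intro sum.cong refl) auto
qed

lemma is_3_cluster_if:
  assumes "distinct [S, T, U]" "adj S U" "adj T U"
  shows "is_3_cluster {S, T, U}"
  unfolding is_3_cluster_def
proof (intro conjI ballI)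
  show "card {S, T, U} = 3" using assms by auto
  let ?R = "{(A, B). A \<in> {S, T, U} \<and> B \<in> {S, T, U} \<and> adj A B}"
  have R: "(S, U) \<in> ?R" "(U, S) \<in> ?R" "(T, U) \<in> ?R" "(U, T) \<in> ?R"
    using assms adj_commute by auto
  fix A B assume AB: "A \<in> {S, T, U}" "B \<in> {S, T, U}"
  have "(A, U) \<in> ?R\<^sup>*"
    using AB(1) r_into_rtrancl[OF R(1)] r_into_rtrancl[OF R(3)] rtrancl_refl[of U ?R] by blast
  moreover have "(U, B) \<in> ?R\<^sup>*"
    using AB(2) r_into_rtrancl[OF R(2)] r_into_rtrancl[OF R(4)] rtrancl_refl[of U ?R] by blast
  ultimately show "(A, B) \<in> ?R\<^sup>*" by (rule rtrancl_trans)
qed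

lemma is_3_cluster_first_step:
  assumes "is_3_cluster K" "A \<in> K"
  shows "\<exists>B\<in>K. adj A B"
proof -
  have "card K = 3" using assms by (simp add: is_3_cluster_def)
  then have "K \<noteq> {A}" by auto
  then obtain C where C: "C \<in> K" "C \<noteq> A" using assms(2) by blast
  let ?R = "{(A, B). A \<in> K \<and> B \<in> K \<and> adj A B}"
  have "(A, C) \<in> ?R\<^sup>*" using assms C(1) unfolding is_3_cluster_def by blast
  then obtain B where "(A, B) \<in> ?R" using C(2) by (cases rule: converse_rtranclE) blast+
  then show ?thesis by blast
qed

text \<open>In a connected graph on three vertices S has a neighbour, and the remaining vertex is
  attached to S or to that neighbour. Hence each triple of \<open>Q3\<close> is enumerated by
  \<open>nbrs\<close> and \<open>clus\<close>, possibly with its last two entries exchanged.\<close>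

lemma triples_cases:
  assumes "(S, T, U) \<in> triples"
  shows "(T \<in> nbrs S \<and> U \<in> clus S T) \<or> (U \<in> nbrs S \<and> T \<in> clus S U)"
proof -
  have m: "S \<in> X" "T \<in> X" "U \<in> X" and d: "S \<noteq> T" "S \<noteq> U" "T \<noteq> U" and c: "is_3_cluster {S, T, U}"
    using assms by (simp_all add: triples_def)
  have irr: "\<not> adj Z Z" for Z by (simp add: adj_def)
  have 1: "adj S T \<or> adj S U" using is_3_cluster_first_step[OF c, of S] irr by simp
  have 2: "adj T S \<or> adj T U" using is_3_cluster_first_step[OF c, of T] irr by simp
  have 3: "adj U S \<or> adj U T" using is_3_cluster_first_step[OF c, of U] irr by simp
  have com: "adj S T \<longleftrightarrow> adj T S" "adj S U \<longleftrightarrow> adj U S" "adj U T \<longleftrightarrow> adj T U" using adj_commute by blast+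
  show ?thesis using 1 2 3 com m d by simp
qed

lemma sum_nbrs_Un_le: "S \<in> X \<Longrightarrow> (\<Sum>T\<in>nbrs S. joint S T) \<le> \<pi> * B2"
proof -
  assume S: "S \<in> X"
  have "(\<Sum>T\<in>nbrs S. joint S T) = \<pi> * (\<Sum>T\<in>nbrs S. cond S T)"
    unfolding sum_distrib_left using S by (intro sum.cong refl) (simp add: power_card_Un)
  then show ?thesis using sum_nbrs_le[OF S] \<pi>_pos by simp
qed

lemma Delta2_le: "Delta2 r n p \<le> \<mu> * B2 / 2"
proof -
  have "(\<Sum>S\<in>X. \<Sum>T\<in>nbrs S. joint S T) \<le> (\<Sum>S\<in>X. \<pi> * B2)"
    by (intro sum_mono sum_nbrs_Un_le)
  then show ?thesis unfolding Delta2_eq \<mu>_def by (simp add: card_X)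
qed

lemma power_card_Un3:
  assumes "S \<in> X" "T \<in> X" "U \<in> X"
  shows "joint3 S T U = \<pi> * cond3 S T U"
proof -
  have "card (K2 S \<union> (K2 T \<union> K2 U)) = card (K2 S) + card ((K2 T \<union> K2 U) - K2 S)"
    using assms by (intro card_Un_edges) auto
  then show ?thesis using assms by (simp add: Un_assoc power_add XD \<pi>_def)
qed

lemma sum_cluster_Un_le:
  assumes "S \<in> X"
  shows "(\<Sum>T\<in>nbrs S. \<Sum>U\<in>clus S T. joint3 S T U) \<le> \<pi> * B3"
proof -
  have "(\<Sum>T\<in>nbrs S. \<Sum>U\<in>clus S T. joint3 S T U)
     = \<pi> * (\<Sum>T\<in>nbrs S. \<Sum>U\<in>clus S T. cond3 S T U)"
    unfolding sum_distrib_left using assms by (intro sum.cong refl) (simp add: power_card_Un3)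
  then show ?thesis using cluster_sum_le[OF assms] \<pi>_pos by simp
qed

lemma total_cluster_sum_le:
  "(\<Sum>S\<in>X. \<Sum>T\<in>nbrs S. \<Sum>U\<in>clus S T. joint3 S T U) \<le> \<mu> * B3"
proof -
  have "(\<Sum>S\<in>X. \<Sum>T\<in>nbrs S. \<Sum>U\<in>clus S T. joint3 S T U)
      \<le> (\<Sum>S\<in>X. \<pi> * B3)"
    by (intro sum_mono sum_cluster_Un_le)
  then show ?thesis unfolding \<mu>_def by (simp add: card_X)
qed

text \<open>The total increase in the probabilities of the neighbours of S caused by S being a
  clique. It is the same for every S, so a closed form avoids choosing a representative; multiplied
  by \<mu> it is twice the difference of \<open>Delta2\<close> and \<open>Delta2_0\<close>.\<close>

definition nbr_excess :: real where
  "nbr_excess = (\<Sum>s\<in>{2..<r}. real ((r choose s) * ((n - r) choose (r - s))) * (p ^ (exc s) - \<pi>))"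

lemma sum_nbrs_excess: "S \<in> X \<Longrightarrow> (\<Sum>T\<in>nbrs S. cond S T - \<pi>) = nbr_excess"
proof -
  assume S: "S \<in> X"
  have "(\<Sum>T\<in>nbrs S. cond S T - \<pi>)
     = (\<Sum>T\<in>{T\<in>X. card (T \<inter> S) \<in> {2..<r}}. p ^ ((r choose 2) - (card (T \<inter> S) choose 2)) - \<pi>)"
    unfolding nbrs_eq[OF S] by (intro sum.cong refl) (auto simp: card_nsets_Diff XD)
  also have "\<dots> = nbr_excess"
    unfolding nbr_excess_def using XD[OF S] by (subst sum_by_overlap) auto
  finally show ?thesis .
qed

lemma excess_nonneg: "S \<in> X \<Longrightarrow> T \<in> X \<Longrightarrow> \<pi> \<le> cond S T"
  unfolding \<pi>_def by (rule power_le) (metis card_K2 card_mono Diff_subset finite_K2)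

lemma Delta2_diff: "2 * (Delta2 r n p - Delta2_0 r n p) = \<mu> * nbr_excess"
proof -
  have "2 * (Delta2 r n p - Delta2_0 r n p) = (\<Sum>S\<in>X. \<Sum>T\<in>nbrs S. joint S T - \<pi> * \<pi>)"
    unfolding Delta2_eq Delta2_0_eq by (simp add: sum_subtractf)
  also have "\<dots> = (\<Sum>S\<in>X. \<pi> * (\<Sum>T\<in>nbrs S. cond S T - \<pi>))"
    unfolding sum_distrib_left by (intro sum.cong refl) (simp add: power_card_Un algebra_simps)
  also have "\<dots> = (\<Sum>S\<in>X. \<pi> * nbr_excess)" by (intro sum.cong refl) (simp only: sum_nbrs_excess)
  finally show ?thesis by (simp add: \<mu>_def card_X)
qed

end

section \<open>The probability of a given clique hypergraph\<close>

locale clique_config = clique_setting +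
  fixes H :: "nat set set"
  assumes clique_hypergraph_H: "\<exists>G\<subseteq>nsets {..<n} 2. H = clique_hypergraph r n G"
begin

abbreviation R :: "nat set set" where "R \<equiv> shadow H"
abbreviation F :: "nat set \<Rightarrow> nat set set" where "F T \<equiv> K2 T - R"
abbreviation H_nbrs :: "nat set \<Rightarrow> nat set set" where "H_nbrs T \<equiv> {S\<in>H. adj S T}"

lemma H_subset: "H \<subseteq> X"
  using clique_hypergraph_H by (auto simp: clique_hypergraph_def)

lemma finite_H [simp]: "finite H" using H_subset finite_X by (rule finite_subset)

lemma R_subset: "R \<subseteq> EE" using H_subset K2_subset by (auto simp: shadow_def)

text \<open>If all edges of T were in the shadow, T would be a clique in any graph whose clique
  hypergraph is \<open>H\<close>, and so would belong to \<open>H\<close>. This is where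
  \<open>H\<close> has to be a clique hypergraph.\<close>

lemma not_covered: "T \<in> X - H \<Longrightarrow> F T \<noteq> {}"
  using clique_hypergraph_H by (auto simp: clique_hypergraph_def shadow_def)

sublocale sf: set_family EE p F "X - H"
proof
  show "F T \<noteq> {}" if "T \<in> X - H" for T using that by (rule not_covered)
qed (use p0 p_half K2_subset in auto)

section \<open>The r-sets outside H by their number of neighbours in H\<close>

definition J0 where "J0 = {T\<in>X - H. card (H_nbrs T) = 0}"
definition J1 where "J1 = {T\<in>X - H. card (H_nbrs T) = 1}"
definition J2 where "J2 = {T\<in>X - H. 2 \<le> card (H_nbrs T)}"

lemma finite_H_nbrs [simp]: "finite (H_nbrs T)" by simp

lemma J_partition: "X - H = J0 \<union> J1 \<union> J2" "J0 \<inter> J1 = {}" "(J0 \<union> J1) \<inter> J2 = {}"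
proof -
  have "card (H_nbrs T) = 0 \<or> card (H_nbrs T) = 1 \<or> 2 \<le> card (H_nbrs T)" for T by linarith
  then show "X - H = J0 \<union> J1 \<union> J2" unfolding J0_def J1_def J2_def by blast
  show "J0 \<inter> J1 = {}"
  proof (rule equals0I)
    fix T assume "T \<in> J0 \<inter> J1"
    then have "card (H_nbrs T) = 0" "card (H_nbrs T) = 1" unfolding J0_def J1_def by blast+
    then show False by linarith
  qed
  show "(J0 \<union> J1) \<inter> J2 = {}"
  proof (rule equals0I)
    fix T assume "T \<in> (J0 \<union> J1) \<inter> J2"
    then have "card (H_nbrs T) = 0 \<or> card (H_nbrs T) = 1" "2 \<le> card (H_nbrs T)" unfolding J0_def J1_def J2_def by blast+
    then show False by linarith
  qed
qed

lemma J0_iff: "T \<in> J0 \<longleftrightarrow> T \<in> X - H \<and> H_nbrs T = {}"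
  unfolding J0_def using finite_H_nbrs[of T] by (simp only: mem_Collect_eq card_0_eq)

lemma J_sub: "J0 \<subseteq> X - H" "J1 \<subseteq> X - H" "J2 \<subseteq> X - H"
  by (auto simp: J0_def J1_def J2_def)

lemma finite_J [simp]: "finite J0" "finite J1" "finite J2"
  by (rule finite_subset[OF _ finite_X], use J_sub in blast)+

lemma K2_Int_R: "T \<in> X - H \<Longrightarrow> K2 T \<inter> R = K2 T \<inter> (\<Union>S\<in>H_nbrs T. K2 S)"
  by (auto simp: shadow_def adj_def)

lemma F_J0: "T \<in> J0 \<Longrightarrow> F T = K2 T"
  using K2_Int_R[of T] by (auto simp: J0_iff)

lemma J1_nbr:
  assumes "T \<in> J1"
  obtains Y where "H_nbrs T = {Y}" "Y \<in> H" "Y \<in> X" "T \<in> nbrs Y" "F T = K2 T - K2 Y"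
proof -
  obtain Y where Y: "H_nbrs T = {Y}" using assms by (auto simp: J1_def card_1_singleton_iff)
  have "K2 T \<inter> R = K2 T \<inter> K2 Y" using K2_Int_R[of T] J_sub(2) assms Y by auto
  moreover have "Y \<in> H" "adj Y T" using Y by auto
  moreover have "Y \<in> X" using \<open>Y \<in> H\<close> H_subset by auto
  ultimately show ?thesis using that[of Y] Y J_sub(2) assms adj_commute by blast
qed

definition H_nbr :: "nat set \<Rightarrow> nat set" where "H_nbr T = the_elem (H_nbrs T)"

lemma H_nbr:
  assumes "T \<in> J1"
  shows "H_nbrs T = {H_nbr T}" "H_nbr T \<in> H" "H_nbr T \<in> X" "T \<in> nbrs (H_nbr T)" "F T = K2 T - K2 (H_nbr T)"
  using J1_nbr[OF assms] unfolding H_nbr_def by (metis the_elem_eq)+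

text \<open>The exponent r - 1 is the least number of edges that a clique adds to a different one,
  attained at overlap r - 1. Thus \<delta> bounds \<open>sf.q\<close> on \<open>J0\<close> and
  \<open>J1\<close>, but not on \<open>J2\<close>, where several members of \<open>H\<close> may
  cover all edges but one.\<close>

definition \<delta> :: real where "\<delta> = p ^ (r - 1)"

lemma \<delta>: "0 < \<delta>" "\<delta> \<le> 1/2" "\<pi> \<le> \<delta>"
proof -
  show "0 < \<delta>" using p0 by (simp add: \<delta>_def)
  have "\<delta> \<le> p ^ 1" unfolding \<delta>_def using r3 by (intro power_le) simp
  then show "\<delta> \<le> 1/2" using p_half by simp
  have "r - 1 \<le> r choose 2" using r3 by (cases r) (auto simp: numeral_2_eq_2)
  then show "\<pi> \<le> \<delta>" unfolding \<pi>_def \<delta>_def by (rule power_le)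
qed

lemma power_nbr_le_\<delta>:
  assumes "S \<in> X" "T \<in> nbrs S"
  shows "cond S T \<le> \<delta>"
  unfolding \<delta>_def
proof (rule power_le)
  define s where "s = card (T \<inter> S)"
  have s: "s < r" "T \<in> X" using assms nbrs_eq[OF assms(1)] by (auto simp: s_def)
  have "(r - 1) + (s choose 2) \<le> r choose 2"
  proof -
    obtain m where m: "r = Suc m" using r3 by (cases r) auto
    have "s choose 2 \<le> m choose 2" using s m by (intro binomial_right_mono) simp
    then show ?thesis by (simp add: m numeral_2_eq_2)
  qed
  then show "r - 1 \<le> card (K2 T - K2 S)" using s XD by (simp add: card_nsets_Diff s_def)
qed

lemma q_J0: "T \<in> J0 \<Longrightarrow> p ^ card (F T) = \<pi>"
  using J_sub(1) XD by (auto simp: F_J0 \<pi>_def)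

lemma q_J1: "T \<in> J1 \<Longrightarrow> p ^ card (F T) \<le> \<delta>"
  using H_nbr[of T] power_nbr_le_\<delta> by auto

lemma \<pi>_le_q: "T \<in> X \<Longrightarrow> \<pi> \<le> p ^ card (F T)"
  unfolding \<pi>_def by (rule power_le) (metis card_K2 card_mono Diff_subset finite_K2)

lemma q_half: "T \<in> X - H \<Longrightarrow> p ^ card (F T) \<le> 1/2"
proof -
  assume "T \<in> X - H"
  then have "1 \<le> card (F T)" using not_covered[of T] by (simp add: Suc_le_eq card_gt_0_iff)
  then have "p ^ card (F T) \<le> p ^ 1" by (rule power_le)
  then show ?thesis using p_half by simp
qed

section \<open>The r-sets with no neighbour in H\<close>

definition g :: "nat set \<Rightarrow> real" where "g S = (\<Sum>T\<in>nbrs S. joint S T)"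

lemma g_nonneg: "0 \<le> g S" unfolding g_def using p0 by (intro sum_nonneg) auto

abbreviation e :: real where "e \<equiv> real (card H)"

lemma B_nonneg: "0 \<le> B2" "0 \<le> B3" using \<beta>_nonneg \<kappa>_nonneg by auto

lemma sum_H_le: "(\<And>S. S \<in> H \<Longrightarrow> f S \<le> c) \<Longrightarrow> sum f H \<le> e * c" for c :: real
  by (metis (no_types, lifting) sum_bounded_above)

text \<open>An r-set outside \<open>J0\<close> is in \<open>H\<close> or adjacent to some Y in
  \<open>H\<close>. In the second case a neighbour T of it is either Y itself, which gives another
  \<pi> * \<open>B2\<close>, or completes a 3-cluster with Y, whose probability given Y dominates
  \<open>joint S T\<close> because it requires fewer edges.\<close>

lemma sum_g_le: "(\<Sum>S\<in>X - J0. g S) \<le> e * (2 * \<pi> * B2 + B3)"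
proof -
  have "X - J0 \<subseteq> H \<union> (\<Union>Y\<in>H. nbrs Y)"
  proof
    fix S assume S: "S \<in> X - J0"
    show "S \<in> H \<union> (\<Union>Y\<in>H. nbrs Y)"
    proof (cases "S \<in> H")
      case False
      then obtain Y where "Y \<in> H" "adj Y S" using S J0_iff[of S] by auto
      then show ?thesis using S adj_commute[of Y S] by auto
    qed simp
  qed
  then have "(\<Sum>S\<in>X - J0. g S) \<le> (\<Sum>S\<in>H \<union> (\<Union>Y\<in>H. nbrs Y). g S)"
    using g_nonneg by (intro sum_mono2) auto
  also have "\<dots> \<le> (\<Sum>S\<in>H. g S) + (\<Sum>S\<in>(\<Union>Y\<in>H. nbrs Y). g S)"
    using g_nonneg by (subst sum_Un) (auto intro!: sum_nonneg)
  also have "(\<Sum>S\<in>(\<Union>Y\<in>H. nbrs Y). g S) \<le> (\<Sum>Y\<in>H. \<Sum>S\<in>nbrs Y. g S)"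
    using g_nonneg finite_H by (intro sum_UN_le) auto
  also have "\<dots> \<le> e * (\<pi> * B2 + B3)"
  proof (rule sum_H_le)
    fix Y assume "Y \<in> H"
    then have Y: "Y \<in> X" using H_subset by auto
    have "g S \<le> joint Y S + (\<Sum>T\<in>clus Y S. cond3 Y S T)" if S: "S \<in> nbrs Y" for S
    proof -
      have "g S \<le> (\<Sum>T\<in>insert Y (nbrs S - {Y}). joint S T)"
        unfolding g_def using p0 by (intro sum_mono2) auto
      also have "\<dots> = joint Y S + (\<Sum>T\<in>nbrs S - {Y}. joint S T)"
        by (subst sum.insert) (auto simp: Un_commute)
      also have "(\<Sum>T\<in>nbrs S - {Y}. joint S T) \<le> (\<Sum>T\<in>nbrs S - {Y}. cond3 Y S T)"
        using S by (intro sum_mono power_le card_mono) auto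
      also have "\<dots> \<le> (\<Sum>T\<in>clus Y S. cond3 Y S T)"
        using p0 by (intro sum_mono2) (auto simp: adj_def)
      finally show ?thesis by simp
    qed
    then have "(\<Sum>S\<in>nbrs Y. g S) \<le> (\<Sum>S\<in>nbrs Y. joint Y S + (\<Sum>T\<in>clus Y S. cond3 Y S T))"
      by (rule sum_mono)
    also have "\<dots> \<le> \<pi> * B2 + B3"
      unfolding sum.distrib using Y by (intro add_mono sum_nbrs_Un_le cluster_sum_le)
    finally show "(\<Sum>S\<in>nbrs Y. g S) \<le> \<pi> * B2 + B3" .
  qed
  also have "(\<Sum>S\<in>H. g S) \<le> e * (\<pi> * B2)"
    unfolding g_def using H_subset by (intro sum_H_le sum_nbrs_Un_le) auto
  finally show ?thesis by (simp add: algebra_simps)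
qed

abbreviation "A0 \<equiv> (\<Sum>S\<in>J0. \<Sum>T\<in>sf.nbs J0 S. sf.q2 S T - sf.q S * sf.q T)"

lemma nbs_J0: "S \<in> J0 \<Longrightarrow> sf.nbs J0 S = nbrs S \<inter> J0"
  using J_sub(1) by (auto simp: F_J0 adj_def)

text \<open>Enlarging \<open>J0\<close> to all r-sets adds only ordered pairs with a member outside
  \<open>J0\<close>. Each of the two positions contributes at most the sum bounded in
  \<open>sum_g_le\<close>, and halving compensates for the two positions.\<close>

lemma A0_bounds: "\<bar>A0 / 2 - (Delta2 r n p - Delta2_0 r n p)\<bar> \<le> e * (2 * \<pi> * B2 + B3)"
proof -
  let ?f = "\<lambda>S T. joint S T - \<pi> * \<pi>"
  let ?w = "\<lambda>S T. if adj S T then joint T S else 0"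
  let ?XN = "(\<Sum>S\<in>X. \<Sum>T\<in>nbrs S. ?f S T)"
  let ?far = "(\<Sum>S\<in>X - J0. \<Sum>T\<in>nbrs S. ?f S T)"
  let ?out = "(\<Sum>S\<in>J0. \<Sum>T\<in>nbrs S - J0. ?f S T)"
  have f0: "0 \<le> ?f S T" if "S \<in> X" "T \<in> X" for S T
    using that excess_nonneg[of S T] \<pi>_pos by (simp add: power_card_Un)
  have A0: "A0 = (\<Sum>S\<in>J0. \<Sum>T\<in>nbrs S \<inter> J0. ?f S T)"
  proof (rule sum.cong[OF refl])
    fix S assume S: "S \<in> J0"
    show "(\<Sum>T\<in>sf.nbs J0 S. sf.q2 S T - sf.q S * sf.q T) = (\<Sum>T\<in>nbrs S \<inter> J0. ?f S T)"
      unfolding nbs_J0[OF S]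
    proof (rule sum.cong[OF refl])
      fix T assume "T \<in> nbrs S \<inter> J0"
      then have T: "T \<in> J0" by simp
      show "sf.q2 S T - sf.q S * sf.q T = ?f S T"
        unfolding q_J0[OF S] q_J0[OF T] by (simp only: F_J0[OF S] F_J0[OF T])
    qed
  qed
  have D: "2 * (Delta2 r n p - Delta2_0 r n p) = ?XN"
    unfolding Delta2_eq Delta2_0_eq by (simp add: sum_subtractf)
  have X: "X = J0 \<union> (X - J0)" using J_sub(1) by auto
  have "?XN = (\<Sum>S\<in>J0. \<Sum>T\<in>nbrs S. ?f S T) + ?far"
    by (subst X, subst sum.union_disjoint) auto
  moreover have "(\<Sum>S\<in>J0. \<Sum>T\<in>nbrs S. ?f S T) = A0 + ?out"
    unfolding A0 sum.distrib[symmetric]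
  proof (rule sum.cong[OF refl])
    fix S
    have "nbrs S = (nbrs S \<inter> J0) \<union> (nbrs S - J0)" by auto
    then show "(\<Sum>T\<in>nbrs S. ?f S T) = (\<Sum>T\<in>nbrs S \<inter> J0. ?f S T) + (\<Sum>T\<in>nbrs S - J0. ?f S T)"
      using sum.union_disjoint[of "nbrs S \<inter> J0" "nbrs S - J0" "?f S"] by auto
  qed
  moreover have "?out \<le> (\<Sum>S\<in>X - J0. g S)"
  proof -
    have "?out \<le> (\<Sum>S\<in>J0. \<Sum>T\<in>X - J0. ?w S T)"
    proof (rule sum_mono)
      fix S
      have "(\<Sum>T\<in>nbrs S - J0. ?f S T) \<le> (\<Sum>T\<in>nbrs S - J0. joint T S)"
        using \<pi>_pos by (intro sum_mono) (simp add: Un_commute)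
      also have "\<dots> = (\<Sum>T\<in>X - J0. ?w S T)"
        by (subst sum.inter_filter[symmetric]) (auto intro!: sum.cong simp: adj_commute)
      finally show "(\<Sum>T\<in>nbrs S - J0. ?f S T) \<le> (\<Sum>T\<in>X - J0. ?w S T)" .
    qed
    also have "\<dots> = (\<Sum>T\<in>X - J0. \<Sum>S\<in>J0. ?w S T)"
      by (rule sum.swap)
    also have "\<dots> \<le> (\<Sum>T\<in>X - J0. g T)"
    proof (rule sum_mono)
      fix T
      have "(\<Sum>S\<in>J0. ?w S T) = (\<Sum>S\<in>{S\<in>J0. adj S T}. joint T S)"
        by (rule sum.inter_filter[symmetric]) simp
      also have "\<dots> \<le> g T" unfolding g_def using J_sub(1) p0 by (intro sum_mono2) auto
      finally show "(\<Sum>S\<in>J0. ?w S T) \<le> g T" .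
    qed
    finally show ?thesis .
  qed
  moreover have "?far \<le> (\<Sum>S\<in>X - J0. g S)"
    unfolding g_def using \<pi>_pos by (intro sum_mono) simp
  moreover have "0 \<le> ?out" "0 \<le> ?far"
    using f0 J_sub(1) by (intro sum_nonneg; blast)+
  moreover have "\<bar>a / 2 - d\<bar> \<le> z"
    if "s = s1 + s2" "s1 = a + t" "t \<le> u" "s2 \<le> u" "0 \<le> t" "0 \<le> s2" "u \<le> z" "2 * d = s"
    for a d z s s1 s2 t u :: real
    using that by linarith
  ultimately show ?thesis using sum_g_le D by blast
qed

text \<open>On \<open>J0\<close> no edge is covered by the shadow, so all probabilities are the
  unconditional ones. The errors can be extended to sums over all r-sets and no longer refer to
  \<open>H\<close>.\<close>

lemma ln_pr_J0:
  "\<bar>ln (sf.pr (avoids F J0)) - card J0 * ln (1 - \<pi>) - A0 / 2\<bar> \<le> 2 * (\<mu> * B3) + 3 * \<delta> * (\<mu> * B2)"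
proof -
  have "\<bar>ln (sf.pr (avoids F J0)) - (\<Sum>j\<in>J0. ln (1 - sf.q j)) - A0 / 2\<bar>
    \<le> 2 * (\<Sum>j\<in>J0. \<Sum>k\<in>sf.nbs J0 j. \<Sum>l\<in>sf.nbs2 J0 j k. sf.q3 j k l)
      + 3 * \<delta> * (\<Sum>j\<in>J0. \<Sum>k\<in>sf.nbs J0 j. sf.q2 j k)"
    using J_sub(1) \<delta> q_J0 by (intro sf.ln_pr_avoids_second_order) auto
  moreover have "(\<Sum>j\<in>J0. \<Sum>k\<in>sf.nbs J0 j. sf.q2 j k) \<le> \<mu> * B2"
  proof -
    have "(\<Sum>j\<in>J0. \<Sum>k\<in>sf.nbs J0 j. sf.q2 j k) \<le> (\<Sum>j\<in>J0. g j)"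
    proof (rule sum_mono)
      fix j assume j: "j \<in> J0"
      have "(\<Sum>k\<in>sf.nbs J0 j. sf.q2 j k) = (\<Sum>k\<in>nbrs j \<inter> J0. joint j k)"
        unfolding nbs_J0[OF j] by (intro sum.cong refl) (simp add: F_J0 j del: card_nsets)
      also have "\<dots> \<le> g j" unfolding g_def using p0 by (intro sum_mono2) auto
      finally show "(\<Sum>k\<in>sf.nbs J0 j. sf.q2 j k) \<le> g j" .
    qed
    also have "\<dots> \<le> (\<Sum>j\<in>X. g j)" using J_sub(1) g_nonneg by (intro sum_mono2) auto
    also have "\<dots> = 2 * Delta2 r n p" by (simp add: Delta2_eq g_def)
    also have "\<dots> \<le> \<mu> * B2" using Delta2_le by simp
    finally show ?thesis .
  qed
  moreover have "(\<Sum>j\<in>J0. \<Sum>k\<in>sf.nbs J0 j. \<Sum>l\<in>sf.nbs2 J0 j k. sf.q3 j k l) \<le> \<mu> * B3"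
  proof -
    let ?q3 = "\<lambda>j k l. joint3 j k l"
    have "(\<Sum>j\<in>J0. \<Sum>k\<in>sf.nbs J0 j. \<Sum>l\<in>sf.nbs2 J0 j k. sf.q3 j k l)
      \<le> (\<Sum>j\<in>J0. \<Sum>k\<in>nbrs j. \<Sum>l\<in>clus j k. ?q3 j k l)"
    proof (rule sum_mono)
      fix j assume j: "j \<in> J0"
      have "(\<Sum>k\<in>sf.nbs J0 j. \<Sum>l\<in>sf.nbs2 J0 j k. sf.q3 j k l) = (\<Sum>k\<in>nbrs j \<inter> J0. \<Sum>l\<in>sf.nbs2 J0 j k. sf.q3 j k l)"
        by (simp only: nbs_J0[OF j])
      also have "\<dots> \<le> (\<Sum>k\<in>nbrs j \<inter> J0. \<Sum>l\<in>clus j k. ?q3 j k l)"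
      proof (rule sum_mono)
        fix k assume k: "k \<in> nbrs j \<inter> J0"
        have "(\<Sum>l\<in>sf.nbs2 J0 j k. sf.q3 j k l) = (\<Sum>l\<in>sf.nbs2 J0 j k. ?q3 j k l)"
          using j k by (intro sum.cong refl) (simp add: F_J0)
        also have "\<dots> \<le> (\<Sum>l\<in>clus j k. ?q3 j k l)"
          using p0 J_sub(1) j k by (intro sum_mono2) (auto simp: F_J0 adj_def)
        finally show "(\<Sum>l\<in>sf.nbs2 J0 j k. sf.q3 j k l) \<le> (\<Sum>l\<in>clus j k. ?q3 j k l)" .
      qed
      also have "\<dots> \<le> (\<Sum>k\<in>nbrs j. \<Sum>l\<in>clus j k. ?q3 j k l)"
        using p0 by (intro sum_mono2 sum_nonneg) auto
      finally show "(\<Sum>k\<in>sf.nbs J0 j. \<Sum>l\<in>sf.nbs2 J0 j k. sf.q3 j k l) \<le> (\<Sum>k\<in>nbrs j. \<Sum>l\<in>clus j k. ?q3 j k l)" .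
    qed
    also have "\<dots> \<le> (\<Sum>j\<in>X. \<Sum>k\<in>nbrs j. \<Sum>l\<in>clus j k. ?q3 j k l)"
      using J_sub(1) p0 by (intro sum_mono2 sum_nonneg) auto
    also have "\<dots> \<le> \<mu> * B3" by (rule total_cluster_sum_le)
    finally show ?thesis .
  qed
  then have "2 * (\<Sum>j\<in>J0. \<Sum>k\<in>sf.nbs J0 j. \<Sum>l\<in>sf.nbs2 J0 j k. sf.q3 j k l) \<le> 2 * (\<mu> * B3)" by simp
  moreover have "(\<Sum>j\<in>J0. ln (1 - sf.q j)) = card J0 * ln (1 - \<pi>)" by (simp add: q_J0)
  ultimately show ?thesis
    using mult_left_mono[of "(\<Sum>j\<in>J0. \<Sum>k\<in>sf.nbs J0 j. sf.q2 j k)" "\<mu> * B2" "3 * \<delta>"] \<delta>(1) by linarith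
qed

section \<open>The r-sets with exactly one neighbour in H\<close>

abbreviation "J1_error \<equiv> (\<Sum>T\<in>J1. \<Sum>U\<in>sf.nbs (J0 \<union> J1) T. sf.q2 T U)"

text \<open>If the adjacent \<open>T\<close> and \<open>U\<close> have different neighbours in \<open>H\<close>, these span an induced path counted by \<open>Q4\<close>.\<close>

lemma J1_error_le: "J1_error \<le> Q4 r n p H + e * B3"
proof -
  let ?N = "\<lambda>T. sf.nbs (J0 \<union> J1) T"
  let ?P = "Sigma J1 ?N"
  let ?far = "{(T, U)\<in>?P. U \<in> J1 \<and> H_nbr U \<noteq> H_nbr T}"
  let ?near = "?P - ?far"
  have finP: "finite ?P" by (intro finite_SigmaI) auto
  have adjP: "T \<in> J1" "U \<in> J0 \<union> J1" "U \<noteq> T" "adj U T" "T \<in> X - H" "U \<in> X - H" if "(T, U) \<in> ?P" for T U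
    using that J_sub by (auto simp: adj_def)
  have "J1_error = (\<Sum>(T, U)\<in>?P. sf.q2 T U)" by (intro sum.Sigma) auto
  also have "\<dots> = (\<Sum>(T, U)\<in>?near. sf.q2 T U) + (\<Sum>(T, U)\<in>?far. sf.q2 T U)"
    using finP by (intro sum.subset_diff) auto
  finally have split: "J1_error = (\<Sum>(T, U)\<in>?near. sf.q2 T U) + (\<Sum>(T, U)\<in>?far. sf.q2 T U)" .
  \<comment> \<open>Here U is in \<open>J0\<close> or has the same neighbour Y in \<open>H\<close>
    as T, so Y, T, U is a 3-cluster and the missing edges are precisely those of T and U outside
    Y.\<close>
  have "(\<Sum>(T, U)\<in>?near. sf.q2 T U) \<le> e * B3"
  proof -
    let ?S = "Sigma H (\<lambda>Y. Sigma (nbrs Y) (clus Y))"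
    let ?h = "\<lambda>(T, U). (H_nbr T, T, U)"
    have near: "sf.q2 T U = p ^ card ((K2 T \<union> K2 U) - K2 (H_nbr T)) \<and> (H_nbr T, T, U) \<in> ?S" if TU: "(T, U) \<in> ?near" for T U
    proof -
      have P: "(T, U) \<in> ?P" using TU by auto
      note a = adjP[OF P]
      note h = H_nbr[OF a(1)]
      have "F U \<union> F T = (K2 T \<union> K2 U) - K2 (H_nbr T)"
      proof (cases "U \<in> J1")
        case True
        then have "H_nbr U = H_nbr T" using TU by auto
        then show ?thesis using H_nbr(5)[OF True] h(5) by auto
      next
        case False
        then have U: "U \<in> J0" using a(2) by auto
        then have "K2 U \<inter> K2 (H_nbr T) = {}" using h(2) F_J0[OF U] by (auto simp: shadow_def)
        then show ?thesis using F_J0[OF U] h(5) by auto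
      qed
      moreover have "U \<noteq> H_nbr T" using a(6) h(2) by auto
      ultimately show ?thesis using a h by (auto simp: Un_commute)
    qed
    have "(\<Sum>(T, U)\<in>?near. sf.q2 T U) = (\<Sum>z\<in>?near. (\<lambda>(Y, T, U). cond3 Y T U) (?h z))"
      using near by (intro sum.cong refl) auto
    also have "\<dots> = (\<Sum>(Y, T, U)\<in>?h ` ?near. cond3 Y T U)"
      by (subst sum.reindex) (auto simp: inj_on_def o_def)
    also have "\<dots> \<le> (\<Sum>(Y, T, U)\<in>?S. cond3 Y T U)"
    proof (rule sum_mono2)
      show "finite ?S" by (intro finite_SigmaI) auto
      show "?h ` ?near \<subseteq> ?S"
      proof (rule image_subsetI)
        fix z assume z: "z \<in> ?near"
        obtain T U where "z = (T, U)" by (cases z)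
        then show "?h z \<in> ?S" using near[of T U] z by (simp only: case_prod_conv)
      qed
    qed (use p0 in auto)
    also have "\<dots> = (\<Sum>Y\<in>H. \<Sum>(T, U)\<in>Sigma (nbrs Y) (clus Y). cond3 Y T U)"
      by (subst sum.Sigma) (auto intro!: finite_SigmaI)
    also have "\<dots> = (\<Sum>Y\<in>H. \<Sum>T\<in>nbrs Y. \<Sum>U\<in>clus Y T. cond3 Y T U)"
      by (intro sum.cong refl, subst sum.Sigma) auto
    also have "\<dots> \<le> e * B3" using H_subset by (intro sum_H_le cluster_sum_le) auto
    finally show ?thesis .
  qed
  moreover have "(\<Sum>(T, U)\<in>?far. sf.q2 T U) \<le> Q4 r n p H"
  proof -
    let ?h = "\<lambda>(T, U). (H_nbr T, T, U, H_nbr U)"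
    let ?v = "\<lambda>(S, S', T', T). of_bool (S \<in> H \<and> T \<in> H) * p ^ card ((K2 S' \<union> K2 T') - (K2 S \<union> K2 T))"
    have far: "sf.q2 T U = ?v (?h (T, U)) \<and> ?h (T, U) \<in> quadruples" if TU: "(T, U) \<in> ?far" for T U
    proof -
      have P: "(T, U) \<in> ?P" and U: "U \<in> J1" and ne: "H_nbr U \<noteq> H_nbr T" using TU by auto
      note a = adjP[OF P]
      note h = H_nbr[OF a(1)] and h' = H_nbr[OF U]
      \<comment> \<open>T has no neighbour in \<open>H\<close> besides \<open>H_nbr T\<close>, and
        likewise for U; this yields the two non-adjacencies demanded of a quadruple.\<close>
      have nT: "\<not> adj (H_nbr U) T" using h(1) h'(2) ne by blast
      have nU: "\<not> adj (H_nbr T) U" using h'(1) h(2) ne by blast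
      have "K2 T \<inter> K2 (H_nbr U) = {}" "K2 U \<inter> K2 (H_nbr T) = {}"
        using nT nU a(5,6) h(2) h'(2) by (auto simp: adj_def)
      then have "F T \<union> F U = (K2 T \<union> K2 U) - (K2 (H_nbr T) \<union> K2 (H_nbr U))" using h(5) h'(5) by auto
      moreover have "?h (T, U) \<in> quadruples"
        unfolding quadruples_def using a h h' nT nU ne by (auto simp: adj_commute)
      ultimately show ?thesis using h(2) h'(2) by simp
    qed
    have "(\<Sum>(T, U)\<in>?far. sf.q2 T U) = (\<Sum>z\<in>?far. ?v (?h z))"
      using far by (intro sum.cong refl) auto
    also have "\<dots> = (\<Sum>z\<in>?h ` ?far. ?v z)"
      by (subst sum.reindex) (auto simp: inj_on_def o_def)
    also have "\<dots> \<le> (\<Sum>z\<in>quadruples. ?v z)"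
    proof (rule sum_mono2[OF finite_quadruples])
      show "?h ` ?far \<subseteq> quadruples"
      proof (rule image_subsetI)
        fix z assume z: "z \<in> ?far"
        obtain T U where "z = (T, U)" by (cases z)
        then show "?h z \<in> quadruples" using far[of T U] z by (simp only: case_prod_conv)
      qed
    qed (use p0 in auto)
    finally show ?thesis by (simp add: Q4_eq)
  qed
  ultimately show ?thesis using split by linarith
qed

lemma CH_eq: "CH r n p H = (\<Sum>T\<in>J2. sf.q T)"
  unfolding CH_def J2_def by (intro sum.cong) auto

lemma nbr_excess_bounds: "0 \<le> nbr_excess" "X \<noteq> {} \<Longrightarrow> nbr_excess \<le> B2"
proof -
  show "0 \<le> nbr_excess"
    unfolding nbr_excess_def \<pi>_def using power_le by (intro sum_nonneg mult_nonneg_nonneg) auto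
  show "nbr_excess \<le> B2" if ne: "X \<noteq> {}"
  proof -
    obtain S where S: "S \<in> X" using ne by blast
    have "nbr_excess \<le> (\<Sum>T\<in>nbrs S. cond S T)"
      unfolding sum_nbrs_excess[OF S, symmetric] using \<pi>_pos by (intro sum_mono) auto
    then show ?thesis using sum_nbrs_le[OF S] by linarith
  qed
qed

lemma sum_J1_eq: "(\<Sum>T\<in>J1. f (H_nbr T) T) = (\<Sum>Y\<in>H. \<Sum>T\<in>nbrs Y \<inter> J1. f Y T)" for f :: "nat set \<Rightarrow> nat set \<Rightarrow> real"
proof -
  have "(\<Sum>T\<in>J1. f (H_nbr T) T) = (\<Sum>Y\<in>H. \<Sum>T\<in>{T\<in>J1. H_nbr T = Y}. f (H_nbr T) T)"
    using H_nbr(2) by (intro sum.group[symmetric]) auto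
  also have "\<dots> = (\<Sum>Y\<in>H. \<Sum>T\<in>nbrs Y \<inter> J1. f Y T)"
  proof (rule sum.cong[OF refl])
    fix Y assume Y: "Y \<in> H"
    have eq: "{T\<in>J1. H_nbr T = Y} = nbrs Y \<inter> J1"
    proof (intro set_eqI iffI)
      fix T assume "T \<in> {T\<in>J1. H_nbr T = Y}" then show "T \<in> nbrs Y \<inter> J1" using H_nbr(4) by auto
    next
      fix T assume T: "T \<in> nbrs Y \<inter> J1"
      then have "Y \<in> H_nbrs T" using Y adj_commute by blast
      then show "T \<in> {T\<in>J1. H_nbr T = Y}" using T H_nbr(1)[of T] by auto
    qed
    have "(\<Sum>T\<in>{T\<in>J1. H_nbr T = Y}. f (H_nbr T) T) = (\<Sum>T\<in>{T\<in>J1. H_nbr T = Y}. f Y T)"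
      by (intro sum.cong) auto
    then show "(\<Sum>T\<in>{T\<in>J1. H_nbr T = Y}. f (H_nbr T) T) = (\<Sum>T\<in>nbrs Y \<inter> J1. f Y T)"
      by (simp only: eq)
  qed
  finally show ?thesis .
qed

text \<open>The quantity e * \<open>nbr_excess\<close> counts all neighbours T of all Y in
  \<open>H\<close>. Those outside \<open>J1\<close> are either in \<open>H\<close>, so that the pair
  is counted by \<open>Q2\<close> and contributes at most \<delta>, or in \<open>J2\<close>, where a
  second neighbour of T in \<open>H\<close> completes a triple counted by \<open>Q3\<close>.\<close>

lemma sum_excess_J1: "\<bar>(\<Sum>T\<in>J1. sf.q T - \<pi>) - e * nbr_excess\<bar> \<le> 2 * \<delta> * Q2 r n H + Q3 r n p H"
proof -
  let ?f = "\<lambda>Y T. cond Y T - \<pi>"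
  have f0: "0 \<le> ?f Y T" if "Y \<in> X" "T \<in> X" for Y T using that excess_nonneg by simp
  have "(\<Sum>T\<in>J1. sf.q T - \<pi>) = (\<Sum>T\<in>J1. ?f (H_nbr T) T)" using H_nbr(5) by (intro sum.cong) auto
  also have "\<dots> = (\<Sum>Y\<in>H. \<Sum>T\<in>nbrs Y \<inter> J1. ?f Y T)" by (rule sum_J1_eq)
  finally have 1: "(\<Sum>T\<in>J1. sf.q T - \<pi>) = (\<Sum>Y\<in>H. \<Sum>T\<in>nbrs Y \<inter> J1. ?f Y T)" .
  have "e * nbr_excess = (\<Sum>Y\<in>H. \<Sum>T\<in>nbrs Y. ?f Y T)"
    using H_subset sum_nbrs_excess by (subst sum.cong[OF refl, where h="\<lambda>_. nbr_excess"]) auto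
  also have "\<dots> = (\<Sum>Y\<in>H. \<Sum>T\<in>nbrs Y \<inter> J1. ?f Y T) + (\<Sum>Y\<in>H. \<Sum>T\<in>nbrs Y - J1. ?f Y T)"
    unfolding sum.distrib[symmetric]
  proof (intro sum.cong refl)
    fix Y
    have "nbrs Y = (nbrs Y \<inter> J1) \<union> (nbrs Y - J1)" by auto
    then show "(\<Sum>T\<in>nbrs Y. ?f Y T) = (\<Sum>T\<in>nbrs Y \<inter> J1. ?f Y T) + (\<Sum>T\<in>nbrs Y - J1. ?f Y T)"
      using sum.union_disjoint[of "nbrs Y \<inter> J1" "nbrs Y - J1" "?f Y"] by auto
  qed
  finally have 2: "e * nbr_excess - (\<Sum>T\<in>J1. sf.q T - \<pi>) = (\<Sum>Y\<in>H. \<Sum>T\<in>nbrs Y - J1. ?f Y T)" using 1 by simp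
  have ge: "0 \<le> (\<Sum>Y\<in>H. \<Sum>T\<in>nbrs Y - J1. ?f Y T)"
    using f0 H_subset by (intro sum_nonneg) blast
  have "(\<Sum>Y\<in>H. \<Sum>T\<in>nbrs Y - J1. ?f Y T) \<le> (\<Sum>Y\<in>H. (\<Sum>T\<in>nbrs Y \<inter> H. \<delta>) + (\<Sum>T\<in>nbrs Y \<inter> J2. cond Y T))"
  proof (rule sum_mono)
    fix Y assume Y: "Y \<in> H"
    have YX: "Y \<in> X" using Y H_subset by auto
    have "nbrs Y - J1 \<subseteq> (nbrs Y \<inter> H) \<union> (nbrs Y \<inter> J2)"
    proof
      fix T assume T: "T \<in> nbrs Y - J1"
      then have "Y \<in> H_nbrs T" using Y adj_commute by blast
      then have "T \<notin> J0" by (auto simp: J0_iff)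
      then show "T \<in> (nbrs Y \<inter> H) \<union> (nbrs Y \<inter> J2)" using T J_partition(1) by blast
    qed
    then have "(\<Sum>T\<in>nbrs Y - J1. ?f Y T) \<le> (\<Sum>T\<in>(nbrs Y \<inter> H) \<union> (nbrs Y \<inter> J2). ?f Y T)"
      using f0 YX by (intro sum_mono2) auto
    also have "\<dots> = (\<Sum>T\<in>nbrs Y \<inter> H. ?f Y T) + (\<Sum>T\<in>nbrs Y \<inter> J2. ?f Y T)"
      using J_sub(3) by (intro sum.union_disjoint) auto
    also have "\<dots> \<le> (\<Sum>T\<in>nbrs Y \<inter> H. \<delta>) + (\<Sum>T\<in>nbrs Y \<inter> J2. cond Y T)"
      using \<pi>_pos power_nbr_le_\<delta>[OF YX] by (intro add_mono sum_mono) force+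
    finally show "(\<Sum>T\<in>nbrs Y - J1. ?f Y T) \<le> (\<Sum>T\<in>nbrs Y \<inter> H. \<delta>) + (\<Sum>T\<in>nbrs Y \<inter> J2. cond Y T)" .
  qed
  also have "\<dots> = 2 * \<delta> * Q2 r n H + (\<Sum>Y\<in>H. \<Sum>T\<in>nbrs Y \<inter> J2. cond Y T)"
    by (simp add: sum.distrib Q2_eq[OF H_subset] sum_distrib_left mult.commute)
  also have "(\<Sum>Y\<in>H. \<Sum>T\<in>nbrs Y \<inter> J2. cond Y T) \<le> Q3 r n p H"
  proof -
    let ?S = "Sigma H (\<lambda>Y. nbrs Y \<inter> J2)"
    \<comment> \<open>Any second neighbour serves. As Y and T remain components of the triple, the
      map from pairs to triples is injective whatever the choice.\<close>
    define oth where "oth Y T = (SOME Z. Z \<in> H_nbrs T \<and> Z \<noteq> Y)" for Y T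
    have oth: "oth Y T \<in> H_nbrs T" "oth Y T \<noteq> Y" if "T \<in> J2" for Y T
    proof -
      have "\<exists>Z. Z \<in> H_nbrs T \<and> Z \<noteq> Y"
      proof (rule ccontr)
        assume "\<not> ?thesis"
        then have "H_nbrs T \<subseteq> {Y}" by auto
        then have "card (H_nbrs T) \<le> card {Y}" by (intro card_mono) auto
        then show False using that by (simp add: J2_def)
      qed
      then have "oth Y T \<in> H_nbrs T \<and> oth Y T \<noteq> Y" unfolding oth_def by (rule someI_ex)
      then show "oth Y T \<in> H_nbrs T" "oth Y T \<noteq> Y" by auto
    qed
    let ?h = "\<lambda>(Y, T). (Y, oth Y T, T)"
    let ?v = "\<lambda>(S, T, U). of_bool (S \<in> H \<and> T \<in> H) * cond S U"
    have "(\<Sum>Y\<in>H. \<Sum>T\<in>nbrs Y \<inter> J2. cond Y T) = (\<Sum>(Y, T)\<in>?S. cond Y T)"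
      by (intro sum.Sigma) auto
    also have "\<dots> = (\<Sum>z\<in>?S. ?v (?h z))"
      using oth(1) by (intro sum.cong refl) auto
    also have "\<dots> = (\<Sum>z\<in>?h ` ?S. ?v z)"
      by (subst sum.reindex) (auto simp: inj_on_def o_def)
    also have "\<dots> \<le> (\<Sum>z\<in>triples. ?v z)"
    proof (rule sum_mono2[OF finite_triples])
      show "?h ` ?S \<subseteq> triples"
      proof clarify
        fix Y T assume Y: "Y \<in> H" and T: "T \<in> X" "adj T Y" "T \<in> J2"
        have oo: "oth Y T \<in> H" "adj (oth Y T) T" "oth Y T \<noteq> Y" using oth[OF T(3)] by auto
        have d: "distinct [Y, oth Y T, T]" using oo T(2) by (auto simp: adj_def)
        then have "is_3_cluster {Y, oth Y T, T}" using T(2) oo adj_commute by (intro is_3_cluster_if) blast+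
        then show "(Y, oth Y T, T) \<in> triples" unfolding triples_def using d Y oo T H_subset by auto
      qed
    qed (use p0 in auto)
    finally show ?thesis by (simp add: Q3_eq)
  qed
  finally show ?thesis using 2 ge by linarith
qed

text \<open>Every member of \<open>J1\<close> is compared with the generic factor 1 - \<pi>. The
  first-order part is kept exactly, and the remainder is at most \<delta> times the expected number
  of extensions of members of \<open>H\<close>.\<close>

lemma ln_ratio_J1:
  "\<bar>(\<Sum>T\<in>J1. ln (1 - sf.q T)) - card J1 * ln (1 - \<pi>) + (\<Sum>T\<in>J1. sf.q T - \<pi>)\<bar> \<le> 2 * \<delta> * (e * B2)"
proof -
  have "\<bar>ln (1 - sf.q T) - ln (1 - \<pi>) + (sf.q T - \<pi>)\<bar> \<le> 2 * \<delta> * sf.q T" if T: "T \<in> J1" for T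
  proof -
    have "T \<in> X" using T J_sub by blast
    then have 1: "\<pi> \<le> sf.q T" by (rule \<pi>_le_q)
    have 2: "sf.q T \<le> \<delta>" using q_J1[OF T] .
    have 3: "sf.q T - \<pi> \<le> sf.q T" "0 \<le> \<pi>" "sf.q T \<le> 1/2" using \<pi>_pos 2 \<delta> by auto
    show ?thesis using ln_shift_bounds[OF 3(2) 1 3(3) 2 3(1)] \<delta>(1) 1 \<pi>_pos by (auto simp: abs_le_iff)
  qed
  then have "(\<Sum>T\<in>J1. \<bar>ln (1 - sf.q T) - ln (1 - \<pi>) + (sf.q T - \<pi>)\<bar>) \<le> (\<Sum>T\<in>J1. 2 * \<delta> * sf.q T)"
    by (rule sum_mono)
  then have "\<bar>\<Sum>T\<in>J1. ln (1 - sf.q T) - ln (1 - \<pi>) + (sf.q T - \<pi>)\<bar> \<le> (\<Sum>T\<in>J1. 2 * \<delta> * sf.q T)"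
    by (rule order_trans[OF sum_abs])
  also have "\<dots> = 2 * \<delta> * (\<Sum>T\<in>J1. p ^ card (K2 T - K2 (H_nbr T)))"
    unfolding sum_distrib_left using H_nbr(5) by (intro sum.cong) auto
  also have "\<dots> \<le> 2 * \<delta> * (e * B2)"
  proof (rule mult_left_mono)
    have "(\<Sum>T\<in>J1. p ^ card (K2 T - K2 (H_nbr T))) = (\<Sum>Y\<in>H. \<Sum>T\<in>nbrs Y \<inter> J1. cond Y T)"
      by (rule sum_J1_eq)
    also have "\<dots> \<le> (\<Sum>Y\<in>H. \<Sum>T\<in>nbrs Y. cond Y T)"
      using p0 by (intro sum_mono sum_mono2) auto
    also have "\<dots> \<le> e * B2" using H_subset by (intro sum_H_le sum_nbrs_le) auto
    finally show "(\<Sum>T\<in>J1. p ^ card (K2 T - K2 (H_nbr T))) \<le> e * B2" .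
  qed (use \<delta> in auto)
  finally show ?thesis by (simp add: sum.distrib sum_subtractf)
qed

text \<open>Origin of the constants, using e <= 2 * \<mu>. For \<open>CH\<close>: 2 from discarding
  \<open>J2\<close> and 2 from its missing factors 1 - \<pi>. For \<mu> * \<open>B3\<close>: 2 from
  \<open>ln_pr_J0\<close>, 2 from \<open>A0_bounds\<close>, 4 from \<open>J1_error\<close>. For
  \<delta> * \<mu> * \<open>B2\<close>: 3, 4 and 4 from \<open>ln_pr_J0\<close>,
  \<open>A0_bounds\<close> and \<open>ln_ratio_J1\<close>. The last term is the price of replacing e
  by \<mu> in e * \<open>nbr_excess\<close>.\<close>

lemma ln_pr_bounds:
  assumes w: "\<bar>e - \<mu>\<bar> \<le> w * sqrt \<mu>" "w * sqrt \<mu> \<le> \<mu>" and "r \<le> n"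
  shows "\<bar>ln (sf.pr (avoids F (X - H))) - (real (n choose r) - e) * ln (1 - \<pi>)
      + (Delta2 r n p - Delta2_0 r n p)\<bar>
    \<le> 4 * CH r n p H + 2 * Q4 r n p H + Q3 r n p H + 2 * \<delta> * Q2 r n H
      + 8 * (\<mu> * B3) + 11 * \<delta> * (\<mu> * B2) + w * sqrt \<mu> * B2"
proof -
  let ?L = "\<lambda>K. ln (sf.pr (avoids F K))"
  have pos: "0 < sf.pr (avoids F K)" if "K \<subseteq> X - H" for K using that by (rule sf.pr_avoids_pos)
  have qpos: "0 < 1 - sf.q T" if "T \<in> X - H" for T using q_half[OF that] by simp
  have e2: "e \<le> 2 * \<mu>" using w by linarith
  have lnprod: "ln (\<Prod>T\<in>A. 1 - sf.q T) = (\<Sum>T\<in>A. ln (1 - sf.q T))" "0 < (\<Prod>T\<in>A. 1 - sf.q T)"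
    if "A \<subseteq> X - H" for A
  proof -
    have fin: "finite A" using that by (rule finite_subset) simp
    have ps: "0 < 1 - sf.q T" if "T \<in> A" for T using qpos \<open>A \<subseteq> X - H\<close> that by blast
    show "ln (\<Prod>T\<in>A. 1 - sf.q T) = (\<Sum>T\<in>A. ln (1 - sf.q T))" 
      by (rule ln_prod[OF fin]) (use ps in force)
    show "0 < (\<Prod>T\<in>A. 1 - sf.q T)" by (rule prod_pos[OF ps])
  qed
  have XH: "X - H = (J0 \<union> J1) \<union> J2" using J_partition(1) by blast
  have s01: "J0 \<union> J1 \<subseteq> X - H" using J_sub by blast
  have t1: "\<bar>?L (X - H) - ?L (J0 \<union> J1)\<bar> \<le> 2 * CH r n p H"
  proof -
    have "sf.pr (avoids F (X - H)) \<le> sf.pr (avoids F (J0 \<union> J1))" using s01 by (rule sf.pr_avoids_antimono)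
    then have up: "?L (X - H) \<le> ?L (J0 \<union> J1)" using pos[of "X - H"] by simp
    have "(\<Prod>T\<in>J2. 1 - sf.q T) * sf.pr (avoids F (J0 \<union> J1)) \<le> sf.pr (avoids F (X - H))"
      unfolding XH using J_partition J_sub q_half by (intro sf.pr_avoids_Un_bounds(1)) auto
    then have "ln ((\<Prod>T\<in>J2. 1 - sf.q T) * sf.pr (avoids F (J0 \<union> J1))) \<le> ?L (X - H)"
      using pos[OF s01] lnprod(2)[OF J_sub(3)] by (intro ln_mono) auto
    then have "(\<Sum>T\<in>J2. ln (1 - sf.q T)) + ?L (J0 \<union> J1) \<le> ?L (X - H)"
      unfolding ln_mult_pos[OF lnprod(2)[OF J_sub(3)] pos[OF s01]] lnprod(1)[OF J_sub(3)] .
    moreover have "(\<Sum>T\<in>J2. - 2 * sf.q T) \<le> (\<Sum>T\<in>J2. ln (1 - sf.q T))"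
      using J_sub(3) q_half p0 by (intro sum_mono ln_one_minus_ge) auto
    moreover have "(\<Sum>T\<in>J2. - 2 * sf.q T) = - 2 * CH r n p H"
      unfolding CH_eq sum_distrib_left ..
    ultimately show ?thesis using up by linarith
  qed
  have t2: "\<bar>?L (J0 \<union> J1) - ?L J0 - (\<Sum>T\<in>J1. ln (1 - sf.q T))\<bar> \<le> 2 * J1_error"
  proof -
    have pre: "finite J1" "J0 \<union> J1 \<subseteq> X - H" "J0 \<inter> J1 = {}" "\<And>j. j \<in> J1 \<Longrightarrow> sf.q j \<le> 1/2"
      using s01 J_partition J_sub q_half by auto
    have P: "0 < (\<Prod>T\<in>J1. 1 - sf.q T) * sf.pr (avoids F J0)"
      using lnprod(2)[OF J_sub(2)] pos[OF J_sub(1)] by simp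
    have "ln ((\<Prod>T\<in>J1. 1 - sf.q T) * sf.pr (avoids F J0)) \<le> ?L (J0 \<union> J1)"
      using sf.pr_avoids_Un_bounds(1)[OF pre] P by (intro ln_mono)
    moreover have "?L (J0 \<union> J1) \<le> ln ((\<Prod>T\<in>J1. 1 - sf.q T) * exp (2 * J1_error) * sf.pr (avoids F J0))"
      using sf.pr_avoids_Un_bounds(2)[OF pre] pos[OF s01] by (intro ln_mono)
    moreover have "0 \<le> J1_error" using p0 by (intro sum_nonneg) auto
    moreover have "ln ((\<Prod>T\<in>J1. 1 - sf.q T) * exp (2 * J1_error) * sf.pr (avoids F J0))
        = (\<Sum>T\<in>J1. ln (1 - sf.q T)) + 2 * J1_error + ?L J0"
      using lnprod(2)[OF J_sub(2)] pos[OF J_sub(1)]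
      by (subst ln_mult_pos) (simp_all only: ln_mult_pos exp_gt_zero mult_pos_pos lnprod(1)[OF J_sub(2)] ln_exp)
    moreover have "ln ((\<Prod>T\<in>J1. 1 - sf.q T) * sf.pr (avoids F J0)) = (\<Sum>T\<in>J1. ln (1 - sf.q T)) + ?L J0"
      unfolding ln_mult_pos[OF lnprod(2)[OF J_sub(2)] pos[OF J_sub(1)]] lnprod(1)[OF J_sub(2)] ..
    moreover have "\<bar>b - a - s\<bar> \<le> 2 * x" if "c \<le> b" "b \<le> d" "0 \<le> x" "d = s + 2 * x + a" "c = s + a"
      for a b c d s x :: real
      using that by linarith
    ultimately show ?thesis by blast
  qed
  have N: "real (n choose r) - e = card J0 + card J1 + card J2"
  proof -
    have "card (X - H) = card J0 + card J1 + card J2"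
      unfolding XH using J_partition(2,3) by (simp add: card_Un_disjoint)
    moreover have "card (X - H) = card X - card H" "card H \<le> card X"
      by (rule card_Diff_subset[OF finite_H H_subset], rule card_mono[OF finite_X H_subset])
    ultimately show ?thesis by (simp add: card_X)
  qed
  \<comment> \<open>The claimed power of 1 - \<pi> also counts the members of \<open>J2\<close>. As
    \<pi> is at most \<open>sf.q T\<close>, their factors are again absorbed by
    \<open>CH\<close>.\<close>
  have t8: "\<bar>card J2 * ln (1 - \<pi>)\<bar> \<le> 2 * CH r n p H"
  proof -
    have p2: "\<pi> \<le> 1/2" using \<delta> by simp
    have "- 2 * \<pi> \<le> ln (1 - \<pi>)" using \<pi>_pos p2 by (intro ln_one_minus_ge) auto
    moreover have "ln (1 - \<pi>) \<le> 0" using \<pi>_pos p2 by simp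
    ultimately have "\<bar>ln (1 - \<pi>)\<bar> \<le> 2 * \<pi>" by simp
    then have "\<bar>card J2 * ln (1 - \<pi>)\<bar> \<le> card J2 * (2 * \<pi>)" by (simp add: abs_mult mult_left_mono)
    also have "\<dots> = (\<Sum>T\<in>J2. 2 * \<pi>)" by simp
    also have "\<dots> \<le> (\<Sum>T\<in>J2. 2 * sf.q T)" using \<pi>_le_q J_sub(3) by (intro sum_mono) auto
    finally show ?thesis by (simp only: CH_eq sum_distrib_left)
  qed
  have X_ne: "X \<noteq> {}" using assms(3) by (simp add: nsets_eq_empty_iff)
  have t7: "\<bar>e * nbr_excess - 2 * (Delta2 r n p - Delta2_0 r n p)\<bar> \<le> w * sqrt \<mu> * B2"
  proof -
    have "e * nbr_excess - 2 * (Delta2 r n p - Delta2_0 r n p) = (e - \<mu>) * nbr_excess"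
      unfolding Delta2_diff by (simp add: algebra_simps)
    also have "\<bar>\<dots>\<bar> = \<bar>e - \<mu>\<bar> * nbr_excess" using nbr_excess_bounds(1) by (simp add: abs_mult)
    also have "\<dots> \<le> w * sqrt \<mu> * B2"
      using w(1) nbr_excess_bounds(1) nbr_excess_bounds(2)[OF X_ne] by (intro mult_mono) auto
    finally show ?thesis .
  qed
  have eB3: "e * B3 \<le> 2 * (\<mu> * B3)" using mult_right_mono[OF e2 B_nonneg(2)] by (simp add: mult.assoc)
  have eB2: "e * B2 \<le> 2 * (\<mu> * B2)" using mult_right_mono[OF e2 B_nonneg(1)] by (simp add: mult.assoc)
  have "e * (2 * \<pi> * B2 + B3) = 2 * \<pi> * (e * B2) + e * B3" by (simp add: algebra_simps)
  also have "\<dots> \<le> 2 * \<delta> * (2 * (\<mu> * B2)) + 2 * (\<mu> * B3)"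
  proof (rule add_mono[OF mult_mono[OF _ eB2] eB3])
    show "2 * \<pi> \<le> 2 * \<delta>" "0 \<le> 2 * \<delta>" using \<delta> by auto
    show "0 \<le> e * B2" by (rule mult_nonneg_nonneg[OF _ B_nonneg(1)]) simp
  qed
  finally have Z: "e * (2 * \<pi> * B2 + B3) \<le> 4 * (\<delta> * (\<mu> * B2)) + 2 * (\<mu> * B3)" by simp
  have Z2: "2 * \<delta> * (e * B2) \<le> 4 * (\<delta> * (\<mu> * B2))"
    using mult_left_mono[OF eB2, of "2 * \<delta>"] \<delta>(1) by simp
  have "(real (n choose r) - e) * ln (1 - \<pi>)
    = card J0 * ln (1 - \<pi>) + card J1 * ln (1 - \<pi>) + card J2 * ln (1 - \<pi>)"
    unfolding N by (simp add: algebra_simps)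
  then show ?thesis
    using t1 t2 t7 t8 ln_pr_J0 A0_bounds J1_error_le sum_excess_J1 ln_ratio_J1 Z Z2 eB3
    unfolding abs_le_iff by argo
qed

section \<open>From avoidance to the probability of H\<close>

lemma prob_clique_hypergraph_eq:
  "measure_pmf.prob (gnp n p) {G. clique_hypergraph r n G = H} = p ^ card R * sf.pr (avoids F (X - H))"
proof -
  have eq: "clique_hypergraph r n G = H \<longleftrightarrow> R \<subseteq> G \<and> avoids K2 (X - H) G" for G
  proof
    assume "clique_hypergraph r n G = H"
    then show "R \<subseteq> G \<and> avoids K2 (X - H) G"
      by (auto simp: clique_hypergraph_def shadow_def avoids_def)
  next
    assume a: "R \<subseteq> G \<and> avoids K2 (X - H) G"
    show "clique_hypergraph r n G = H"
    proof (intro set_eqI iffI)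
      fix S assume "S \<in> clique_hypergraph r n G"
      then show "S \<in> H" using a by (auto simp: clique_hypergraph_def avoids_def)
    next
      fix S assume S: "S \<in> H"
      then have "S \<in> X" "K2 S \<subseteq> R" using H_subset by (auto simp: shadow_def)
      then show "S \<in> clique_hypergraph r n G" using a by (auto simp: clique_hypergraph_def)
    qed
  qed
  have av: "avoids K2 (X - H) (G \<union> R) = avoids F (X - H) G" for G
    unfolding avoids_def by blast
  have "measure_pmf.prob (gnp n p) {G. clique_hypergraph r n G = H}
     = bexp EE p (\<lambda>G. of_bool (R \<subseteq> G) * of_bool (avoids K2 (X - H) G))"
    unfolding gnp_prob by (intro bexp_cong) (simp add: eq)
  also have "\<dots> = p ^ card R * sf.pr (avoids F (X - H))"
    unfolding sf.pr_def using R_subset by (subst bexp_force) (auto simp: av)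
  finally show ?thesis .
qed

lemma power_shadow: "p ^ card R = \<pi> ^ card H * p powi (- tH r H)"
proof -
  have "\<pi> ^ card H * p powi (- tH r H) = p powi (int ((r choose 2) * card H)) * p powi (- tH r H)"
    by (simp add: \<pi>_def power_mult[symmetric] power_int_of_nat del: of_nat_mult)
  also have "\<dots> = p powi (int ((r choose 2) * card H) + (- tH r H))"
    using p0 by (subst power_int_add) auto
  also have "int ((r choose 2) * card H) + (- tH r H) = int (card R)" by (simp add: tH_def)
  finally show ?thesis by (simp add: power_int_of_nat)
qed

lemma prob_clique_hypergraph_exp:
  assumes w: "\<bar>e - \<mu>\<bar> \<le> w * sqrt \<mu>" "w * sqrt \<mu> \<le> \<mu>" and "r \<le> n"
  shows "\<exists>\<epsilon>. \<bar>\<epsilon>\<bar> \<le> 4 * CH r n p H + 2 * Q4 r n p H + Q3 r n p H + 2 * \<delta> * Q2 r n H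
      + 8 * (\<mu> * B3) + 11 * \<delta> * (\<mu> * B2) + w * sqrt \<mu> * B2 \<and>
    measure_pmf.prob (gnp n p) {G. clique_hypergraph r n G = H} =
      \<pi> ^ card H * (1 - \<pi>) ^ ((n choose r) - card H) * p powi (- tH r H) *
      exp (- Delta2 r n p + Delta2_0 r n p + \<epsilon>)"
proof -
  let ?P = "sf.pr (avoids F (X - H))"
  define \<epsilon> where "\<epsilon> = ln ?P - (real (n choose r) - e) * ln (1 - \<pi>) + (Delta2 r n p - Delta2_0 r n p)"
  have P: "0 < ?P" by (rule sf.pr_avoids_pos) simp
  have "\<pi> \<le> 1/2" using \<delta> by simp
  then have pos: "0 < (1 - \<pi>) ^ ((n choose r) - card H)" by simp
  have "card H \<le> card X" using H_subset by (intro card_mono) auto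
  then have m: "real (n choose r) - e = real ((n choose r) - card H)" by (simp add: card_X of_nat_diff)
  have "ln ?P = ln ((1 - \<pi>) ^ ((n choose r) - card H)) + (- Delta2 r n p + Delta2_0 r n p + \<epsilon>)"
    unfolding \<epsilon>_def ln_realpow m by linarith
  then have "exp (ln ?P) = (1 - \<pi>) ^ ((n choose r) - card H) * exp (- Delta2 r n p + Delta2_0 r n p + \<epsilon>)"
    by (simp only: exp_add exp_ln[OF pos])
  then have "?P = (1 - \<pi>) ^ ((n choose r) - card H) * exp (- Delta2 r n p + Delta2_0 r n p + \<epsilon>)"
    by (simp only: exp_ln[OF P])
  then have "measure_pmf.prob (gnp n p) {G. clique_hypergraph r n G = H} =
      \<pi> ^ card H * (1 - \<pi>) ^ ((n choose r) - card H) * p powi (- tH r H) *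
      exp (- Delta2 r n p + Delta2_0 r n p + \<epsilon>)"
    unfolding prob_clique_hypergraph_eq power_shadow by simp
  then show ?thesis using ln_pr_bounds[OF assms] unfolding \<epsilon>_def[symmetric] by blast
qed

end

section \<open>Good hypergraphs\<close>

context clique_setting
begin

section \<open>Expectations of the statistics in the definition of good\<close>

abbreviation cl :: "nat set set \<Rightarrow> nat set set" where "cl \<equiv> clique_hypergraph r n"

lemma cl_subset: "cl G \<subseteq> X" by (auto simp: clique_hypergraph_def)

lemma subset_cl: "I \<subseteq> X \<Longrightarrow> I \<subseteq> cl G \<longleftrightarrow> shadow I \<subseteq> G"
  unfolding clique_hypergraph_def shadow_def by blast

lemma shadow_subset: "I \<subseteq> X \<Longrightarrow> shadow I \<subseteq> EE"
  unfolding shadow_def using K2_subset by blast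

lemma bexp_cl: "I \<subseteq> X \<Longrightarrow> bexp EE p (\<lambda>G. of_bool (I \<subseteq> cl G)) = p ^ card (shadow I)"
  by (simp add: subset_cl bexp_supset shadow_subset)

abbreviation both :: "nat set \<Rightarrow> nat set \<Rightarrow> real" where
  "both S T \<equiv> bexp EE p (\<lambda>G. of_bool (S \<in> cl G \<and> T \<in> cl G))"

lemma bexp_cl2:
  assumes "S \<in> X" "T \<in> X"
  shows "bexp EE p (\<lambda>G. of_bool (S \<in> cl G \<and> T \<in> cl G)) = joint S T"
  using bexp_cl[of "{S, T}"] assms by (simp add: shadow_def)

lemma expectation_Q2: "bexp EE p (\<lambda>G. Q2 r n (cl G)) = Delta2 r n p"
proof -
  have "bexp EE p (\<lambda>G. Q2 r n (cl G)) = 1/2 * (\<Sum>(S, T)\<in>Sigma X nbrs. both S T)"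
    unfolding Q2_def Sigma_nbrs bexp_cmult case_prod_beta bexp_sum ..
  also have "\<dots> = 1/2 * (\<Sum>(S, T)\<in>Sigma X nbrs. joint S T)"
    by (intro arg_cong[where f="(*) (1/2)"] sum.cong refl) (auto simp: bexp_cl2)
  also have "\<dots> = Delta2 r n p" unfolding Delta2_eq by (subst sum.Sigma) auto
  finally show ?thesis .
qed

lemma power_mult_power_le: "p ^ card A * p ^ card B \<le> p ^ card (A \<union> B)"
  using card_Un_le[of A B] by (simp add: power_add[symmetric] power_le)

text \<open>The weight \<open>cond S U\<close> disregards edges that U may share with T, so its
  product with \<open>joint S T\<close> is at most \<open>joint3 S T U\<close>. The factor 2 allows
  for the two orders in which a triple is enumerated.\<close>

lemma expectation_Q3: "bexp EE p (\<lambda>G. Q3 r n p (cl G)) \<le> 2 * (\<mu> * B3)"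
proof -
  let ?f = "\<lambda>S T U. joint3 S T U"
  let ?A = "Sigma X (\<lambda>S. Sigma (nbrs S) (clus S))"
  let ?sw = "\<lambda>(S, T, U). (S, U, T)"
  have tot: "(\<Sum>(S, T, U)\<in>?A. ?f S T U) \<le> \<mu> * B3"
  proof -
    have "(\<Sum>(S, T, U)\<in>?A. ?f S T U) = (\<Sum>S\<in>X. \<Sum>(T, U)\<in>Sigma (nbrs S) (clus S). ?f S T U)"
      by (subst sum.Sigma) (auto intro!: finite_SigmaI)
    also have "\<dots> = (\<Sum>S\<in>X. \<Sum>T\<in>nbrs S. \<Sum>U\<in>clus S T. ?f S T U)"
      by (intro sum.cong refl, subst sum.Sigma) auto
    finally show ?thesis using total_cluster_sum_le by simp
  qed
  have finA: "finite ?A" by (intro finite_SigmaI) auto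
  have sw: "(\<Sum>(S, T, U)\<in>?sw ` ?A. ?f S T U) = (\<Sum>(S, T, U)\<in>?A. ?f S T U)"
  proof -
    have "inj_on ?sw ?A" by (auto simp: inj_on_def)
    then have "(\<Sum>(S, T, U)\<in>?sw ` ?A. ?f S T U) = (\<Sum>z\<in>?A. (\<lambda>(S, T, U). ?f S T U) (?sw z))"
      by (subst sum.reindex) (auto simp: o_def)
    also have "\<dots> = (\<Sum>(S, T, U)\<in>?A. ?f S T U)" by (intro sum.cong refl) (auto simp: Un_ac)
    finally show ?thesis .
  qed
  have "bexp EE p (\<lambda>G. Q3 r n p (cl G))
     = (\<Sum>(S, T, U)\<in>triples. cond S U * both S T)"
    unfolding Q3_eq bexp_sum case_prod_beta bexp_multc ..
  also have "\<dots> \<le> (\<Sum>(S, T, U)\<in>triples. ?f S T U)"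
  proof (rule sum_mono, clarify)
    fix S T U assume z: "(S, T, U) \<in> triples"
    then have "both S T = joint S T"
      by (intro bexp_cl2) (auto simp: triples_def)
    moreover have "cond S U * joint S T \<le> p ^ card ((K2 U - K2 S) \<union> (K2 S \<union> K2 T))"
      by (rule power_mult_power_le)
    moreover have "(K2 U - K2 S) \<union> (K2 S \<union> K2 T) = K2 S \<union> K2 T \<union> K2 U" by auto
    ultimately show "cond S U * both S T \<le> ?f S T U"
      by simp
  qed
  also have "\<dots> \<le> (\<Sum>(S, T, U)\<in>?A \<union> ?sw ` ?A. ?f S T U)"
  proof (rule sum_mono2)
    show "triples \<subseteq> ?A \<union> ?sw ` ?A"
    proof (rule subsetI)
      fix z assume z: "z \<in> triples"
      obtain S T U where STU: "z = (S, T, U)" by (metis prod_cases3)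
      have "S \<in> X" using z by (simp add: triples_def STU)
      then have "(S, U, T) \<in> ?A \<or> (S, T, U) \<in> ?A" using triples_cases[of S T U] z STU by blast
      moreover have "(S, T, U) \<in> ?sw ` ?A" if "(S, U, T) \<in> ?A"
        using imageI[OF that, of ?sw] by (simp only: case_prod_conv)
      ultimately show "z \<in> ?A \<union> ?sw ` ?A" unfolding STU by blast
    qed
  qed (use finA p0 in auto)
  also have "\<dots> \<le> (\<Sum>(S, T, U)\<in>?A. ?f S T U) + (\<Sum>(S, T, U)\<in>?sw ` ?A. ?f S T U)"
    using finA p0 by (subst sum_Un) (auto intro!: sum_nonneg)
  finally show ?thesis using tot sw by linarith
qed

text \<open>The first three cliques of the path form a 3-cluster, and the fourth meets it in an
  edge. Such an extension multiplies the expected number by at most a constant times \<beta> + 1, so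
  induced paths are no more frequent than 3-clusters up to constants.\<close>

lemma expectation_Q4:
  "bexp EE p (\<lambda>G. Q4 r n p (cl G)) \<le> 2 ^ (3 * r) * (\<beta> + 1) * (\<mu> * B3)"
proof -
  let ?f = "\<lambda>S T U. joint3 S T U"
  let ?W = "\<lambda>S T U. K2 S \<union> K2 T \<union> K2 U"
  let ?Z = "\<lambda>S T U. {V\<in>X. 2 \<le> card (V \<inter> (S \<union> T \<union> U))}"
  let ?D = "Sigma X (\<lambda>S. Sigma (nbrs S) (\<lambda>T. Sigma (clus S T) (\<lambda>U. ?Z S T U)))"
  have finD: "finite ?D" by (intro finite_SigmaI) auto
  have "bexp EE p (\<lambda>G. Q4 r n p (cl G))
     = (\<Sum>(S, S', T', T)\<in>quadruples. p ^ card ((K2 S' \<union> K2 T') - (K2 S \<union> K2 T)) * both S T)"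
    unfolding Q4_eq bexp_sum case_prod_beta bexp_multc ..
  also have "\<dots> \<le> (\<Sum>(S, S', T', T)\<in>quadruples. p ^ card (?W S S' T' \<union> K2 T))"
  proof (rule sum_mono, clarify)
    fix S S' T' T assume z: "(S, S', T', T) \<in> quadruples"
    then have "both S T = joint S T"
      by (intro bexp_cl2) (auto simp: quadruples_def)
    moreover have "p ^ card ((K2 S' \<union> K2 T') - (K2 S \<union> K2 T)) * joint S T
        \<le> p ^ card (((K2 S' \<union> K2 T') - (K2 S \<union> K2 T)) \<union> (K2 S \<union> K2 T))"
      by (rule power_mult_power_le)
    moreover have "((K2 S' \<union> K2 T') - (K2 S \<union> K2 T)) \<union> (K2 S \<union> K2 T) = ?W S S' T' \<union> K2 T" by auto
    ultimately show "p ^ card ((K2 S' \<union> K2 T') - (K2 S \<union> K2 T)) * both S T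
        \<le> p ^ card (?W S S' T' \<union> K2 T)"
      by simp
  qed
  also have "\<dots> \<le> (\<Sum>(S, S', T', T)\<in>?D. p ^ card (?W S S' T' \<union> K2 T))"
  proof (rule sum_mono2[OF finD])
    show "quadruples \<subseteq> ?D"
    proof (rule subsetI)
      fix z assume z: "z \<in> quadruples"
      obtain S S' T' T where eq: "z = (S, S', T', T)" by (metis prod_cases4)
      have m: "S \<in> X" "S' \<in> X" "T' \<in> X" "T \<in> X" and d: "S \<noteq> T'" "S' \<noteq> T'"
        and a: "adj S S'" "adj S' T'" "adj T' T"
        using z unfolding eq by (simp_all add: quadruples_def)
      have a': "adj S' S" "adj T' S'" "adj T T'" using a adj_commute by blast+
      have "2 \<le> card (T \<inter> T')" using a'(3) XD(1)[OF m(4)] by (simp add: adj_iff)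
      also have "\<dots> \<le> card (T \<inter> (S \<union> S' \<union> T'))" using XD(1)[OF m(4)] by (intro card_mono) auto
      finally show "z \<in> ?D" unfolding eq using m d a' by blast
    qed
  qed (use p0 in auto)
  also have "\<dots> = (\<Sum>S\<in>X. \<Sum>(S', T', T)\<in>Sigma (nbrs S) (\<lambda>T. Sigma (clus S T) (\<lambda>U. ?Z S T U)). p ^ card (?W S S' T' \<union> K2 T))"
    by (subst sum.Sigma) (auto intro!: finite_SigmaI)
  also have "\<dots> = (\<Sum>S\<in>X. \<Sum>S'\<in>nbrs S. \<Sum>(T', T)\<in>Sigma (clus S S') (\<lambda>U. ?Z S S' U). p ^ card (?W S S' T' \<union> K2 T))"
    by (intro sum.cong refl, subst sum.Sigma) (auto intro!: finite_SigmaI)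
  also have "\<dots> = (\<Sum>S\<in>X. \<Sum>S'\<in>nbrs S. \<Sum>T'\<in>clus S S'. \<Sum>T\<in>?Z S S' T'. p ^ card (?W S S' T' \<union> K2 T))"
    by (intro sum.cong refl, subst sum.Sigma) auto
  also have "\<dots> \<le> (\<Sum>S\<in>X. \<Sum>S'\<in>nbrs S. \<Sum>T'\<in>clus S S'. 2 ^ (3 * r) * (\<beta> + 1) * ?f S S' T')"
  proof (intro sum_mono)
    fix S S' T' assume m: "S \<in> X" "S' \<in> nbrs S" "T' \<in> clus S S'"
    have m': "S' \<in> X" "T' \<in> X" using m by auto
    have "(\<Sum>T\<in>?Z S S' T'. p ^ card (?W S S' T' \<union> K2 T)) = ?f S S' T' * (\<Sum>T\<in>?Z S S' T'. p ^ card (K2 T - ?W S S' T'))"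
      unfolding sum_distrib_left
    proof (rule sum.cong[OF refl])
      fix T assume "T \<in> ?Z S S' T'"
      then have "card (?W S S' T' \<union> K2 T) = card (?W S S' T') + card (K2 T - ?W S S' T')"
        using m(1) m' by (intro card_Un_edges) auto
      then show "p ^ card (?W S S' T' \<union> K2 T) = ?f S S' T' * p ^ card (K2 T - ?W S S' T')"
        by (simp only: power_add)
    qed
    also have "\<dots> \<le> ?f S S' T' * (2 ^ (3 * r) * (\<beta> + 1))"
    proof (intro mult_left_mono sum_extension)
      show "S \<union> S' \<union> T' \<subseteq> {..<n}" using XD(3) m(1) m' by blast
      show "card (S \<union> S' \<union> T') \<le> 3 * r"
        using card_Un_le[of "S \<union> S'" T'] card_Un_le[of S S'] XD(2)[OF m(1)] XD(2)[OF m'(1)] XD(2)[OF m'(2)] by linarith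
      show "?W S S' T' \<subseteq> K2 (S \<union> S' \<union> T')" by (auto simp: nsets_def)
    qed (use p0 in auto)
    finally show "(\<Sum>T\<in>?Z S S' T'. p ^ card (?W S S' T' \<union> K2 T)) \<le> 2 ^ (3 * r) * (\<beta> + 1) * ?f S S' T'"
      by (simp only: mult_ac)
  qed
  also have "\<dots> = 2 ^ (3 * r) * (\<beta> + 1) * (\<Sum>S\<in>X. \<Sum>S'\<in>nbrs S. \<Sum>T'\<in>clus S S'. ?f S S' T')"
    by (simp only: sum_distrib_left)
  also have "\<dots> \<le> 2 ^ (3 * r) * (\<beta> + 1) * (\<mu> * B3)"
    using total_cluster_sum_le \<beta>_nonneg by (intro mult_left_mono) auto
  finally show ?thesis .
qed

text \<open>The expected number of families of k neighbours of T that are cliques together with T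
  itself. It controls \<open>CH\<close>, in which T is not a clique but is weighted by the
  probability of its uncovered edges.\<close>

definition family_sum :: "nat set \<Rightarrow> nat \<Rightarrow> real" where
  "family_sum T k = (\<Sum>I\<in>{I. I \<subseteq> nbrs T \<and> card I = k}. p ^ card (K2 T \<union> shadow I))"

lemma finite_families [simp]: "finite {I. I \<subseteq> nbrs T \<and> P I}"
  by (rule finite_subset[of _ "Pow X"]) auto

lemma family_sum_2: "T \<in> X \<Longrightarrow> family_sum T 2 \<le> \<pi> * B3"
proof -
  assume T: "T \<in> X"
  let ?S = "Sigma (nbrs T) (clus T)"
  let ?i = "\<lambda>(S, U). {S, U}"
  let ?v = "\<lambda>I. p ^ card (K2 T \<union> shadow I)"
  have sub: "{I. I \<subseteq> nbrs T \<and> card I = 2} \<subseteq> ?i ` ?S"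
  proof
    fix I assume I: "I \<in> {I. I \<subseteq> nbrs T \<and> card I = 2}"
    then obtain S U where SU: "I = {S, U}" "S \<noteq> U" by (auto simp: card_2_iff)
    then have "(S, U) \<in> ?S" using I by (auto simp: adj_def)
    then have "?i (S, U) \<in> ?i ` ?S" by (rule imageI)
    then show "I \<in> ?i ` ?S" using SU by (simp only: case_prod_conv)
  qed
  have fin: "finite ?S" by (intro finite_SigmaI) auto
  have "family_sum T 2 \<le> (\<Sum>I\<in>?i ` ?S. ?v I)"
    unfolding family_sum_def using sub fin p0 by (intro sum_mono2) auto
  also have "\<dots> \<le> (\<Sum>z\<in>?S. ?v (?i z))"
    using sum_image_le[OF fin, of ?v ?i] p0 by (simp add: o_def)
  also have "\<dots> = (\<Sum>(S, U)\<in>?S. joint3 T S U)"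
    by (intro sum.cong refl) (auto simp: shadow_def Un_ac)
  also have "\<dots> = (\<Sum>S\<in>nbrs T. \<Sum>U\<in>clus T S. joint3 T S U)"
    by (subst sum.Sigma) auto
  also have "\<dots> \<le> \<pi> * B3" by (rule sum_cluster_Un_le[OF T])
  finally show ?thesis .
qed

text \<open>T and the k members of a family span at most r (k + 1) vertices, and a further neighbour
  of T is an extension of this vertex set.\<close>

lemma family_sum_Suc:
  assumes T: "T \<in> X"
  shows "family_sum T (Suc k) \<le> 2 ^ (r * (k + 1)) * (\<beta> + 1) * family_sum T k"
proof -
  let ?A = "{I. I \<subseteq> nbrs T \<and> card I = k}"
  let ?S = "Sigma ?A (\<lambda>I. nbrs T)"
  let ?i = "\<lambda>(I, S). insert S I"
  let ?v = "\<lambda>I. p ^ card (K2 T \<union> shadow I)"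
  have sub: "{I. I \<subseteq> nbrs T \<and> card I = Suc k} \<subseteq> ?i ` ?S"
  proof
    fix I assume I: "I \<in> {I. I \<subseteq> nbrs T \<and> card I = Suc k}"
    then obtain S J where SJ: "I = insert S J" "S \<notin> J" "card J = k" by (auto simp: card_Suc_eq)
    then have "(J, S) \<in> ?S" using I by auto
    then have "?i (J, S) \<in> ?i ` ?S" by (rule imageI)
    then show "I \<in> ?i ` ?S" using SJ by (simp only: case_prod_conv)
  qed
  have fin: "finite ?S" by (intro finite_SigmaI) auto
  have "family_sum T (Suc k) \<le> (\<Sum>I\<in>?i ` ?S. ?v I)"
    unfolding family_sum_def using sub fin p0 by (intro sum_mono2) auto
  also have "\<dots> \<le> (\<Sum>z\<in>?S. ?v (?i z))"
    using sum_image_le[OF fin, of ?v ?i] p0 by (simp add: o_def)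
  also have "\<dots> = (\<Sum>(I, S)\<in>?S. ?v (insert S I))" by (intro sum.cong refl) auto
  also have "\<dots> = (\<Sum>I\<in>?A. \<Sum>S\<in>nbrs T. ?v (insert S I))"
    by (subst sum.Sigma) auto
  also have "\<dots> \<le> (\<Sum>I\<in>?A. 2 ^ (r * (k + 1)) * (\<beta> + 1) * ?v I)"
  proof (rule sum_mono)
    fix I assume I: "I \<in> ?A"
    then have IX: "I \<subseteq> X" "card I = k" by auto
    have finI: "finite I" using IX(1) finite_X by (rule finite_subset)
    let ?W = "K2 T \<union> shadow I"
    have "(\<Sum>S\<in>nbrs T. ?v (insert S I)) = ?v I * (\<Sum>S\<in>nbrs T. p ^ card (K2 S - ?W))"
      unfolding sum_distrib_left
    proof (rule sum.cong[OF refl])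
      fix S assume S: "S \<in> nbrs T"
      have "K2 T \<union> shadow (insert S I) = ?W \<union> K2 S" by (auto simp: shadow_def)
      moreover have "card (?W \<union> K2 S) = card ?W + card (K2 S - ?W)"
        using S T finite_subset[OF shadow_subset[OF IX(1)] finite_EE] by (intro card_Un_edges) auto
      ultimately show "?v (insert S I) = ?v I * p ^ card (K2 S - ?W)" by (simp only: power_add)
    qed
    also have "\<dots> \<le> ?v I * (2 ^ (r * (k + 1)) * (\<beta> + 1))"
    proof (intro mult_left_mono sum_extension)
      show "T \<union> \<Union>I \<subseteq> {..<n}" using T IX XD(3) by blast
      have "card (\<Union>I) \<le> (\<Sum>S\<in>I. card S)" using card_UN_le[OF finI, of "\<lambda>S. S"] by simp
      also have "\<dots> = (\<Sum>S\<in>I. r)" using IX(1) XD(2) by (intro sum.cong refl) auto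
      finally have "card (\<Union>I) \<le> k * r" by (simp add: IX(2))
      then show "card (T \<union> \<Union>I) \<le> r * (k + 1)"
        using card_Un_le[of T "\<Union>I"] XD(2)[OF T] by (simp add: algebra_simps)
      show "?W \<subseteq> K2 (T \<union> \<Union>I)" by (auto simp: shadow_def nsets_def)
      show "nbrs T \<subseteq> {Ta \<in> X. 2 \<le> card (Ta \<inter> (T \<union> \<Union>I))}"
      proof
        fix S assume S: "S \<in> nbrs T"
        have finS: "finite S" using S XD(1) by auto
        then have "2 \<le> card (S \<inter> T)" using S by (simp add: adj_iff)
        also have "\<dots> \<le> card (S \<inter> (T \<union> \<Union>I))" using finS by (intro card_mono) auto
        finally show "S \<in> {Ta \<in> X. 2 \<le> card (Ta \<inter> (T \<union> \<Union>I))}" using S by simp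
      qed
    qed (use p0 in auto)
    finally show "(\<Sum>S\<in>nbrs T. ?v (insert S I)) \<le> 2 ^ (r * (k + 1)) * (\<beta> + 1) * ?v I"
      by (simp only: mult_ac)
  qed
  also have "\<dots> = 2 ^ (r * (k + 1)) * (\<beta> + 1) * family_sum T k" unfolding family_sum_def sum_distrib_left ..
  finally show ?thesis .
qed

definition family_size :: nat where "family_size = (r choose 2) + 2"
text \<open>It bounds the cost of one further neighbour for every k up to
  \<open>family_size\<close>; the additional factor 2 bounds \<beta> + 1.\<close>

definition family_factor :: real where "family_factor = 2 ^ (r * (family_size + 1) + 1)"

lemma family_factor_ge_1: "1 \<le> family_factor" unfolding family_factor_def by (rule one_le_power) simp

lemma family_sum_le:
  assumes T: "T \<in> X" and b: "\<beta> \<le> 1" and "2 \<le> k" "k \<le> family_size"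
  shows "family_sum T k \<le> family_factor ^ k * (\<pi> * B3)"
  using assms(3,4)
proof (induction k rule: dec_induct)
  case base
  have "1 * (\<pi> * B3) \<le> family_factor ^ 2 * (\<pi> * B3)"
    using family_factor_ge_1 \<pi>_pos \<kappa>_nonneg by (intro mult_right_mono one_le_power) auto
  then show ?case using family_sum_2[OF T] by simp
next
  case (step k)
  have h0: "0 \<le> family_sum T k" unfolding family_sum_def using p0 by (intro sum_nonneg) auto
  have "2 ^ (r * (k + 1)) * (\<beta> + 1) \<le> 2 ^ (r * (family_size + 1)) * (2::real)"
    using step b \<beta>_nonneg by (intro mult_mono power_increasing) auto
  also have "\<dots> = family_factor" by (simp add: family_factor_def)
  finally have "family_sum T (Suc k) \<le> family_factor * family_sum T k"
    using family_sum_Suc[OF T, of k] h0 by (meson mult_right_mono order_trans)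
  also have "\<dots> \<le> family_factor * (family_factor ^ k * (\<pi> * B3))"
    using step family_factor_ge_1 by (intro mult_left_mono) auto
  finally show ?case by (simp add: mult.assoc)
qed

definition CH_const :: real where "CH_const = real family_size * family_factor ^ family_size"

text \<open>The edges of \<open>T\<close> in the shadow are covered by at most \<open>r choose 2\<close> members of \<open>H\<close>; two further
  neighbours ensure that the family spans a cluster of at least three cliques together with \<open>T\<close>.\<close>

lemma CH_le_families:
  "CH r n p (cl G) \<le> (\<Sum>T\<in>X. \<Sum>I\<in>{I. I \<subseteq> nbrs T \<and> card I \<in> {2..family_size}}.
      of_bool (I \<subseteq> cl G) * p ^ card (K2 T - shadow I))"
proof -
  let ?H = "cl G"
  let ?in = "\<lambda>T. \<Sum>I\<in>{I. I \<subseteq> nbrs T \<and> card I \<in> {2..family_size}}. of_bool (I \<subseteq> ?H) * p ^ card (K2 T - shadow I)"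
  have "p ^ card (K2 T - shadow ?H) \<le> ?in T"
    if T: "T \<in> X" "T \<notin> ?H" and two: "2 \<le> card {S \<in> ?H. adj S T}" for T
  proof -
    have "\<forall>d\<in>K2 T \<inter> shadow ?H. \<exists>S. S \<in> ?H \<and> d \<in> K2 S" by (auto simp: shadow_def)
    then obtain c where c: "\<And>d. d \<in> K2 T \<inter> shadow ?H \<Longrightarrow> c d \<in> ?H \<and> d \<in> K2 (c d)" by metis
    obtain Y where Y: "Y \<subseteq> {S \<in> ?H. adj S T}" "card Y = 2" "finite Y"
      using two by (meson obtain_subset_with_card_n)
    let ?c = "c ` (K2 T \<inter> shadow ?H)"
    let ?I = "?c \<union> Y"
    have finT: "finite (K2 T)" using T by simp
    have cadj: "?c \<subseteq> {S \<in> ?H. adj S T}"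
    proof
      fix S assume "S \<in> ?c"
      then obtain d where d: "d \<in> K2 T \<inter> shadow ?H" "S = c d" by blast
      then have "S \<in> ?H" "d \<in> K2 S" using c by auto
      then show "S \<in> {S \<in> ?H. adj S T}" using T(2) d(1) by (auto simp: adj_def)
    qed
    have IH: "?I \<subseteq> {S \<in> ?H. adj S T}" using cadj Y(1) by (rule Un_least)
    then have In: "?I \<subseteq> nbrs T" and IH2: "?I \<subseteq> ?H" using cl_subset by blast+
    have finI: "finite ?I" using finT Y(3) by blast
    have "card ?c \<le> card (K2 T \<inter> shadow ?H)" using finT by (intro card_image_le) auto
    also have "\<dots> \<le> card (K2 T)" using finT by (intro card_mono) auto
    also have "\<dots> = r choose 2" by (rule card_K2[OF T(1)])
    finally have "card ?I \<le> family_size" using card_Un_le[of ?c Y] Y(2) unfolding family_size_def by linarith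
    moreover have "2 \<le> card ?I" using card_mono[OF finI, of Y] Y(2) by simp
    ultimately have mem: "?I \<in> {I. I \<subseteq> nbrs T \<and> card I \<in> {2..family_size}}" using In by simp
    \<comment> \<open>The chosen family covers every edge of T that \<open>cl G\<close> covers, so
      no edge becomes newly uncovered when \<open>cl G\<close> is replaced by it.\<close>
    have "K2 T - shadow ?I \<subseteq> K2 T - shadow ?H"
    proof
      fix d assume d: "d \<in> K2 T - shadow ?I"
      have "d \<notin> shadow ?H"
      proof
        assume "d \<in> shadow ?H"
        then have dd: "d \<in> K2 T \<inter> shadow ?H" using d by blast
        then have "c d \<in> ?I" "d \<in> K2 (c d)" using c by auto
        then show False using d unfolding shadow_def by blast
      qed
      then show "d \<in> K2 T - shadow ?H" using d by blast
    qed
    then have "p ^ card (K2 T - shadow ?H) \<le> p ^ card (K2 T - shadow ?I)"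
      using finT by (intro power_le card_mono) auto
    also have "\<dots> = of_bool (?I \<subseteq> ?H) * p ^ card (K2 T - shadow ?I)" using IH2 by (simp only: of_bool_eq(2) mult_1_left)
    also have "\<dots> \<le> ?in T"
      using p0 by (intro member_le_sum[OF mem]) auto
    finally show ?thesis .
  qed
  then have "CH r n p ?H \<le> (\<Sum>T\<in>{T \<in> X. T \<notin> ?H \<and> 2 \<le> card {S \<in> ?H. adj S T}}. ?in T)"
    unfolding CH_def by (intro sum_mono) auto
  also have "\<dots> \<le> (\<Sum>T\<in>X. ?in T)"
    using p0 by (intro sum_mono2 sum_nonneg) auto
  finally show ?thesis .
qed

text \<open>The edges of T outside the shadow of a family are disjoint from the edges forced by the
  family, so weight and probability multiply to the joint probability. Families of size 2 give
  3-clusters, and by \<open>family_sum_le\<close> larger ones cost only constants.\<close>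

lemma expectation_CH:
  assumes b: "\<beta> \<le> 1"
  shows "bexp EE p (\<lambda>G. CH r n p (cl G)) \<le> CH_const * (\<mu> * B3)"
proof -
  let ?A = "\<lambda>T. {I. I \<subseteq> nbrs T \<and> card I \<in> {2..family_size}}"
  have "bexp EE p (\<lambda>G. CH r n p (cl G)) \<le> bexp EE p (\<lambda>G. \<Sum>T\<in>X. \<Sum>I\<in>?A T.
      of_bool (I \<subseteq> cl G) * p ^ card (K2 T - shadow I))"
    using p0 p_le_1 CH_le_families by (intro bexp_mono) auto
  also have "\<dots> = (\<Sum>T\<in>X. \<Sum>I\<in>?A T. p ^ card (K2 T - shadow I) * bexp EE p (\<lambda>G. of_bool (I \<subseteq> cl G)))"
    unfolding bexp_sum bexp_multc ..
  also have "\<dots> = (\<Sum>T\<in>X. \<Sum>I\<in>?A T. p ^ card (K2 T \<union> shadow I))"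
  proof (intro sum.cong refl)
    fix T I assume T: "T \<in> X" and I: "I \<in> ?A T"
    then have IX: "I \<subseteq> X" by auto
    have fs: "finite (shadow I)" using shadow_subset[OF IX] finite_EE by (rule finite_subset)
    have "card (shadow I \<union> K2 T) = card (shadow I) + card (K2 T - shadow I)"
      using T fs by (intro card_Un_edges) auto
    then show "p ^ card (K2 T - shadow I) * bexp EE p (\<lambda>G. of_bool (I \<subseteq> cl G)) = p ^ card (K2 T \<union> shadow I)"
      unfolding bexp_cl[OF IX] by (simp only: Un_commute power_add mult.commute)
  qed
  also have "\<dots> \<le> (\<Sum>T\<in>X. CH_const * (\<pi> * B3))"
  proof (rule sum_mono)
    fix T assume T: "T \<in> X"
    have "(\<Sum>I\<in>?A T. p ^ card (K2 T \<union> shadow I))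
      = (\<Sum>k\<in>{2..family_size}. \<Sum>I\<in>{I\<in>?A T. card I = k}. p ^ card (K2 T \<union> shadow I))"
      by (rule sum.group[symmetric]) auto
    also have "\<dots> = (\<Sum>k\<in>{2..family_size}. family_sum T k)"
      unfolding family_sum_def by (intro sum.cong refl arg_cong[where f=card]) auto
    also have "\<dots> \<le> (\<Sum>k\<in>{2..family_size}. family_factor ^ family_size * (\<pi> * B3))"
    proof (rule sum_mono)
      fix k assume k: "k \<in> {2..family_size}"
      then have "family_sum T k \<le> family_factor ^ k * (\<pi> * B3)" using family_sum_le[OF T b] by simp
      also have "\<dots> \<le> family_factor ^ family_size * (\<pi> * B3)"
        using k family_factor_ge_1 \<pi>_pos \<kappa>_nonneg by (intro mult_right_mono power_increasing) auto
      finally show "family_sum T k \<le> family_factor ^ family_size * (\<pi> * B3)" .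
    qed
    also have "\<dots> = real (card {2..family_size}) * (family_factor ^ family_size * (\<pi> * B3))" by simp
    also have "\<dots> \<le> real family_size * (family_factor ^ family_size * (\<pi> * B3))"
      using family_factor_ge_1 \<pi>_pos \<kappa>_nonneg by (intro mult_right_mono) auto
    finally show "(\<Sum>I\<in>?A T. p ^ card (K2 T \<union> shadow I)) \<le> CH_const * (\<pi> * B3)"
      by (simp only: CH_const_def mult.assoc)
  qed
  also have "\<dots> = CH_const * (\<mu> * B3)" by (simp add: \<mu>_def mult_ac)
  finally show ?thesis .
qed

section \<open>Concentration of the number of cliques and goodness with high probability\<close>

lemma expectation_card: "bexp EE p (\<lambda>G. real (card (cl G))) = \<mu>"
proof -
  have "real (card (cl G)) = (\<Sum>S\<in>X. of_bool ({S} \<subseteq> cl G))" for G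
  proof -
    have "X \<inter> cl G = cl G" using cl_subset by blast
    then show ?thesis by (simp add: of_bool_def sum.If_cases Int_def conj_commute)
  qed
  then have "bexp EE p (\<lambda>G. real (card (cl G))) = (\<Sum>S\<in>X. bexp EE p (\<lambda>G. of_bool ({S} \<subseteq> cl G)))"
    by (simp only: bexp_sum)
  also have "\<dots> = (\<Sum>S\<in>X. \<pi>)"
    by (intro sum.cong refl, subst bexp_cl) (auto simp: shadow_def XD \<pi>_def)
  finally show ?thesis by (simp add: \<mu>_def)
qed

text \<open>Distinct non-adjacent cliques are independent, so beyond the square of the mean only the
  diagonal and the adjacent ordered pairs contribute.\<close>

lemma variance_card: "bexp EE p (\<lambda>G. (real (card (cl G)) - \<mu>)\<^sup>2) \<le> \<mu> + 2 * Delta2 r n p"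
proof -
  have sq: "(real (card (cl G)))\<^sup>2 = (\<Sum>S\<in>X. \<Sum>T\<in>X. of_bool (S \<in> cl G \<and> T \<in> cl G))" for G
  proof -
    have "X \<inter> cl G = cl G" using cl_subset by blast
    then have "real (card (cl G)) = (\<Sum>S\<in>X. of_bool (S \<in> cl G))"
      by (simp add: of_bool_def sum.If_cases Int_def conj_commute)
    then show ?thesis by (simp only: power2_eq_square sum_product of_bool_conj)
  qed
  have "bexp EE p (\<lambda>G. (real (card (cl G)))\<^sup>2) = (\<Sum>S\<in>X. \<Sum>T\<in>X. joint S T)"
    unfolding sq bexp_sum by (intro sum.cong refl bexp_cl2)
  also have "\<dots> \<le> (\<Sum>S\<in>X. \<pi> + (\<Sum>T\<in>nbrs S. joint S T) + real (n choose r) * (\<pi> * \<pi>))"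
  proof (rule sum_mono)
    fix S assume S: "S \<in> X"
    have "(\<Sum>T\<in>X. joint S T)
       \<le> (\<Sum>T\<in>X. (if T = S then \<pi> else 0) + (if adj T S then joint S T else 0) + \<pi> * \<pi>)"
    proof (rule sum_mono)
      fix T assume T: "T \<in> X"
      show "joint S T \<le> (if T = S then \<pi> else 0) + (if adj T S then joint S T else 0) + \<pi> * \<pi>"
      proof (cases "T = S \<or> adj T S")
        case True
        then show ?thesis
          using S \<pi>_pos p0 by (auto simp: XD \<pi>_def)
      next
        case False
        then have "K2 S \<inter> K2 T = {}" by (auto simp: adj_def)
        then have "K2 T - K2 S = K2 T" by blast
        then show ?thesis using False S T by (simp add: power_card_Un XD \<pi>_def)
      qed
    qed
    also have "\<dots> = \<pi> + (\<Sum>T\<in>nbrs S. joint S T) + real (n choose r) * (\<pi> * \<pi>)"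
      using S by (simp add: sum.distrib sum.inter_filter)
    finally show "(\<Sum>T\<in>X. joint S T) \<le> \<pi> + (\<Sum>T\<in>nbrs S. joint S T) + real (n choose r) * (\<pi> * \<pi>)" .
  qed
  also have "\<dots> = \<mu> + 2 * Delta2 r n p + \<mu>\<^sup>2"
    by (simp add: sum.distrib Delta2_eq \<mu>_def power2_eq_square)
  finally have 1: "bexp EE p (\<lambda>G. (real (card (cl G)))\<^sup>2) \<le> \<mu> + 2 * Delta2 r n p + \<mu>\<^sup>2" .
  have "(real (card (cl G)) - \<mu>)\<^sup>2 = (real (card (cl G)))\<^sup>2 - 2 * \<mu> * real (card (cl G)) + \<mu>\<^sup>2" for G
    by (simp add: power2_diff)
  then have "bexp EE p (\<lambda>G. (real (card (cl G)) - \<mu>)\<^sup>2)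
    = bexp EE p (\<lambda>G. (real (card (cl G)))\<^sup>2) - 2 * \<mu> * \<mu> + \<mu>\<^sup>2"
    by (simp add: bexp_add bexp_diff bexp_cmult expectation_card)
  then show ?thesis using 1 by (simp add: power2_eq_square)
qed

text \<open>Each of the five quantitative conditions fails with probability at most 1 / w by
  Markov's inequality; for the number of hyperedges it is applied to the squared deviation.\<close>

lemma prob_good_ge:
  assumes w: "2 \<le> w" and b: "B2 \<le> 1"
  shows "1 - 5 / w \<le> measure_pmf.prob (gnp n p) {G. good r n p w (cl G)}"
proof -
  define b where "b f G = (of_bool (\<not> f G \<le> w * bexp EE p f) :: real)" for f G
  have b_markov: "bexp EE p (b f) \<le> 1 / w" if "\<And>G. 0 \<le> f G" for f
    unfolding b_def[abs_def] using p0 p_half w that by (intro bexp_markov) auto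
  have b_nonneg: "0 \<le> b f G" for f G by (simp add: b_def)
  have b_1: "b f G = 1" if "\<not> f G \<le> w * bexp EE p f" for f G using that by (simp add: b_def)
  define V where "V G = (real (card (cl G)) - \<mu>)\<^sup>2" for G
  have V: "bexp EE p V \<le> 2 * \<mu>"
  proof -
    have "2 * Delta2 r n p \<le> \<mu> * B2" using Delta2_le by simp
    also have "\<dots> \<le> \<mu> * 1" using b \<mu>_nonneg by (intro mult_left_mono)
    finally show ?thesis using variance_card unfolding V_def[abs_def] by linarith
  qed
  have dev: "\<bar>real (card (cl G)) - mu r n p\<bar> \<le> w * sqrt (mu r n p)" if "V G \<le> w * bexp EE p V" for G
  proof -
    have "V G \<le> w * (2 * \<mu>)" using that mult_left_mono[OF V, of w] w by linarith
    \<comment> \<open>The mean of V is at most 2 * \<mu>, and w >= 2 absorbs this 2 to give the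
      required deviation w * sqrt \<mu>.\<close>
    also have "\<dots> \<le> w * (w * \<mu>)" using w \<mu>_nonneg by (intro mult_left_mono mult_right_mono) auto
    also have "\<dots> = (w * sqrt \<mu>)\<^sup>2" using \<mu>_nonneg by (simp add: power_mult_distrib power2_eq_square)
    finally have "\<bar>real (card (cl G)) - \<mu>\<bar> \<le> \<bar>w * sqrt \<mu>\<bar>" unfolding V_def by (simp only: abs_le_square_iff)
    then show ?thesis using w \<mu>_nonneg by (simp add: mu_eq abs_mult)
  qed
  let ?Q2 = "\<lambda>G. Q2 r n (cl G)" and ?Q3 = "\<lambda>G. Q3 r n p (cl G)" and ?Q4 = "\<lambda>G. Q4 r n p (cl G)"
    and ?C = "\<lambda>G. CH r n p (cl G)"
  have "bexp EE p (\<lambda>G. 1 - (b V G + b ?Q2 G + b ?Q3 G + b ?Q4 G + b ?C G))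
     \<le> bexp EE p (\<lambda>G. of_bool (good r n p w (cl G)))"
  proof (rule bexp_mono)
    fix G assume G: "G \<subseteq> EE"
    have nn: "0 \<le> b V G" "0 \<le> b ?Q2 G" "0 \<le> b ?Q3 G" "0 \<le> b ?Q4 G" "0 \<le> b ?C G" by (rule b_nonneg)+
    show "1 - (b V G + b ?Q2 G + b ?Q3 G + b ?Q4 G + b ?C G) \<le> (of_bool (good r n p w (cl G)) :: real)"
    proof (cases "good r n p w (cl G)")
      case True
      then show ?thesis using nn by simp
    next
      case False
      then have "\<not> V G \<le> w * bexp EE p V \<or> \<not> ?Q2 G \<le> w * bexp EE p ?Q2 \<or> \<not> ?Q3 G \<le> w * bexp EE p ?Q3
        \<or> \<not> ?Q4 G \<le> w * bexp EE p ?Q4 \<or> \<not> ?C G \<le> w * bexp EE p ?C"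
        unfolding good_def gnp_expectation using dev G by blast
      then have "b V G = 1 \<or> b ?Q2 G = 1 \<or> b ?Q3 G = 1 \<or> b ?Q4 G = 1 \<or> b ?C G = 1"
        using b_1[of V G] b_1[of ?Q2 G] b_1[of ?Q3 G] b_1[of ?Q4 G] b_1[of ?C G] by blast
      then have "1 - (b V G + b ?Q2 G + b ?Q3 G + b ?Q4 G + b ?C G) \<le> 0" using nn by linarith
      then show ?thesis using False by simp
    qed
  qed (use p0 p_le_1 in auto)
  moreover have "bexp EE p (b V) \<le> 1 / w" "bexp EE p (b ?Q2) \<le> 1 / w" "bexp EE p (b ?Q3) \<le> 1 / w"
    "bexp EE p (b ?Q4) \<le> 1 / w" "bexp EE p (b ?C) \<le> 1 / w"
    using p0 by (auto intro!: b_markov sum_nonneg simp: V_def Q2_def Q3_eq Q4_eq CH_def)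
  ultimately show ?thesis
    unfolding gnp_prob bexp_diff bexp_add bexp_const[OF finite_EE] mem_Collect_eq by simp
qed

text \<open>Goodness bounds each statistic by w times its expectation, and these expectations are of
  order \<mu> * \<open>B3\<close>, except for \<open>Q2\<close>, which is of order \<mu> *
  \<open>B2\<close> but enters with the factor \<delta>. The condition on w^2 keeps the deviation of
  the number of hyperedges below \<mu>.\<close>

lemma prob_of_good:
  assumes g: "good r n p w H" and w: "1 \<le> w" "w\<^sup>2 \<le> \<mu>" and "r \<le> n" and b: "\<beta> \<le> 1"
  shows "\<exists>\<epsilon>. \<bar>\<epsilon>\<bar> \<le> (4 * CH_const + 4 * 2 ^ (3 * r) + 12) * 2 ^ (3 * r)
      * (w * (\<mu> * \<kappa> + p ^ (r - 1) * (\<mu> * \<beta>) + sqrt \<mu> * \<beta>)) \<and>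
    measure_pmf.prob (gnp n p) {G. cl G = H} =
      \<pi> ^ card H * (1 - \<pi>) ^ ((n choose r) - card H) * p powi (- tH r H) *
      exp (- Delta2 r n p + Delta2_0 r n p + \<epsilon>)"
proof -
  interpret clique_config r n p H
    using g by unfold_locales (auto simp: good_def)
  define M3 where "M3 = \<mu> * B3"
  have M3: "0 \<le> M3" using \<mu>_nonneg B_nonneg by (simp add: M3_def)
  have M2: "0 \<le> \<mu> * B2" using \<mu>_nonneg B_nonneg by simp
  have g1: "\<bar>e - \<mu>\<bar> \<le> w * sqrt \<mu>" using g by (simp add: good_def mu_eq)
  have g2: "w * sqrt \<mu> \<le> \<mu>"
  proof -
    have "w \<le> sqrt \<mu>" using w by (intro real_le_rsqrt)
    then have "w * sqrt \<mu> \<le> sqrt \<mu> * sqrt \<mu>" using \<mu>_nonneg by (intro mult_right_mono) auto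
    then show ?thesis using \<mu>_nonneg by simp
  qed
  have Q2: "Q2 r n H \<le> w * (\<mu> * B2 / 2)"
    using g mult_left_mono[OF Delta2_le, of w] w unfolding good_def gnp_expectation expectation_Q2 by linarith
  have Q3: "Q3 r n p H \<le> w * (2 * M3)"
    using g mult_left_mono[OF expectation_Q3, of w] w unfolding good_def gnp_expectation M3_def by linarith
  have Q4: "Q4 r n p H \<le> w * (2 ^ (3 * r) * (\<beta> + 1) * M3)"
    using g mult_left_mono[OF expectation_Q4, of w] w unfolding good_def gnp_expectation M3_def by linarith
  have "2 ^ (3 * r) * (\<beta> + 1) * M3 \<le> 2 ^ (3 * r) * 2 * M3"
    using b M3 by (intro mult_right_mono mult_left_mono) auto
  then have Q4': "Q4 r n p H \<le> w * (2 ^ (3 * r) * 2 * M3)"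
    using Q4 w mult_left_mono[of _ _ w] by (meson order_trans zero_le_one)
  have C: "CH r n p H \<le> w * (CH_const * M3)"
    using g mult_left_mono[OF expectation_CH[OF b], of w] w unfolding good_def gnp_expectation M3_def by linarith
  have dQ2: "2 * \<delta> * Q2 r n H \<le> w * (\<delta> * (\<mu> * B2))"
    using mult_left_mono[OF Q2, of "2 * \<delta>"] \<delta>(1) by (simp add: mult_ac)
  have M3w: "M3 \<le> w * M3" using w M3 mult_right_mono[of 1 w M3] by simp
  have d0: "0 \<le> \<delta> * (\<mu> * B2)" using \<delta>(1) M2 by simp
  have dw: "\<delta> * (\<mu> * B2) \<le> w * (\<delta> * (\<mu> * B2))"
    using mult_right_mono[OF w(1) d0] by simp
  have tot: "4 * CH r n p H + 2 * Q4 r n p H + Q3 r n p H + 2 * \<delta> * Q2 r n H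
      + 8 * (\<mu> * B3) + 11 * \<delta> * (\<mu> * B2) + w * sqrt \<mu> * B2
    \<le> (4 * CH_const + 4 * 2 ^ (3 * r) + 12) * 2 ^ (3 * r)
      * (w * (\<mu> * \<kappa> + p ^ (r - 1) * (\<mu> * \<beta>) + sqrt \<mu> * \<beta>))" (is "?lhs \<le> ?rhs")
  proof -
    have "?lhs \<le> 4 * (w * (CH_const * M3)) + 2 * (w * (2 ^ (3 * r) * 2 * M3)) + w * (2 * M3)
        + 8 * (w * M3) + 12 * (w * (\<delta> * (\<mu> * B2))) + w * sqrt \<mu> * B2"
      using C Q4' Q3 dQ2 M3w dw unfolding M3_def[symmetric] by (simp only: mult.assoc)
    also have "\<dots> = w * ((4 * CH_const + 4 * 2 ^ (3 * r) + 10) * M3 + 12 * (\<delta> * (\<mu> * B2)) + 1 * (sqrt \<mu> * B2))"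
      by (simp add: algebra_simps)
    also have "\<dots> \<le> w * ((4 * CH_const + 4 * 2 ^ (3 * r) + 12) * M3 + (4 * CH_const + 4 * 2 ^ (3 * r) + 12) * (\<delta> * (\<mu> * (2 ^ (3 * r) * \<beta>)))
        + (4 * CH_const + 4 * 2 ^ (3 * r) + 12) * (sqrt \<mu> * (2 ^ (3 * r) * \<beta>)))"
    proof -
      have ec0: "0 \<le> CH_const" using family_factor_ge_1 by (simp add: CH_const_def)
      have "(2::real) ^ r \<le> 2 ^ (3 * r)" by (intro power_increasing) auto
      then have B2le: "B2 \<le> 2 ^ (3 * r) * \<beta>" using \<beta>_nonneg by (intro mult_right_mono) auto
      show ?thesis
        using w ec0 M3 \<delta>(1) B2le \<mu>_nonneg B_nonneg \<beta>_nonneg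
        by (intro mult_left_mono add_mono mult_right_mono mult_mono) (auto intro!: mult_nonneg_nonneg add_nonneg_nonneg)
    qed
    also have "\<dots> = ?rhs" unfolding M3_def \<delta>_def by (simp add: algebra_simps)
    finally show ?thesis .
  qed
  from prob_clique_hypergraph_exp[OF g1 g2 assms(4)] tot show ?thesis
    by (meson order_trans)
qed

end

section \<open>Asymptotic size of the error terms\<close>

text \<open>Chosen so that (3 r^2 + 4) \<open>gam r\<close> <= 1/r: a gain of n powr (-1/r) must
  outweigh the shift by \<open>gam r\<close> in each of up to 3 r^2 edges and still leave n powr (-4
  \<open>gam r\<close>).\<close>

definition gam :: "nat \<Rightarrow> real" where "gam r = 1 / (5 * real r ^ 3)"

context clique_setting
begin

section \<open>Negligible monomials in n and p\<close>

definition ext :: "nat \<Rightarrow> real" where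
  "ext s = real n ^ (r - s) * p ^ (exc s)"

lemma \<beta>_eq: "\<beta> = (\<Sum>s\<in>{2..<r}. ext s)" by (simp add: \<beta>_def ext_def)

lemma \<kappa>_eq: "\<kappa> = \<beta> * \<beta> + (\<Sum>s\<in>{2..<r}. ext s * p ^ max 1 (r - s - 1))"
  by (simp add: \<kappa>_def ext_def[symmetric] distrib_left sum.distrib sum_distrib_right[symmetric] \<beta>_eq)

lemma ext_nonneg: "0 \<le> ext s" using p0 by (simp add: ext_def)

lemma \<mu>_le: "\<mu> \<le> real n ^ r * p ^ (r choose 2)"
proof -
  have "(n choose r) \<le> n ^ r" by (rule binomial_le_power_nat) simp
  then have "real (n choose r) \<le> real n ^ r" by (metis of_nat_le_iff of_nat_power)
  then show ?thesis unfolding \<mu>_def \<pi>_def using p0 by (intro mult_right_mono) auto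
qed

lemma gam: "0 < gam r" "(3 * real r ^ 2 + 4) * gam r \<le> 1 / real r"
proof -
  show "0 < gam r" using r3 by (simp add: gam_def)
  have "(3::real)\<^sup>2 \<le> real r ^ 2" using r3 by (intro power_mono) auto
  then have "(3 * real r ^ 2 + 4) * gam r \<le> (5 * real r ^ 2) * gam r"
    using \<open>0 < gam r\<close> by (intro mult_right_mono) auto
  also have "\<dots> = 1 / real r" using r3 by (simp add: gam_def power2_eq_square power3_eq_cube)
  finally show "(3 * real r ^ 2 + 4) * gam r \<le> 1 / real r" .
qed

text \<open>The hypothesis r v + 1 <= 2 d says that at p = n powr (-2/r) the exponent is at most
  -1/r. All the negligible terms below are reduced to this integer inequality.\<close>

lemma negligible:
  assumes n: "1 \<le> n" and p: "p \<le> real n powr (- 2 / real r + gam r)"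
    and e: "d \<le> 3 * r\<^sup>2" and v: "r * v + 1 \<le> 2 * d"
  shows "real n ^ v * p ^ d \<le> real n powr (- 4 * gam r)"
proof -
  have n0: "0 < real n" using n by simp
  have "p ^ d \<le> (real n powr (- 2 / real r + gam r)) ^ d" using p p0 by (intro power_mono) auto
  also have "\<dots> = real n powr ((- 2 / real r + gam r) * real d)"
    using n0 by (simp add: powr_powr[symmetric] powr_realpow)
  finally have "real n ^ v * p ^ d \<le> real n powr real v * real n powr ((- 2 / real r + gam r) * real d)"
    using n0 by (simp add: powr_realpow mult_left_mono)
  also have "\<dots> = real n powr (real v + (- 2 / real r + gam r) * real d)" by (simp add: powr_add)
  also have "\<dots> \<le> real n powr (- 4 * gam r)"
  proof (rule powr_mono)
    have "real (r * v + 1) \<le> real (2 * d)" using v by (simp only: of_nat_le_iff)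
    then have "real r * real v + 1 \<le> 2 * real d" by simp
    then have 1: "real v + 1 / real r \<le> 2 / real r * real d"
      using divide_right_mono[of "real r * real v + 1" "2 * real d" "real r"] r3 by (simp add: add_divide_distrib)
    have "real d \<le> real (3 * r\<^sup>2)" using e by (simp only: of_nat_le_iff)
    then have "gam r * real d \<le> gam r * (3 * real r ^ 2)" using gam(1) by (intro mult_left_mono) auto
    then show "real v + (- 2 / real r + gam r) * real d \<le> - 4 * gam r"
      using 1 gam(2) by (simp add: algebra_simps)
  qed (use n in simp)
  finally show ?thesis .
qed

text \<open>The product is smallest at the two ends s = 2 and s = r - 1, where equality
  holds.\<close>

lemma excess_ge: "2 \<le> s \<Longrightarrow> s < r \<Longrightarrow> r \<le> (s - 1) * (r - s) + 2"
proof -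
  assume s: "2 \<le> s" "s < r"
  then have "(s - 1) + (r - s) \<le> (s - 1) * (r - s) + 1" by (intro prod_ge_sum_nat) auto
  then show ?thesis using s by linarith
qed

lemma choose_le_sq: "2 * (r choose 2) \<le> r\<^sup>2"
  using two_choose_two[of r] by (simp add: power2_eq_square)

context
  assumes n1: "1 \<le> n" and p_le: "p \<le> real n powr (- 2 / real r + gam r)"
begin

text \<open>The rate between the two others: taking a square root halves the exponent -4
  \<open>gam r\<close> of \<open>negligible\<close>, and the later factor w <= n powr
  \<open>gam r\<close> leaves n powr (- \<open>gam r\<close>).\<close>

abbreviation eta :: real where "eta \<equiv> real n powr (- 2 * gam r)"

lemma powr_le_eta: "real n powr (- 4 * gam r) \<le> eta"
  using n1 gam(1) by (intro powr_mono) auto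

lemma ext_le: "s \<in> {2..<r} \<Longrightarrow> ext s \<le> real n powr (- 4 * gam r)"
  unfolding ext_def
proof (rule negligible[OF n1 p_le])
  assume s: "s \<in> {2..<r}"
  show "exc s \<le> 3 * r\<^sup>2" using choose_le_sq diff_le_self[of "r choose 2" "s choose 2"] by linarith
  have "1 \<le> (s - 1) * (r - s)" using s by (simp add: Suc_le_eq)
  then show "r * (r - s) + 1 \<le> 2 * exc s"
    using s two_choose_two_diff[of s r] by simp
qed

lemma \<beta>_le: "\<beta> \<le> real r * real n powr (- 4 * gam r)"
proof -
  have "\<beta> \<le> (\<Sum>s\<in>{2..<r}. real n powr (- 4 * gam r))" unfolding \<beta>_eq by (intro sum_mono ext_le)
  also have "\<dots> = real (r - 2) * real n powr (- 4 * gam r)" by simp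
  also have "\<dots> \<le> real r * real n powr (- 4 * gam r)" by (intro mult_right_mono) auto
  finally show ?thesis .
qed

lemma \<mu>_ext_\<delta>_le:
  assumes s: "s \<in> {2..<r}"
  shows "p ^ (r - 1) * (\<mu> * ext s) \<le> eta"
proof -
  have "p ^ (r - 1) * (\<mu> * ext s) \<le> p ^ (r - 1) * ((real n ^ r * p ^ (r choose 2)) * ext s)"
    using p0 ext_nonneg \<mu>_le by (intro mult_left_mono mult_right_mono) auto
  also have "\<dots> = real n ^ (r + (r - s)) * p ^ ((r - 1) + (r choose 2) + exc s)"
    by (simp add: ext_def power_add)
  also have "\<dots> \<le> real n powr (- 4 * gam r)"
  proof (rule negligible[OF n1 p_le])
    have "r \<le> r\<^sup>2" using r3 by (simp add: power2_eq_square)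
    then show "(r - 1) + (r choose 2) + exc s \<le> 3 * r\<^sup>2"
      using choose_le_sq diff_le_self[of "r choose 2" "s choose 2"] by linarith
    have "2 * exc s = r * (r - s) + (s - 1) * (r - s)"
      using s by (intro two_choose_two_diff) auto
    moreover have "r \<le> (s - 1) * (r - s) + 2" by (rule excess_ge; use s in simp)
    ultimately show "r * (r + (r - s)) + 1 \<le> 2 * ((r - 1) + (r choose 2) + exc s)"
      using two_choose_two[of r] r3 unfolding distrib_left by linarith
  qed
  finally show ?thesis using powr_le_eta by linarith
qed

lemma \<delta>\<mu>\<beta>_le: "p ^ (r - 1) * (\<mu> * \<beta>) \<le> real r * eta"
proof -
  have "p ^ (r - 1) * (\<mu> * \<beta>) = (\<Sum>s\<in>{2..<r}. p ^ (r - 1) * (\<mu> * ext s))"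
    by (simp add: \<beta>_eq sum_distrib_left)
  also have "\<dots> \<le> (\<Sum>s\<in>{2..<r}. eta)" by (intro sum_mono \<mu>_ext_\<delta>_le)
  also have "\<dots> = real (r - 2) * eta" by simp
  also have "\<dots> \<le> real r * eta" by (intro mult_right_mono) auto
  finally show ?thesis .
qed

text \<open>The two excesses contribute at least 2 (r - 2), against a deficit of r from the edges of
  the first clique. The balance r - 4 is positive exactly when r >= 5, which is why smaller r have
  extra terms in \<xi>.\<close>

lemma \<mu>_ext_cs_le:
  assumes r5: "5 \<le> r" and s: "s \<in> {2..<r}" and t: "t \<in> {2..<r}"
  shows "\<mu> * (ext s * ext t) \<le> real n powr (- 4 * gam r)"
proof -
  have "\<mu> * (ext s * ext t) \<le> (real n ^ r * p ^ (r choose 2)) * (ext s * ext t)"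
    using ext_nonneg \<mu>_le by (intro mult_right_mono) auto
  also have "\<dots> = real n ^ (r + (r - s) + (r - t))
      * p ^ ((r choose 2) + exc s + exc t)"
    by (simp add: ext_def power_add)
  also have "\<dots> \<le> real n powr (- 4 * gam r)"
  proof (rule negligible[OF n1 p_le])
    show "(r choose 2) + exc s + exc t \<le> 3 * r\<^sup>2"
      using choose_le_sq diff_le_self[of "r choose 2" "s choose 2"] diff_le_self[of "r choose 2" "t choose 2"] by linarith
    have "2 * exc s = r * (r - s) + (s - 1) * (r - s)"
      by (rule two_choose_two_diff) (use s in auto)
    moreover have "2 * exc t = r * (r - t) + (t - 1) * (r - t)"
      by (rule two_choose_two_diff) (use t in auto)
    moreover have "r \<le> (s - 1) * (r - s) + 2" "r \<le> (t - 1) * (r - t) + 2"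
      by (rule excess_ge; use s t in simp)+
    ultimately show "r * (r + (r - s) + (r - t)) + 1
        \<le> 2 * ((r choose 2) + exc s + exc t)"
      using two_choose_two[of r] r5 unfolding distrib_left by linarith
  qed
  finally show ?thesis .
qed

lemma \<mu>_ext_new_le:
  assumes r5: "5 \<le> r" and s: "s \<in> {2..<r}" "s \<noteq> r - 1"
  shows "\<mu> * (ext s * p ^ max 1 (r - s - 1)) \<le> eta"
proof -
  have m: "max 1 (r - s - 1) = r - s - 1" using s by auto
  have "\<mu> * (ext s * p ^ max 1 (r - s - 1)) \<le> (real n ^ r * p ^ (r choose 2)) * (ext s * p ^ (r - s - 1))"
    unfolding m using ext_nonneg p0 \<mu>_le by (intro mult_right_mono) auto
  also have "\<dots> = real n ^ (r + (r - s)) * p ^ ((r choose 2) + exc s + (r - s - 1))"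
    by (simp add: ext_def power_add)
  also have "\<dots> \<le> real n powr (- 4 * gam r)"
  proof (rule negligible[OF n1 p_le])
    have "r \<le> r\<^sup>2" using r3 by (simp add: power2_eq_square)
    then show "(r choose 2) + exc s + (r - s - 1) \<le> 3 * r\<^sup>2"
      using choose_le_sq diff_le_self[of "r choose 2" "s choose 2"] by linarith
    have "r + 1 \<le> (s - 1) * (r - s) + 2 * (r - s - 1)"
    proof -
      obtain x where x: "s = x + 2" using s by (metis add.commute atLeastLessThan_iff le_Suc_ex)
      have "2 \<le> r - s" using s by auto
      then obtain y where y: "r - s = y + 2" by (metis add.commute le_Suc_ex)
      have r: "r = x + y + 4" using x y s by auto
      \<comment> \<open>With x = s - 2 and y = r - s - 2 the required inequality becomes x y + x + 2
        y >= 1, which fails only for x = y = 0, that is, for r = 4.\<close>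
      have "1 \<le> x + y" using r r5 by simp
      then have "1 \<le> x * y + x + 2 * y" by simp
      then show ?thesis unfolding y using x r by (simp add: algebra_simps)
    qed
    moreover have "2 * exc s = r * (r - s) + (s - 1) * (r - s)"
      using s by (intro two_choose_two_diff) auto
    ultimately show "r * (r + (r - s)) + 1 \<le> 2 * ((r choose 2) + exc s + (r - s - 1))"
      using two_choose_two[of r] unfolding distrib_left by linarith
  qed
  finally show ?thesis using powr_le_eta by linarith
qed

text \<open>Two cliques with r - 1 common vertices lack a single edge of K_(r+1), and a third clique
  inside their union supplies it. The constant comes from bounding n choose (r + 1) below by (n / (r
  + 1)) ^ (r + 1).\<close>

lemma \<mu>_ext_last_le:
  assumes "r < n"
  shows "\<mu> * (ext (r - 1) * p) \<le> real (r + 1) ^ (r + 1) * mu (r + 1) n p"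
proof -
  have ed: "(r choose 2) - ((r - 1) choose 2) = r - 1"
  proof -
    obtain m where m: "r = Suc m" using r3 by (cases r) auto
    show ?thesis by (simp add: m numeral_2_eq_2)
  qed
  have e: "(r choose 2) + (r - 1) + 1 = (r + 1) choose 2"
    using r3 by (simp add: numeral_2_eq_2)
  have "\<mu> * (ext (r - 1) * p) \<le> (real n ^ r * p ^ (r choose 2)) * (ext (r - 1) * p)"
    using ext_nonneg p0 \<mu>_le by (intro mult_right_mono) auto
  also have "\<dots> = real n ^ (r + 1) * p ^ ((r choose 2) + (r - 1) + 1)"
    unfolding ext_def ed using r3 power_minus_mult[of r p] by (simp add: power_add mult.assoc)
  also have "\<dots> = real (r + 1) ^ (r + 1) * ((real n / real (r + 1)) ^ (r + 1) * p ^ ((r + 1) choose 2))"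
    unfolding e by (simp add: power_divide)
  also have "\<dots> \<le> real (r + 1) ^ (r + 1) * (real (n choose (r + 1)) * p ^ ((r + 1) choose 2))"
    using assms p0 by (intro mult_left_mono mult_right_mono binomial_ge_n_over_k_pow_k) auto
  finally show ?thesis by (simp only: mu_def)
qed

text \<open>The square of the left side is the product bounded in \<open>\<mu>_ext_cs_le\<close>
  with s = t.\<close>

lemma sqrt_\<mu>_ext_le:
  assumes r5: "5 \<le> r" and s: "s \<in> {2..<r}"
  shows "sqrt \<mu> * ext s \<le> eta"
proof -
  have "(sqrt \<mu> * ext s)\<^sup>2 = \<mu> * (ext s * ext s)" using \<mu>_nonneg by (simp add: power_mult_distrib power2_eq_square)
  also have "\<dots> \<le> real n powr (- 4 * gam r)" by (rule \<mu>_ext_cs_le[OF r5 s s])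
  also have "\<dots> = eta\<^sup>2" by (simp add: power2_eq_square powr_add[symmetric])
  finally show ?thesis by (rule power2_le_imp_le) simp
qed

lemma error_le_5:
  assumes r5: "5 \<le> r" and "r < n"
  shows "\<mu> * \<kappa> + p ^ (r - 1) * (\<mu> * \<beta>) + sqrt \<mu> * \<beta>
    \<le> (real (r + 1) ^ (r + 1) + 4 * real r ^ 2) * (xi r n p + eta)"
proof -
  have xi: "xi r n p = mu (r + 1) n p" using r5 by (simp add: xi_def)
  have mu0: "0 \<le> mu (r + 1) n p" using p0 by (simp add: mu_def)
  have eta0: "0 \<le> eta" by simp
  have bb: "\<mu> * (\<beta> * \<beta>) \<le> real r ^ 2 * eta"
  proof -
    have "\<mu> * (\<beta> * \<beta>) = (\<Sum>s\<in>{2..<r}. \<Sum>t\<in>{2..<r}. \<mu> * (ext s * ext t))"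
      unfolding \<beta>_eq sum_product by (simp add: sum_distrib_left)
    also have "\<dots> \<le> (\<Sum>s\<in>{2..<r}. \<Sum>t\<in>{2..<r}. eta)"
      using \<mu>_ext_cs_le[OF r5] powr_le_eta by (intro sum_mono) (meson order_trans)
    also have "\<dots> = (real (r - 2) * real (r - 2)) * eta"
      by (simp only: sum_constant card_atLeastLessThan mult.assoc)
    also have "\<dots> \<le> (real r * real r) * eta" by (intro mult_right_mono mult_mono) auto
    finally show ?thesis by (simp add: power2_eq_square)
  qed
  have nn: "\<mu> * (\<Sum>s\<in>{2..<r}. ext s * p ^ max 1 (r - s - 1)) \<le> real (r + 1) ^ (r + 1) * mu (r + 1) n p + real r * eta"
  proof -
    \<comment> \<open>The overlap r - 1 is split off because it alone yields K_(r+1); all other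
      overlaps are negligible.\<close>
    have "{2..<r} = insert (r - 1) {2..<r - 1}" using r5 by auto
    then have "\<mu> * (\<Sum>s\<in>{2..<r}. ext s * p ^ max 1 (r - s - 1))
       = \<mu> * (ext (r - 1) * p) + (\<Sum>s\<in>{2..<r - 1}. \<mu> * (ext s * p ^ max 1 (r - s - 1)))"
      using r5 by (simp add: distrib_left sum_distrib_left)
    also have "(\<Sum>s\<in>{2..<r - 1}. \<mu> * (ext s * p ^ max 1 (r - s - 1))) \<le> (\<Sum>s\<in>{2..<r - 1}. eta)"
      by (intro sum_mono \<mu>_ext_new_le[OF r5]) auto
    also have "\<dots> = real (r - 1 - 2) * eta" by simp
    also have "\<dots> \<le> real r * eta" by (intro mult_right_mono) auto
    finally show ?thesis using \<mu>_ext_last_le[OF assms(2)] by linarith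
  qed
  have ss: "sqrt \<mu> * \<beta> \<le> real r * eta"
  proof -
    have "sqrt \<mu> * \<beta> = (\<Sum>s\<in>{2..<r}. sqrt \<mu> * ext s)" by (simp add: \<beta>_eq sum_distrib_left)
    also have "\<dots> \<le> (\<Sum>s\<in>{2..<r}. eta)" by (intro sum_mono sqrt_\<mu>_ext_le[OF r5])
    also have "\<dots> = real (r - 2) * eta" by simp
    also have "\<dots> \<le> real r * eta" by (intro mult_right_mono) auto
    finally show ?thesis .
  qed
  have "real r \<le> real r ^ 2" using r5 by (simp add: power2_eq_square)
  then have rr: "real r * eta \<le> real r ^ 2 * eta" by (intro mult_right_mono) auto
  have "\<mu> * \<kappa> = \<mu> * (\<beta> * \<beta>) + \<mu> * (\<Sum>s\<in>{2..<r}. ext s * p ^ max 1 (r - s - 1))"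
    unfolding \<kappa>_eq by (rule distrib_left)
  then have "\<mu> * \<kappa> + p ^ (r - 1) * (\<mu> * \<beta>) + sqrt \<mu> * \<beta>
    \<le> real (r + 1) ^ (r + 1) * mu (r + 1) n p + 4 * (real r ^ 2 * eta)"
    using bb nn ss rr \<delta>\<mu>\<beta>_le by linarith
  moreover have "0 \<le> 4 * (real r ^ 2 * mu (r + 1) n p)" "0 \<le> real (r + 1) ^ (r + 1) * eta"
    using mu0 eta0 by simp_all
  moreover have "(A + 4 * B) * (m + h) = A * m + 4 * (B * m) + A * h + 4 * (B * h)" for A B m h :: real
    by (simp add: algebra_simps)
  moreover have "L \<le> a + 4 * d + b + 4 * c" if "L \<le> a + 4 * c" "0 \<le> 4 * d" "0 \<le> b" for L a b c d :: real
    using that by linarith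
  ultimately show ?thesis unfolding xi by metis
qed

lemma error_constant_ge:
  assumes "0 \<le> x"
  shows "8 * (x + eta) \<le> (real (r + 1) ^ (r + 1) + 4 * real r ^ 2) * (x + eta)"
proof (rule mult_right_mono)
  have "(3::real)\<^sup>2 \<le> real r ^ 2" using r3 by (intro power_mono) auto
  then have "8 \<le> 4 * real r ^ 2" by simp
  moreover have "0 \<le> real (r + 1) ^ (r + 1)" by (rule zero_le_power) simp
  ultimately show "8 \<le> real (r + 1) ^ (r + 1) + 4 * real r ^ 2" by linarith
qed (use assms in simp)

text \<open>For r = 4 the relevant monomials are powers of z = n p^2, which is 1 at p = n powr
  (-2/r), so none of them is negligible. They range from z^3, coming from sqrt \<mu> * \<beta>, to
  z^8, coming from \<mu> * \<beta> * \<beta>; the two extremes dominate the rest and form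
  \<xi>.\<close>

lemma error_le_4:
  assumes r4: "r = 4"
  shows "\<mu> * \<kappa> + p ^ (r - 1) * (\<mu> * \<beta>) + sqrt \<mu> * \<beta>
    \<le> (real (r + 1) ^ (r + 1) + 4 * real r ^ 2) * (xi r n p + eta)"
proof -
  define z where "z = real n * p\<^sup>2"
  have z0: "0 \<le> z" by (simp add: z_def)
  have nz: "0 \<le> real n" and pz: "0 \<le> p" using p0 by auto
  have C: "(4::nat) choose 2 = 6" "(3::nat) choose 2 = 3" "(2::nat) choose 2 = 1" by (simp_all add: numeral_eq_Suc)
  have set: "{2..<r} = {2, 3}" using r4 by auto
  have ext: "ext 2 = real n ^ 2 * p ^ 5" "ext 3 = real n * p ^ 3" unfolding ext_def by (simp_all add: r4 C)
  have b: "\<beta> = real n ^ 2 * p ^ 5 + real n * p ^ 3" by (simp add: \<beta>_eq set ext)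
  have k: "\<kappa> = \<beta> * \<beta> + (real n ^ 2 * p ^ 6 + real n * p ^ 4)"
  proof -
    have "(\<Sum>s\<in>{2, 3::nat}. f s) = f 2 + f 3" for f :: "nat \<Rightarrow> real" by simp
    moreover have "max 1 (r - 2 - 1) = 1" "max 1 (r - 3 - 1) = 1" using r4 by auto
    ultimately show ?thesis unfolding \<kappa>_eq set ext by (simp only: ext) (simp add: eval_nat_numeral)
  qed
  have m: "\<mu> \<le> real n ^ 4 * p ^ 6" using \<mu>_le by (simp add: r4 C)
  have m': "sqrt \<mu> \<le> real n ^ 2 * p ^ 3"
    using m p0 by (intro real_le_lsqrt) (auto simp: power_mult_distrib power_mult[symmetric])
  have pw: "z ^ i = real n ^ i * p ^ (2 * i)" for i by (simp add: z_def power_mult_distrib power_mult)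
  have zi: "z ^ i \<le> z ^ 3 + z ^ 8" if "3 \<le> i" "i \<le> 8" for i
  proof (cases "z \<le> 1")
    case True
    then have "z ^ i \<le> z ^ 3" using that z0 by (intro power_decreasing) auto
    then show ?thesis using z0 by (simp add: add_increasing2)
  next
    case False
    then have "z ^ i \<le> z ^ 8" using that by (intro power_increasing) auto
    then show ?thesis using z0 by (simp add: add_increasing)
  qed
  have xi: "xi r n p = z ^ 3 + z ^ 8" unfolding pw by (simp add: xi_def r4)
  have "\<mu> * \<kappa> \<le> (real n ^ 4 * p ^ 6) * \<kappa>" using m \<kappa>_nonneg by (rule mult_right_mono)
  also have "\<dots> = z ^ 8 + 2 * z ^ 7 + 2 * z ^ 6 + z ^ 5"
    unfolding k b pw by (simp add: algebra_simps eval_nat_numeral)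
  finally have "\<mu> * \<kappa> \<le> z ^ 8 + 2 * z ^ 7 + 2 * z ^ 6 + z ^ 5" .
  moreover have "z ^ 8 \<le> z ^ 3 + z ^ 8" "z ^ 7 \<le> z ^ 3 + z ^ 8" "z ^ 6 \<le> z ^ 3 + z ^ 8"
    "z ^ 5 \<le> z ^ 3 + z ^ 8" and z4: "z ^ 4 \<le> z ^ 3 + z ^ 8" and z3: "z ^ 3 \<le> z ^ 3 + z ^ 8"
    by (rule zi; simp)+
  moreover have "m \<le> 6 * e" if "m \<le> a + 2 * b + 2 * c + d" "a \<le> e" "b \<le> e" "c \<le> e" "d \<le> e"
    for m a b c d e :: real
    using that by linarith
  ultimately have 1: "\<mu> * \<kappa> \<le> 6 * xi r n p" unfolding xi by blast
  have "sqrt \<mu> * \<beta> \<le> (real n ^ 2 * p ^ 3) * \<beta>" using m' \<beta>_nonneg by (rule mult_right_mono)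
  also have "\<dots> = z ^ 4 + z ^ 3" unfolding b pw by (simp add: algebra_simps eval_nat_numeral)
  finally have 2: "sqrt \<mu> * \<beta> \<le> 2 * xi r n p" using z4 z3 unfolding xi by argo
  have 3: "p ^ (r - 1) * (\<mu> * \<beta>) \<le> 4 * eta" using \<delta>\<mu>\<beta>_le by (simp add: r4)
  have "0 \<le> xi r n p" unfolding xi using z0 by simp
  moreover have "0 \<le> eta" by simp
  moreover have "8 * (xi r n p + eta) \<le> (real (r + 1) ^ (r + 1) + 4 * real r ^ 2) * (xi r n p + eta)"
    using \<open>0 \<le> xi r n p\<close> by (rule error_constant_ge)
  ultimately show ?thesis using 1 2 3 by argo
qed

text \<open>For r = 3 both main terms are governed by n^5 p^7: it bounds \<mu> * \<beta> * \<beta>,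
  and its square root bounds sqrt \<mu> * \<beta>. The remaining n^4 p^6, three triangles inside
  K_4, is smaller because \<mu> >= 1 forces n p >= 1.\<close>

lemma error_le_3:
  assumes r3': "r = 3" and "1 \<le> \<mu>"
  shows "\<mu> * \<kappa> + p ^ (r - 1) * (\<mu> * \<beta>) + sqrt \<mu> * \<beta>
    \<le> (real (r + 1) ^ (r + 1) + 4 * real r ^ 2) * (xi r n p + eta)"
proof -
  have C: "(3::nat) choose 2 = 3" "(2::nat) choose 2 = 1" by (simp_all add: numeral_eq_Suc)
  have set: "{2..<r} = {2}" using r3' by auto
  have ext: "ext 2 = real n * p ^ 2" unfolding ext_def by (simp add: r3' C)
  have b: "\<beta> = real n * p ^ 2" by (simp add: \<beta>_eq set ext)
  have k: "\<kappa> = \<beta> * \<beta> + real n * p ^ 3"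
  proof -
    have "max 1 (r - 2 - 1) = 1" using r3' by auto
    moreover have "(\<Sum>s\<in>{2::nat}. f s) = f 2" for f :: "nat \<Rightarrow> real" by simp
    ultimately show ?thesis unfolding \<kappa>_eq set by (simp only: ext) (simp add: eval_nat_numeral)
  qed
  have m: "\<mu> \<le> real n ^ 3 * p ^ 3" using \<mu>_le by (simp add: r3' C)
  define x where "x = real n ^ 5 * p ^ 7"
  have x0: "0 \<le> x" using p0 by (simp add: x_def)
  have np: "1 \<le> real n * p"
  proof (rule ccontr)
    assume "\<not> 1 \<le> real n * p"
    then have "(real n * p) ^ 3 < 1" using p0 by (simp add: power_less_one_iff)
    then show False using m assms(2) by (simp add: power_mult_distrib)
  qed
  have xi: "xi r n p = x + sqrt x" by (simp add: xi_def r3' x_def)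
  have "\<mu> * \<kappa> \<le> (real n ^ 3 * p ^ 3) * \<kappa>" using m \<kappa>_nonneg by (rule mult_right_mono)
  also have "\<dots> = x + 1 * (real n ^ 4 * p ^ 6)" unfolding k b x_def by (simp add: algebra_simps eval_nat_numeral)
  also have "\<dots> \<le> x + (real n * p) * (real n ^ 4 * p ^ 6)" using np p0 by (intro add_left_mono mult_right_mono) auto
  also have "\<dots> = 2 * x" unfolding x_def by (simp add: algebra_simps eval_nat_numeral)
  finally have 1: "\<mu> * \<kappa> \<le> 2 * x" .
  have "sqrt \<mu> * \<beta> = sqrt (\<mu> * \<beta>\<^sup>2)" using \<beta>_nonneg by (simp add: real_sqrt_mult)
  also have "\<dots> \<le> sqrt ((real n ^ 3 * p ^ 3) * \<beta>\<^sup>2)" using m by (intro real_sqrt_le_mono mult_right_mono) auto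
  also have "(real n ^ 3 * p ^ 3) * \<beta>\<^sup>2 = x" unfolding b x_def by (simp add: algebra_simps eval_nat_numeral)
  finally have 2: "sqrt \<mu> * \<beta> \<le> sqrt x" .
  have 3: "p ^ (r - 1) * (\<mu> * \<beta>) \<le> 3 * eta" using \<delta>\<mu>\<beta>_le by (simp add: r3')
  have "0 \<le> sqrt x" "0 \<le> eta" using x0 by auto
  moreover have "8 * (x + sqrt x + eta) \<le> (real (r + 1) ^ (r + 1) + 4 * real r ^ 2) * (x + sqrt x + eta)"
    using x0 by (intro error_constant_ge) simp
  ultimately show ?thesis using 1 2 3 x0 unfolding xi by argo
qed

lemma error_le:
  assumes "r < n" "1 \<le> \<mu>"
  shows "\<mu> * \<kappa> + p ^ (r - 1) * (\<mu> * \<beta>) + sqrt \<mu> * \<beta>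
    \<le> (real (r + 1) ^ (r + 1) + 4 * real r ^ 2) * (xi r n p + eta)"
proof -
  consider "r = 3" | "r = 4" | "5 \<le> r" using r3 by linarith
  then show ?thesis using error_le_3 error_le_4 error_le_5 assms by cases auto
qed

end

text \<open>It depends on r alone, so it can be fixed before p, as the order of quantifiers in the
  theorem demands.\<close>

definition error_const :: real where
  "error_const = (4 * CH_const + 4 * 2 ^ (3 * r) + 12) * 2 ^ (3 * r) * (real (r + 1) ^ (r + 1) + 4 * real r ^ 2)"

lemma prob_of_good_asymp:
  assumes n: "r < n" and p: "p \<le> real n powr (- 2 / real r + gam r)"
    and w: "1 \<le> w" "w \<le> sqrt (mu r n p)" "w \<le> real n powr gam r" and b: "\<beta> \<le> 1"
    and g: "good r n p w H"
  shows "\<exists>\<epsilon>. \<bar>\<epsilon>\<bar> \<le> error_const * (w * xi r n p + real n powr (- gam r)) \<and>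
    measure_pmf.prob (gnp n p) {G. cl G = H} =
      (p ^ (r choose 2)) ^ card H * (1 - p ^ (r choose 2)) ^ ((n choose r) - card H) * p powi (- tH r H) *
      exp (- Delta2 r n p + Delta2_0 r n p + \<epsilon>)"
proof -
  let ?K1 = "(4 * CH_const + 4 * 2 ^ (3 * r) + 12) * 2 ^ (3 * r)" and ?K2 = "real (r + 1) ^ (r + 1) + 4 * real r ^ 2"
  let ?\<eta> = "real n powr (- 2 * gam r)"
  have n1: "1 \<le> n" using n by simp
  have "w\<^sup>2 \<le> (sqrt \<mu>)\<^sup>2" using w by (intro power_mono) (auto simp: mu_eq)
  then have w2: "w\<^sup>2 \<le> \<mu>" using \<mu>_nonneg by simp
  have "1\<^sup>2 \<le> w\<^sup>2" using w by (intro power_mono) auto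
  then have mu1: "1 \<le> \<mu>" using w2 by simp
  have ec0: "0 \<le> CH_const" using family_factor_ge_1 by (simp add: CH_const_def)
  have K1: "0 \<le> ?K1" using ec0 by simp
  have K2: "0 \<le> ?K2" by simp
  obtain \<epsilon> where \<epsilon>: "\<bar>\<epsilon>\<bar> \<le> ?K1 * (w * (\<mu> * \<kappa> + p ^ (r - 1) * (\<mu> * \<beta>) + sqrt \<mu> * \<beta>))"
    and P: "measure_pmf.prob (gnp n p) {G. cl G = H} =
      \<pi> ^ card H * (1 - \<pi>) ^ ((n choose r) - card H) * p powi (- tH r H) *
      exp (- Delta2 r n p + Delta2_0 r n p + \<epsilon>)"
    using prob_of_good[OF g w(1) w2 less_imp_le[OF n] b] by blast
  have "w * ?\<eta> \<le> real n powr gam r * ?\<eta>" using w(3) by (rule mult_right_mono) simp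
  also have "\<dots> = real n powr (- gam r)" by (simp add: powr_add[symmetric])
  finally have w\<eta>: "w * ?\<eta> \<le> real n powr (- gam r)" .
  note \<epsilon>
  also have "?K1 * (w * (\<mu> * \<kappa> + p ^ (r - 1) * (\<mu> * \<beta>) + sqrt \<mu> * \<beta>)) \<le> ?K1 * (w * (?K2 * (xi r n p + ?\<eta>)))"
    using K1 w error_le[OF n1 p n mu1] by (intro mult_left_mono) auto
  also have "\<dots> = error_const * (w * xi r n p + w * ?\<eta>)" unfolding error_const_def by (simp add: algebra_simps)
  also have "\<dots> \<le> error_const * (w * xi r n p + real n powr (- gam r))"
    using w\<eta> K1 K2 unfolding error_const_def by (intro mult_left_mono add_left_mono) auto
  finally show ?thesis using P unfolding \<pi>_def by blast
qed

end

section \<open>Choice of \<gamma>, of the constant and of the largest admissible growth rate\<close>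

theorem theorem6p2:
  fixes r :: nat
  assumes "3 \<le> r"
  shows "\<exists>\<gamma>::real. \<gamma> > 0 \<and> (\<exists>C::real. \<forall>p :: nat \<Rightarrow> real.
    (\<forall>n. 0 \<le> p n \<and> p n \<le> 1) \<longrightarrow>
    (\<forall>\<^sub>F n in sequentially. p n \<le> real n powr (- 2 / real r + \<gamma>)) \<longrightarrow>
    filterlim (\<lambda>n. mu r n (p n)) at_top sequentially \<longrightarrow>
    (\<exists>\<omega>\<^sub>0 :: nat \<Rightarrow> real. filterlim \<omega>\<^sub>0 at_top sequentially \<and>
      (\<forall>\<omega> :: nat \<Rightarrow> real. filterlim \<omega> at_top sequentially \<longrightarrow>
        (\<forall>\<^sub>F n in sequentially. \<omega> n \<le> \<omega>\<^sub>0 n) \<longrightarrow>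
        (\<forall>\<^sub>F n in sequentially. \<forall>H. good r n (p n) (\<omega> n) H \<longrightarrow>
          (\<exists>\<epsilon>::real. \<bar>\<epsilon>\<bar> \<le> C * (\<omega> n * xi r n (p n) + real n powr (- \<gamma>)) \<and>
            measure_pmf.prob (gnp n (p n)) {G. clique_hypergraph r n G = H} =
              (p n ^ (r choose 2)) ^ card H *
              (1 - p n ^ (r choose 2)) ^ ((n choose r) - card H) *
              p n powi (- tH r H) *
              exp (- Delta2 r n (p n) + Delta2_0 r n (p n) + \<epsilon>))) \<and>
        (\<lambda>n. measure_pmf.prob (gnp n (p n))
               {G. good r n (p n) (\<omega> n) (clique_hypergraph r n G)}) \<longlonglongrightarrow> 1)))"
proof (rule exI[of _ "gam r"], intro conjI, goal_cases)
  case 1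
  show ?case using assms by (simp add: gam_def)
next
  case 2
  have gam: "0 < gam r" using assms by (simp add: gam_def)
  have exponent_neg: "- 2 / real r + gam r < 0"
  proof -
    have "real r \<le> real r ^ 3" using assms by (intro self_le_power) auto
    then have "real r \<le> 5 * real r ^ 3" by linarith
    then have "gam r \<le> 1 / real r" unfolding gam_def using assms by (intro divide_left_mono) auto
    also have "\<dots> < 2 / real r" using assms by (simp add: divide_strict_right_mono)
    finally show ?thesis by simp
  qed
  show ?case
  proof (rule exI[of _ "clique_setting.error_const r"], intro allI impI, goal_cases)
    case (1 p)
    note p01 = 1(1) and p_le = 1(2) and mu_top = 1(3)
    \<comment> \<open>The first bound is the condition w^2 <= \<mu>; the second lets the error w * n
      powr (-2 \<open>gam r\<close>) be absorbed into n powr (- \<open>gam r\<close>).\<close>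
    define \<omega>\<^sub>0 where "\<omega>\<^sub>0 n = min (sqrt (mu r n (p n))) (real n powr gam r)" for n
    have "filterlim (\<lambda>n. real n powr gam r) at_top sequentially"
      using gam by real_asymp
    moreover have "filterlim (\<lambda>n. sqrt (mu r n (p n))) at_top sequentially"
      by (rule filterlim_compose[OF sqrt_at_top mu_top])
    ultimately have \<omega>\<^sub>0: "filterlim \<omega>\<^sub>0 at_top sequentially"
      unfolding filterlim_at_top \<omega>\<^sub>0_def by (auto intro: eventually_conj)
    have setting: "\<forall>\<^sub>F n in sequentially. clique_setting r (p n) \<and> r < n
        \<and> p n \<le> real n powr (- 2 / real r + gam r) \<and> 2 ^ r * clique_setting.\<beta> r n (p n) \<le> 1"
    proof -
      have "(\<lambda>n. real n powr (- 2 / real r + gam r)) \<longlonglongrightarrow> 0"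
        using exponent_neg by real_asymp
      then have 1: "\<forall>\<^sub>F n in sequentially. real n powr (- 2 / real r + gam r) < 1/2"
        by (rule order_tendstoD) simp
      have "(\<lambda>n. 2 ^ r * real r * real n powr (- 4 * gam r)) \<longlonglongrightarrow> 0"
        using gam by real_asymp
      then have 2: "\<forall>\<^sub>F n in sequentially. 2 ^ r * real r * real n powr (- 4 * gam r) < 1"
        by (rule order_tendstoD) simp
      have 3: "\<forall>\<^sub>F n in sequentially. 1 \<le> mu r n (p n)"
        using mu_top by (simp add: filterlim_at_top)
      show ?thesis
        using 1 2 3 p_le eventually_gt_at_top[of r]
      proof eventually_elim
        case (elim n)
        \<comment> \<open>The theorem allows p = 0, but then \<open>mu\<close> would vanish,
          contrary to its being at least 1.\<close>
        have "p n \<noteq> 0"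
        proof
          assume "p n = 0"
          then show False using elim(3) assms by (simp add: mu_def power_0_left binomial_eq_0_iff)
        qed
        then interpret clique_setting r n "p n"
          using p01 elim assms by unfold_locales (auto simp: less_le)
        \<comment> \<open>As \<beta> tends to 0, \<open>B2\<close> is eventually at most 1. The
          variance bound needs this, and it also yields \<beta> <= 1 for the estimates of
          \<open>Q4\<close> and \<open>CH\<close>.\<close>
        have "B2 \<le> 2 ^ r * (real r * real n powr (- 4 * gam r))"
          using \<beta>_le elim by (intro mult_left_mono) auto
        then have "B2 \<le> 1" using elim(2) by argo
        then show ?case using elim clique_setting_axioms by blast
      qed
    qed
    have \<omega>2: "\<forall>\<^sub>F n in sequentially. 2 \<le> \<omega> n" if "filterlim \<omega> at_top sequentially"
      for \<omega> :: "nat \<Rightarrow> real"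
      using that by (simp add: filterlim_at_top)
    show ?case
    proof (intro exI[of _ \<omega>\<^sub>0] conjI allI impI \<omega>\<^sub>0, goal_cases)
      case (1 \<omega>)
      show ?case
        using setting 1(2) \<omega>2[OF 1(1)]
      proof eventually_elim
        case (elim n)
        interpret clique_setting r n "p n" using elim by simp
        have "1 * \<beta> \<le> B2" using \<beta>_nonneg by (intro mult_right_mono) auto
        then have "\<beta> \<le> 1" using elim by linarith
        then show ?case using elim by (intro allI impI prob_of_good_asymp) (auto simp: \<omega>\<^sub>0_def)
      qed
    next
      case (2 \<omega>)
      have lower: "\<forall>\<^sub>F n in sequentially. 1 - 5 / \<omega> n \<le> measure_pmf.prob (gnp n (p n))
               {G. good r n (p n) (\<omega> n) (clique_hypergraph r n G)}"
        using setting \<omega>2[OF 2(1)]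
      proof eventually_elim
        case (elim n)
        interpret clique_setting r n "p n" using elim by simp
        show ?case using elim by (intro prob_good_ge) auto
      qed
      have lim: "(\<lambda>n. 1 - 5 / \<omega> n) \<longlonglongrightarrow> 1"
      proof -
        have "(\<lambda>n. 5 / \<omega> n) \<longlonglongrightarrow> 0"
          by (rule real_tendsto_divide_at_top[OF tendsto_const 2(1)])
        from tendsto_diff[OF tendsto_const[of 1] this] show ?thesis by simp
      qed
      show ?case
        by (rule tendsto_sandwich[OF lower _ lim tendsto_const]) (simp add: measure_pmf.prob_le_1)
    qed
  qed
qed

end
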